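(* Let $\mathsf{A}(t',t)=\widetilde{\mathsf{A}}(t')\Theta(t'-t)$ be an $N\times N$ complex time-dependent matrix with entries in $\mathrm{Sm}_\Theta(I)$ and let $\boldsymbol{v},\boldsymbol{w}\in\mathbb{C}^N$ be time-independent vectors with $\boldsymbol{w}^H\boldsymbol{v}=1$. Assume that the $\ast$-Lanczos algorithm run on $(\mathsf{A},\boldsymbol{w},\boldsymbol{v})$ satisfies the no-breakdown assumption for the coefficients $\beta_1,\dots,\beta_{N-1}$, and let $\mathsf{T}_N$, $\mathsf{V}_N=[\boldsymbol{v}_0,\dots,\boldsymbol{v}_{N-1}]$ and $\mathsf{W}_N=[\boldsymbol{w}_0,\dots,\boldsymbol{w}_{N-1}]$ be the $N\times N$ matrices it produces. Then $$\mathsf{A}^{\ast j}=\mathsf{V}_N\ast\mathsf{T}_N^{\ast j}\ast\mathsf{W}_N^H,\qquad j=0,1,\dots,$$ and thus $$\mathsf{R}_\ast(\mathsf{A})=\mathsf{V}_N\ast\mathsf{R}_\ast(\mathsf{T}_N)\ast\mathsf{W}_N^H .$$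
   Context: Let $I\subseteq\mathbb{R}$ be an interval and $t',t$ real variables in $I$. Distributions and the $\ast$-product. $\mathrm{D}(I)$ is the class of distributions of the form $d(t',t)=\widetilde d(t',t)\Theta(t'-t)+\sum_{i=0}^{M}\widetilde d_i(t',t)\delta^{(i)}(t'-t)$ with $M$ finite and $\widetilde d,\widetilde d_i$ smooth functions on $I^2$; $\Theta$ is the Heaviside function with $\Theta(0)=1$ and $\delta^{(i)}$ is the $i$-th derivative of the Dirac delta. $\mathrm{Sm}_\Theta(I)\subset \mathrm{D}(I)$ is the subclass of those of the form $\widetilde f(t',t)\Theta(t'-t)$. The (non-commutative, associative) $\ast$-product on $\mathrm{D}(I)$ is $(f_2\ast f_1)(t',t)=\int_{-\infty}^{\infty}f_2(t',\tau)f_1(\tau,t)\,d\tau$ (in the sense of distributions); on $\mathrm{Sm}_\Theta(I)$ it equals $\Theta(t'-t)\int_t^{t'}\widetilde f_2(t',\tau)\widetilde f_1(\tau,t)\,d\tau$. For $f(t',t)=\widetilde f(t',t)\Theta(t'-t)$ one has $f\ast\delta'=-(\partial_t\widetilde f)\Theta(t'-t)+\widetilde f(t',t')\delta(t'-t)$ and $\delta'\ast f=(\partial_{t'}\widetilde f)\Theta(t'-t)+\widetilde f(t,t)\delta(t'-t)$, and $\delta^{(i)}\ast\delta^{(j)}=\delta^{(i+j)}$. The identity is $1_\ast=\delta(t'-t)$. The product extends to matrices and vectors with entries in $\mathrm{D}(I)$ by the usual row-by-column rule, with identity $\mathrm{Id}_\ast=\mathrm{Id}\,1_\ast$; $\mathsf{M}^{\ast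 j}$ is the $j$-th $\ast$-power, with $\mathsf{M}^{\ast 0}=\mathrm{Id}_\ast$. When no product symbol is written between a time-independent vector and a matrix, it is the usual matrix-vector product. The $\ast$-inverse $f^{\ast-1}$ satisfies $f^{\ast-1}\ast f=f\ast f^{\ast-1}=1_\ast$ (with $\mathrm{Id}_\ast$ for matrices). The $\ast$-resolvent of a matrix $\mathsf{M}$ is $\mathsf{R}_\ast(\mathsf{M})=(\mathrm{Id}_\ast-\mathsf{M})^{\ast-1}=\mathrm{Id}_\ast+\sum_{k\ge1}\mathsf{M}^{\ast k}$. The $\ast$-Lanczos algorithm. Input: $\mathsf{A},\boldsymbol{w},\boldsymbol{v}$. Set $\boldsymbol{v}_{-1}=\boldsymbol{w}_{-1}=0$, $\boldsymbol{v}_0=\boldsymbol{v}\,1_\ast$, $\boldsymbol{w}_0^H=\boldsymbol{w}^H1_\ast$. For $k=1,2,\dots$ define $$\alpha_{k-1}=\boldsymbol{w}_{k-1}^H\ast\mathsf{A}\ast\boldsymbol{v}_{k-1},\qquad \boldsymbol{w}_k^H=\boldsymbol{w}_{k-1}^H\ast\mathsf{A}-\alpha_{k-1}\ast\boldsymbol{w}_{k-1}^H-\beta_{k-1}\ast\boldsymbol{w}_{k-2}^H,$$ $$\widehat{\boldsymbol{v}}_k=\mathsf{A}\ast\boldsymbol{v}_{k-1}-\boldsymbol{v}_{k-1}\ast\alpha_{k-1}-\boldsymbol{v}_{k-2},\qquad \beta_k=\boldsymbol{w}_k^H\ast\mathsf{A}\ast\boldsymbol{v}_{k-1},\qquad \boldsymbol{v}_k=\widehat{\boldsymbol{v}}_k\ast\beta_k^{\ast-1},$$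 where for $k=1$ the terms with index $-1$ are absent. (Here $\boldsymbol{w}_k^H$ denotes a row vector of distributions, and $\mathsf{W}_N^H$ is the matrix whose rows are $\boldsymbol{w}_0^H,\dots,\boldsymbol{w}_{N-1}^H$.) The matrix $\mathsf{T}_n$ is the $n\times n$ tridiagonal matrix with diagonal entries $\alpha_0,\dots,\alpha_{n-1}$, all superdiagonal entries equal to $1_\ast$, and subdiagonal entries $\beta_1,\dots,\beta_{n-1}$. No-breakdown assumption for $\beta_1,\dots,\beta_{n-1}$: each $\beta_j$, $1\le j\le n-1$, is $\ast$-invertible, with inverse in $\mathrm{D}(I)$, and $\beta_j^{(1,0)}(t,t)\neq0$ for every $t\in I$, where $\beta_j^{(1,0)}(t',t)=\frac{\partial}{\partial t}\beta_j(t',t)$ (the derivative being taken of the smooth coefficient of $\Theta(t'-t)$; it is known that under this condition all coefficients involved lie in $\mathrm{Sm}_\Theta(I)$). *)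

theory Defs
  imports "HOL-Analysis.Analysis" "HOL-Library.Function_Algebras" "Jordan_Normal_Form.Matrix"
begin

no_notation vec_nth (infixl "$" 90)

section \<open>The class D(I) and the star product\<close>

text \<open>
  A distribution d(t',t) in two variables is represented by its partial pairing in the second
  variable: the kernel \<open>d :: distr\<close> sends \<open>t'\<close> and a test function \<open>h\<close> to the value
  of the (formal) integral of d(t',t) h(t) over t.  The pairing with a two-variable test function
  \<open>\<phi>\<close> is the integral of \<open>d t' (\<phi> t')\<close> over t'.  Sums, differences and the zero of distributions
  are the pointwise ones of \<open>Function_Algebras\<close>.
\<close>

type_synonym distr = "real \<Rightarrow> (real \<Rightarrow> complex) \<Rightarrow> complex"

text \<open>
  Smoothness on the square \<open>I \<times> I\<close>: all iterated partial derivatives (one-sided at the endpoints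
  that belong to \<open>I\<close>) exist and are continuous; \<open>F i j\<close> is the derivative of order \<open>i\<close> in the
  first and \<open>j\<close> in the second variable.
\<close>

definition smooth2_on :: "real set \<Rightarrow> (real \<Rightarrow> real \<Rightarrow> complex) \<Rightarrow> bool" where
  "smooth2_on I f \<longleftrightarrow> (\<exists>F :: nat \<Rightarrow> nat \<Rightarrow> real \<Rightarrow> real \<Rightarrow> complex.
     (\<forall>x\<in>I. \<forall>y\<in>I. F 0 0 x y = f x y) \<and>
     (\<forall>i j. continuous_on (I \<times> I) (\<lambda>(x, y). F i j x y)) \<and>
     (\<forall>i j. \<forall>x\<in>I. \<forall>y\<in>I.
        ((\<lambda>s. F i j s y) has_vector_derivative F (Suc i) j x y) (at x within I) \<and>
        ((\<lambda>s. F i j x s) has_vector_derivative F i (Suc j) x y) (at y within I)))"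

definition vderiv :: "(real \<Rightarrow> complex) \<Rightarrow> real \<Rightarrow> complex" where
  "vderiv f = (\<lambda>t. vector_derivative f (at t))"

text \<open>
  Test functions: smooth on the interior of \<open>I\<close> and vanishing near its left end.  No condition
  is imposed at the right end: for each \<open>t'\<close> the distribution d(t',.) is supported in
  \<open>t \<le> t'\<close>, so it extends uniquely from compactly supported smooth functions to these functions,
  and, unlike the compactly supported ones, they are preserved by the action of D(I).
\<close>

definition test_fun :: "real set \<Rightarrow> (real \<Rightarrow> complex) set" where
  "test_fun I = {h.
     (\<forall>n. \<forall>t\<in>interior I. (vderiv ^^ n) h differentiable (at t)) \<and>
     (\<exists>a\<in>interior I. \<forall>t\<in>interior I. t < a \<longrightarrow> h t = 0)}"

text \<open>
  The distribution \<open>f(t',t) \<Theta>(t'-t) + (\<Sum>i\<le>M. c\<^sub>i(t',t) \<delta>\<^sup>(\<^sup>i\<^sup>)(t'-t))\<close>.  As functions of \<open>t\<close>, the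
  \<open>i\<close>-th derivative of \<open>\<delta>(t'-t)\<close> is \<open>(-1)^i\<close> times \<open>\<delta>\<^sup>(\<^sup>i\<^sup>)(t'-t)\<close>; hence pairing \<open>\<delta>\<^sup>(\<^sup>i\<^sup>)(t'-t)\<close> with
  \<open>g(t)\<close> gives the \<open>i\<close>-th derivative of \<open>g\<close> at \<open>t'\<close>, without a sign.  Kernels are set to 0 outside
  their domain, so that equality of distributions on \<open>I\<close> is plain equality.
\<close>

definition dform ::
    "real set \<Rightarrow> (real \<Rightarrow> real \<Rightarrow> complex) \<Rightarrow> nat \<Rightarrow> (nat \<Rightarrow> real \<Rightarrow> real \<Rightarrow> complex) \<Rightarrow> distr" where
  "dform I f M c = (\<lambda>t' h. if t' \<in> interior I \<and> h \<in> test_fun I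
     then integral {t \<in> interior I. t \<le> t'} (\<lambda>t. f t' t * h t)
          + (\<Sum>i\<le>M. (vderiv ^^ i) (\<lambda>t. c i t' t * h t) t')
     else 0)"

definition D_class :: "real set \<Rightarrow> distr set" where
  "D_class I = {d. \<exists>f M c. smooth2_on I f \<and> (\<forall>i\<le>M. smooth2_on I (c i)) \<and> d = dform I f M c}"

definition theta :: "real set \<Rightarrow> (real \<Rightarrow> real \<Rightarrow> complex) \<Rightarrow> distr" where
  "theta I f = dform I f 0 (\<lambda>i t' t. 0)"

definition const_delta :: "real set \<Rightarrow> complex \<Rightarrow> distr" where
  "const_delta I z = dform I (\<lambda>t' t. 0) 0 (\<lambda>i t' t. z)"

abbreviation one_star :: "real set \<Rightarrow> distr" where
  "one_star I \<equiv> const_delta I 1"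

text \<open>
  The integral of \<open>f\<^sub>2(t',\<tau>) f\<^sub>1(\<tau>,t)\<close> over \<open>\<tau>\<close>, paired with \<open>h(t)\<close>: \<open>f\<^sub>2(t',.)\<close> is applied to the
  function that sends \<open>\<tau>\<close> to the pairing of \<open>f\<^sub>1(\<tau>,.)\<close> with \<open>h\<close>.
\<close>

definition star :: "distr \<Rightarrow> distr \<Rightarrow> distr" (infixl "\<star>" 70) where
  "f2 \<star> f1 = (\<lambda>t' h. f2 t' (\<lambda>\<tau>. f1 \<tau> h))"

definition is_star_inverse :: "real set \<Rightarrow> distr \<Rightarrow> distr \<Rightarrow> bool" where
  "is_star_inverse I f g \<longleftrightarrow>
     f \<in> D_class I \<and> g \<in> D_class I \<and> g \<star> f = one_star I \<and> f \<star> g = one_star I"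

definition star_inverse :: "real set \<Rightarrow> distr \<Rightarrow> distr" where
  "star_inverse I f = (THE g. is_star_inverse I f g)"

text \<open>
  \<open>b\<close> is a smooth coefficient of \<open>\<Theta>(t'-t)\<close> in \<open>d\<close>.  It is determined by \<open>d\<close> only for
  \<open>t \<le> t'\<close>; by smoothness this also determines its partial derivatives on the diagonal.
\<close>

definition theta_coeff :: "real set \<Rightarrow> distr \<Rightarrow> (real \<Rightarrow> real \<Rightarrow> complex) \<Rightarrow> bool" where
  "theta_coeff I d b \<longleftrightarrow> smooth2_on I b \<and>
     (\<exists>M c. (\<forall>i\<le>M. smooth2_on I (c i)) \<and> d = dform I b M c)"


section \<open>Vectors and matrices of distributions\<close>

definition vdot :: "distr vec \<Rightarrow> distr vec \<Rightarrow> distr" (infixl "\<star>\<^sub>v\<^sub>v" 70) where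
  "x \<star>\<^sub>v\<^sub>v y = (\<Sum>i<dim_vec y. vec_index x i \<star> vec_index y i)"

definition vec_mat_star :: "distr vec \<Rightarrow> distr mat \<Rightarrow> distr vec" (infixl "\<star>\<^sub>v\<^sub>m" 70) where
  "x \<star>\<^sub>v\<^sub>m M = Matrix.vec (dim_col M) (\<lambda>j. x \<star>\<^sub>v\<^sub>v col M j)"

definition mat_vec_star :: "distr mat \<Rightarrow> distr vec \<Rightarrow> distr vec" (infixl "\<star>\<^sub>m\<^sub>v" 70) where
  "M \<star>\<^sub>m\<^sub>v y = Matrix.vec (dim_row M) (\<lambda>i. Matrix.row M i \<star>\<^sub>v\<^sub>v y)"

definition mat_star :: "distr mat \<Rightarrow> distr mat \<Rightarrow> distr mat" (infixl "\<star>\<^sub>m\<^sub>m" 70) where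
  "M \<star>\<^sub>m\<^sub>m P = Matrix.mat (dim_row M) (dim_col P) (\<lambda>(i, j). Matrix.row M i \<star>\<^sub>v\<^sub>v col P j)"

definition lscale :: "distr \<Rightarrow> distr vec \<Rightarrow> distr vec" (infixl "\<star>\<^sub>s\<^sub>v" 70) where
  "a \<star>\<^sub>s\<^sub>v x = map_vec (\<lambda>d. a \<star> d) x"

definition rscale :: "distr vec \<Rightarrow> distr \<Rightarrow> distr vec" (infixl "\<star>\<^sub>v\<^sub>s" 70) where
  "x \<star>\<^sub>v\<^sub>s a = map_vec (\<lambda>d. d \<star> a) x"

definition Id_star :: "real set \<Rightarrow> nat \<Rightarrow> distr mat" where
  "Id_star I n = Matrix.mat n n (\<lambda>(i, j). if i = j then one_star I else 0)"

primrec mat_star_power :: "real set \<Rightarrow> distr mat \<Rightarrow> nat \<Rightarrow> distr mat" where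
  "mat_star_power I M 0 = Id_star I (dim_row M)"
| "mat_star_power I M (Suc j) = M \<star>\<^sub>m\<^sub>m mat_star_power I M j"

definition D_mat :: "real set \<Rightarrow> nat \<Rightarrow> distr mat set" where
  "D_mat I n = {M \<in> carrier_mat n n. \<forall>i<n. \<forall>j<n. M $$ (i, j) \<in> D_class I}"

text \<open>
  \<open>R\<close> is the star-inverse of \<open>Id - M\<close> and the sum of the series of the star-powers of \<open>M\<close>, which
  converges entrywise in the sense of distributions.
\<close>

definition is_star_resolvent :: "real set \<Rightarrow> distr mat \<Rightarrow> distr mat \<Rightarrow> bool" where
  "is_star_resolvent I M R \<longleftrightarrow> (let n = dim_row M in
     M \<in> D_mat I n \<and> R \<in> D_mat I n \<and>
     R \<star>\<^sub>m\<^sub>m (Id_star I n - M) = Id_star I n \<and> (Id_star I n - M) \<star>\<^sub>m\<^sub>m R = Id_star I n \<and>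
     (\<forall>i<n. \<forall>j<n. \<forall>t'\<in>interior I. \<forall>h\<in>test_fun I.
        (\<lambda>k. (mat_star_power I M k $$ (i, j)) t' h) sums (R $$ (i, j)) t' h))"

definition has_star_resolvent :: "real set \<Rightarrow> distr mat \<Rightarrow> bool" where
  "has_star_resolvent I M \<longleftrightarrow> (\<exists>R. is_star_resolvent I M R)"

definition star_resolvent :: "real set \<Rightarrow> distr mat \<Rightarrow> distr mat" where
  "star_resolvent I M = (THE R. is_star_resolvent I M R)"


section \<open>The star-Lanczos algorithm\<close>

text \<open>
  The state after step \<open>k\<close> is \<open>(w\<^sub>k\<^sup>H, w\<^sub>k\<^sub>-\<^sub>1\<^sup>H, v\<^sub>k, v\<^sub>k\<^sub>-\<^sub>1, \<beta>\<^sub>k)\<close>, where the vectors of index -1 are 0;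
  the value 0 stored for \<open>\<beta>\<^sub>0\<close> only multiplies the vector of index -1.
\<close>

primrec lanczos_state ::
    "real set \<Rightarrow> distr mat \<Rightarrow> complex Matrix.vec \<Rightarrow> complex Matrix.vec \<Rightarrow> nat \<Rightarrow>
     distr vec \<times> distr vec \<times> distr vec \<times> distr vec \<times> distr" where
  "lanczos_state I A w v 0 =
     (map_vec (\<lambda>z. const_delta I (cnj z)) w, 0\<^sub>v (dim_row A),
      map_vec (const_delta I) v, 0\<^sub>v (dim_row A), 0)"
| "lanczos_state I A w v (Suc k) =
     (case lanczos_state I A w v k of (wk, wp, vk, vp, b) \<Rightarrow>
       let a = wk \<star>\<^sub>v\<^sub>m A \<star>\<^sub>v\<^sub>v vk;
           w' = wk \<star>\<^sub>v\<^sub>m A - a \<star>\<^sub>s\<^sub>v wk - b \<star>\<^sub>s\<^sub>v wp;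
           v_hat = A \<star>\<^sub>m\<^sub>v vk - vk \<star>\<^sub>v\<^sub>s a - vp;
           b' = w' \<star>\<^sub>v\<^sub>m A \<star>\<^sub>v\<^sub>v vk
       in (w', wk, v_hat \<star>\<^sub>v\<^sub>s star_inverse I b', vk, b'))"

definition lanczos_w ::
    "real set \<Rightarrow> distr mat \<Rightarrow> complex Matrix.vec \<Rightarrow> complex Matrix.vec \<Rightarrow> nat \<Rightarrow> distr vec" where
  "lanczos_w I A w v k = (case lanczos_state I A w v k of (wk, wp, vk, vp, b) \<Rightarrow> wk)"

definition lanczos_v ::
    "real set \<Rightarrow> distr mat \<Rightarrow> complex Matrix.vec \<Rightarrow> complex Matrix.vec \<Rightarrow> nat \<Rightarrow> distr vec" where
  "lanczos_v I A w v k = (case lanczos_state I A w v k of (wk, wp, vk, vp, b) \<Rightarrow> vk)"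

definition lanczos_\<beta> ::
    "real set \<Rightarrow> distr mat \<Rightarrow> complex Matrix.vec \<Rightarrow> complex Matrix.vec \<Rightarrow> nat \<Rightarrow> distr" where
  "lanczos_\<beta> I A w v k = (case lanczos_state I A w v k of (wk, wp, vk, vp, b) \<Rightarrow> b)"

definition lanczos_\<alpha> ::
    "real set \<Rightarrow> distr mat \<Rightarrow> complex Matrix.vec \<Rightarrow> complex Matrix.vec \<Rightarrow> nat \<Rightarrow> distr" where
  "lanczos_\<alpha> I A w v k = lanczos_w I A w v k \<star>\<^sub>v\<^sub>m A \<star>\<^sub>v\<^sub>v lanczos_v I A w v k"

definition lanczos_T ::
    "real set \<Rightarrow> distr mat \<Rightarrow> complex Matrix.vec \<Rightarrow> complex Matrix.vec \<Rightarrow> nat \<Rightarrow> distr mat" where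
  "lanczos_T I A w v n = Matrix.mat n n (\<lambda>(i, j).
     if i = j then lanczos_\<alpha> I A w v i
     else if j = Suc i then one_star I
     else if i = Suc j then lanczos_\<beta> I A w v i
     else 0)"

definition lanczos_V ::
    "real set \<Rightarrow> distr mat \<Rightarrow> complex Matrix.vec \<Rightarrow> complex Matrix.vec \<Rightarrow> nat \<Rightarrow> distr mat" where
  "lanczos_V I A w v n =
     Matrix.mat (dim_row A) n (\<lambda>(i, k). vec_index (lanczos_v I A w v k) i)"

definition lanczos_WH ::
    "real set \<Rightarrow> distr mat \<Rightarrow> complex Matrix.vec \<Rightarrow> complex Matrix.vec \<Rightarrow> nat \<Rightarrow> distr mat" where
  "lanczos_WH I A w v n =
     Matrix.mat n (dim_col A) (\<lambda>(k, j). vec_index (lanczos_w I A w v k) j)"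

definition no_breakdown ::
    "real set \<Rightarrow> distr mat \<Rightarrow> complex Matrix.vec \<Rightarrow> complex Matrix.vec \<Rightarrow> nat \<Rightarrow> bool" where
  "no_breakdown I A w v n \<longleftrightarrow> (\<forall>k. 1 \<le> k \<and> k \<le> n - 1 \<longrightarrow>
     (\<exists>g. is_star_inverse I (lanczos_\<beta> I A w v k) g) \<and>
     (\<exists>b. theta_coeff I (lanczos_\<beta> I A w v k) b \<and>
          (\<forall>t\<in>I. vector_derivative (\<lambda>s. b t s) (at t within I) \<noteq> 0)))"

end

theory Submission
  imports Defs "Jordan_Normal_Form.Determinant"
begin

text \<open>
  An element of D(I) acts on the test functions, and the star product is the composition of these
  actions.  The letters of this calculus are multiplication by a smooth function, the derivative
  \<open>\<delta>'\<close>, and the Volterra operators \<open>f \<Theta>\<close>; among the latter, \<open>\<Theta>\<close> itself is the inverse of \<open>\<delta>'\<close>, because test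
  functions vanish near the left end of the interval.  So D(I) behaves like a ring of
  pseudodifferential operators in one variable: every element is \<open>(c \<delta> + f \<Theta>) \<star> \<delta>\<^sup>(\<^sup>k\<^sup>)\<close> for some integer
  \<open>k\<close> (\<open>D_class_eq\<close>), orders add up under products (\<open>Ord_star\<close>), and the symbol \<open>c\<close> is well defined
  (\<open>symbol_zero\<close>) and multiplicative (\<open>O0_star_principal\<close>).

  The matrix \<open>A\<close> has order \<open>-1\<close>.  The no-breakdown condition says that \<open>\<beta>\<^sub>k\<close>, which has order \<open>-2\<close>, has a
  nowhere vanishing symbol, so that its inverse has order \<open>2\<close> and not more (\<open>inverse_order_2\<close>).  By induction
  \<open>w\<^sub>k\<close> has order \<open>-k\<close> and \<open>v\<^sub>k\<close> has order \<open>k\<close> (\<open>orders\<close>).  The three-term recurrences give, as for the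
  classical Lanczos algorithm, the biorthogonality \<open>W V = Id\<close> and \<open>T = W A V\<close> (\<open>biorthogonal\<close>, \<open>TM_eq\<close>).

  The remaining algebraic point is \<open>V W = Id\<close>, since the ring is not commutative and one-sided inverses need
  not be two-sided.  By the order count, the rows of \<open>W\<close> and the columns of \<open>V\<close> have symbols, and these form
  complex matrices that are inverse to each other at each point.  So \<open>Id - V W\<close> is an idempotent matrix
  of Volterra operators.  The iterated integrals in its powers are bounded by \<open>C\<^sup>m (t' - t)\<^sup>m / m!\<close>, so these
  powers tend to \<open>0\<close>; being equal to all of them, \<open>Id - V W\<close> is \<open>0\<close> (\<open>filtered_right_inverse\<close>).  Now
  \<open>A\<^sup>j = V T\<^sup>j W\<close> is the behaviour of powers under conjugation.

  For the resolvents, \<open>Id - A\<close> is inverted by variation of constants: if \<open>u\<close> is a fundamental matrix of the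
  linear equation \<open>u' = a u\<close>, where \<open>A = a \<Theta>\<close>, and \<open>z\<close> is its inverse, then \<open>Id - A = u \<delta>' z \<Theta>\<close>
  (\<open>separable_volterra_inverse\<close>).  This inverse lies in D(I), and the factorial bounds make the series of
  powers converge to it.  Conjugation transports inverse and convergence to \<open>T\<close> (\<open>resolvents\<close>).
\<close>

section \<open>Integrals over an interval and their derivatives\<close>

lemma nontrivial_at_within:
  fixes I :: "real set"
  assumes "is_interval I" "interior I \<noteq> {}" "x \<in> I"
  shows "at x within I \<noteq> bot"
proof -
  obtain y where "y \<in> interior I" using assms by auto
  then obtain e where e: "e > 0" "ball y e \<subseteq> I" using mem_interior by blast
  define z where "z = (if x = y then y + e/2 else y)"
  have "z \<in> I" "z \<noteq> x" using e by (auto simp: z_def dist_real_def subset_eq)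
  have "connected I" using assms(1) is_interval_connected by blast
  then show ?thesis using \<open>z \<in> I\<close> \<open>z \<noteq> x\<close> assms(3)
    by (metis connected_imp_perfect insertE singletonD trivial_limit_within)
qed

locale star_interval =
  fixes I :: "real set"
  assumes interval: "is_interval I" and interior_nonempty: "interior I \<noteq> {}"
begin

lemma at_within_nontrivial: "x \<in> I \<Longrightarrow> at x within I \<noteq> bot"
  using nontrivial_at_within interval interior_nonempty by blast

lemma convex_interval: "convex I"
  using interval is_interval_convex by blast

lemma segment_subset: "a \<in> I \<Longrightarrow> b \<in> I \<Longrightarrow> {a..b} \<subseteq> I"
  using interval by (metis atLeastAtMost_iff mem_is_interval_1_I subsetI)

end

text \<open>The oriented integral.  Kernels are integrated from \<open>t\<close> to \<open>t'\<close> also when \<open>t' < t\<close>, so that the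
  product of two smooth kernels is again smooth on the whole square \<open>I \<times> I\<close> and not only on the
  triangle \<open>t \<le> t'\<close>.\<close>

definition oint :: "real \<Rightarrow> real \<Rightarrow> (real \<Rightarrow> complex) \<Rightarrow> complex" where
  "oint a b k = integral {a..b} k - integral {b..a} k"

lemma oint_swap: "oint b a k = - oint a b k"
  by (simp add: oint_def)

lemma oint_le: "a \<le> b \<Longrightarrow> oint a b k = integral {a..b} k"
  by (cases "a = b") (auto simp: oint_def)

lemma oint_same [simp]: "oint a a k = 0"
  by (simp add: oint_def)

lemma shifted_power_has_derivative:
  fixes a :: real
  shows "((\<lambda>r. (r - a) ^ Suc m / (fact m * real (Suc m))) has_real_derivative (r - a) ^ m / fact m) (at r within S)"
proof -
  have "((\<lambda>r. r - a) has_real_derivative 1) (at r within S)" by (auto intro!: derivative_eq_intros)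
  from DERIV_cdivide[OF DERIV_power[OF this, of "Suc m"], of "fact m * real (Suc m)"]
  show ?thesis by (simp del: of_nat_Suc power_Suc)
qed

lemma reflected_power_has_derivative:
  fixes a :: real
  shows "((\<lambda>r. - ((a - r) ^ Suc m / (fact m * real (Suc m)))) has_real_derivative (a - r) ^ m / fact m) (at r within S)"
proof -
  have "((\<lambda>r. a - r) has_real_derivative - 1) (at r within S)" by (auto intro!: derivative_eq_intros)
  from DERIV_minus[OF DERIV_cdivide[OF DERIV_power[OF this, of "Suc m"], of "fact m * real (Suc m)"]]
  show ?thesis by (simp del: of_nat_Suc power_Suc)
qed

lemma has_integral_shifted_power:
  assumes "p \<le> t"
  shows "((\<lambda>s. (s - p) ^ m / fact m) has_integral ((t - p) ^ Suc m / fact (Suc m) :: real)) {p..t}"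
    and "((\<lambda>s. (t - s) ^ m / fact m) has_integral ((t - p) ^ Suc m / fact (Suc m) :: real)) {p..t}"
proof -
  have fact: "fact m * real (Suc m) = fact (Suc m)" by (simp only: fact_Suc mult.commute)
  define F where "F r = (r - p) ^ Suc m / (fact m * real (Suc m))" for r
  have "((\<lambda>s. (s - p) ^ m / fact m) has_integral F t - F p) {p..t}"
    unfolding F_def using shifted_power_has_derivative
    by (intro fundamental_theorem_of_calculus assms) (simp add: has_real_derivative_iff_has_vector_derivative[symmetric] del: power_Suc of_nat_Suc)
  moreover have "F t - F p = (t - p) ^ Suc m / fact (Suc m)" unfolding F_def fact by simp
  ultimately show "((\<lambda>s. (s - p) ^ m / fact m) has_integral ((t - p) ^ Suc m / fact (Suc m))) {p..t}" by (simp only:)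
  define G where "G r = - ((t - r) ^ Suc m / (fact m * real (Suc m)))" for r
  have "((\<lambda>s. (t - s) ^ m / fact m) has_integral G t - G p) {p..t}"
    unfolding G_def using reflected_power_has_derivative
    by (intro fundamental_theorem_of_calculus assms) (simp add: has_real_derivative_iff_has_vector_derivative[symmetric] del: power_Suc of_nat_Suc)
  moreover have "G t - G p = (t - p) ^ Suc m / fact (Suc m)" unfolding G_def fact by simp
  ultimately show "((\<lambda>s. (t - s) ^ m / fact m) has_integral ((t - p) ^ Suc m / fact (Suc m))) {p..t}" by (simp only:)
qed

context star_interval
begin

lemma oint_integrable:
  fixes k :: "real \<Rightarrow> complex"
  assumes "continuous_on I k" "a \<in> I" "b \<in> I"
  shows "k integrable_on {a..b}"
  using assms by (intro integrable_continuous_real continuous_on_subset[OF _ segment_subset])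

lemma oint_add:
  assumes "continuous_on I k" "continuous_on I l" "a \<in> I" "b \<in> I"
  shows "oint a b (\<lambda>t. k t + l t) = oint a b k + oint a b l"
  using assms by (simp add: oint_def integral_add oint_integrable)

lemma oint_combine:
  assumes k: "continuous_on I k" and I: "a \<in> I" "b \<in> I" "c \<in> I"
  shows "oint a b k + oint b c k = oint a c k"
proof -
  define m where "m = min a (min b c)"
  have m: "m \<in> I" "m \<le> a" "m \<le> b" "m \<le> c" using I by (auto simp: m_def min_def)
  have le: "integral {x..y} k = integral {m..y} k - integral {m..x} k"
    if "m \<le> x" "x \<le> y" "y \<in> I" for x y
    using that Henstock_Kurzweil_Integration.integral_combine[of m x y k]
      oint_integrable[OF k m(1), of y] by (simp add: algebra_simps)
  have "oint x y k = integral {m..y} k - integral {m..x} k"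
    if "m \<le> x" "m \<le> y" "x \<in> I" "y \<in> I" for x y
  proof (cases "x \<le> y")
    case True
    show ?thesis unfolding oint_le[OF True] by (rule le[OF that(1) True that(4)])
  next
    case False
    then have "y \<le> x" by simp
    then have "oint y x k = integral {m..x} k - integral {m..y} k"
      unfolding oint_le[OF \<open>y \<le> x\<close>] using le[OF that(2) _ that(3)] by simp
    then show ?thesis using oint_swap[of x y k] by simp
  qed
  from this[OF m(2,3) I(1,2)] this[OF m(3,4) I(2,3)] this[OF m(2,4) I(1,3)]
  show ?thesis by simp
qed

lemma oint_cong:
  assumes "\<And>t. t \<in> I \<Longrightarrow> k t = l t" "a \<in> I" "b \<in> I"
  shows "oint a b k = oint a b l"
proof -
  have "integral {x..y} k = integral {x..y} l" if "x \<in> I" "y \<in> I" for x y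
    using segment_subset[OF that] assms(1) by (intro integral_cong) auto
  then show ?thesis using assms by (simp add: oint_def)
qed

text \<open>The induction step of the factorial bounds for iterated integrals.\<close>

lemma oint_power_bound:
  assumes k: "continuous_on I k" and I: "p \<in> I" "t \<in> I"
    and le: "\<And>s. min p t \<le> s \<Longrightarrow> s \<le> max p t \<Longrightarrow> cmod (k s) \<le> C * (\<bar>s - p\<bar> ^ m / fact m)"
  shows "cmod (oint p t k) \<le> C * (\<bar>t - p\<bar> ^ Suc m / fact (Suc m))"
proof (cases "p \<le> t")
  case True
  note * = has_integral_mult_right[OF has_integral_shifted_power(1)[OF True, of m], of C]
  have "cmod (integral {p..t} k) \<le> integral {p..t} (\<lambda>s. C * ((s - p) ^ m / fact m))"
  proof (rule integral_norm_bound_integral[OF oint_integrable[OF k I] has_integral_integrable[OF *]])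
    show "cmod (k s) \<le> C * ((s - p) ^ m / fact m)" if "s \<in> {p..t}" for s
      using le[of s] that by (simp add: abs_of_nonneg)
  qed
  then have "cmod (oint p t k) \<le> C * ((t - p) ^ Suc m / fact (Suc m))"
    unfolding integral_unique[OF *] oint_le[OF True] .
  moreover have "\<bar>t - p\<bar> = t - p" using True by simp
  ultimately show ?thesis by (simp only:)
next
  case False
  then have t: "t \<le> p" by simp
  note * = has_integral_mult_right[OF has_integral_shifted_power(2)[OF t, of m], of C]
  have "cmod (integral {t..p} k) \<le> integral {t..p} (\<lambda>s. C * ((p - s) ^ m / fact m))"
  proof (rule integral_norm_bound_integral[OF oint_integrable[OF k I(2,1)] has_integral_integrable[OF *]])
    show "cmod (k s) \<le> C * ((p - s) ^ m / fact m)" if "s \<in> {t..p}" for s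
      using le[of s] that by (simp add: abs_of_nonpos)
  qed
  then have "cmod (oint t p k) \<le> C * ((p - t) ^ Suc m / fact (Suc m))"
    unfolding integral_unique[OF *] oint_le[OF t] .
  moreover have "cmod (oint p t k) = cmod (oint t p k)" using oint_swap[of t p k] by simp
  moreover have "\<bar>t - p\<bar> = p - t" using t by simp
  ultimately show ?thesis by (simp only:)
qed

text \<open>The one-sided derivatives at an endpoint of \<open>I\<close> that belongs to \<open>I\<close> are seen on a compact subinterval,
  to which theorems about compact intervals apply; it can be chosen to contain a base point \<open>p\<close>.\<close>

lemma compact_neighbourhood:
  assumes "x \<in> I" "p \<in> I"
  obtains a b where "a \<in> I" "b \<in> I" "x \<in> {a..b}" "p \<in> {a..b}" "at x within I = at x within {a..b}"
proof -
  obtain a where a: "a \<in> I" "a \<le> x" "a \<le> p" "a < x \<or> (\<forall>y\<in>I. x \<le> y)"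
  proof (cases "\<exists>y\<in>I. y < x")
    case True
    then obtain y where "y \<in> I" "y < x" by blast
    then show ?thesis using that[of "min y p"] assms by (auto simp: min_def)
  next
    case False
    then show ?thesis by (intro that[of x]) (use assms in \<open>auto simp: not_less\<close>)
  qed
  obtain b where b: "b \<in> I" "x \<le> b" "p \<le> b" "x < b \<or> (\<forall>y\<in>I. y \<le> x)"
  proof (cases "\<exists>y\<in>I. x < y")
    case True
    then obtain y where "y \<in> I" "x < y" by blast
    then show ?thesis using that[of "max y p"] assms by (auto simp: max_def)
  next
    case False
    then show ?thesis by (intro that[of x]) (use assms in \<open>auto simp: not_less\<close>)
  qed
  define S where "S = {(if a < x then a else x - 1)<..<(if x < b then b else x + 1)}"
  have "at x within I = at x within {a..b}"
  proof (rule at_within_nhd[where S = S])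
    show "x \<in> S" "open S" by (auto simp: S_def)
    have "z \<in> I \<longleftrightarrow> z \<in> {a..b}" if "z \<in> S" for z
    proof
      show "z \<in> I" if "z \<in> {a..b}" using that segment_subset[OF a(1) b(1)] by blast
      show "z \<in> {a..b}" if "z \<in> I"
      proof -
        have "a \<le> z"
          using a(2,4) \<open>z \<in> S\<close> that unfolding S_def by (cases "a < x") auto
        moreover have "z \<le> b"
          using b(2,4) \<open>z \<in> S\<close> that unfolding S_def by (cases "x < b") auto
        ultimately show ?thesis by simp
      qed
    qed
    then show "I \<inter> S - {x} = {a..b} \<inter> S - {x}" by blast
  qed
  then show ?thesis using that[of a b] a b assms by auto
qed

lemma oint_has_vector_derivative:
  assumes k: "continuous_on I k" and I: "p \<in> I" "x \<in> I"
  shows "((\<lambda>u. oint p u k) has_vector_derivative k x) (at x within I)"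
proof -
  obtain a b where ab: "a \<in> I" "b \<in> I" "x \<in> {a..b}" "p \<in> {a..b}" "at x within I = at x within {a..b}"
    using compact_neighbourhood[OF I(2,1)] by blast
  have sub: "{a..b} \<subseteq> I" using ab segment_subset by auto
  have "((\<lambda>u. integral {a..u} k) has_vector_derivative k x) (at x within {a..b})"
    using integral_has_vector_derivative continuous_on_subset[OF k sub] ab by blast
  then have "((\<lambda>u. integral {a..u} k - integral {a..p} k) has_vector_derivative k x - 0) (at x within {a..b})"
    by (intro has_vector_derivative_diff has_vector_derivative_const)
  then have "((\<lambda>u. oint p u k) has_vector_derivative k x - 0) (at x within {a..b})"
  proof (rule has_vector_derivative_transform[rotated 2])
    show "oint p u k = integral {a..u} k - integral {a..p} k" if "u \<in> {a..b}" for u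
    proof -
      have "u \<in> I" using that sub by auto
      then have "oint p a k + oint a u k = oint p u k" using oint_combine[OF k] I ab by blast
      then show ?thesis using that ab oint_swap[of p a k] by (simp add: oint_le)
    qed
  qed (use ab in auto)
  then show ?thesis unfolding ab(5) by simp
qed

lemma oint_FTC:
  assumes g: "\<And>x. x \<in> I \<Longrightarrow> (g has_vector_derivative g' x) (at x within I)"
    and I: "a \<in> I" "b \<in> I"
  shows "oint a b g' = g b - g a"
proof -
  have *: "integral {x..y} g' = g y - g x" if "x \<le> y" "x \<in> I" "y \<in> I" for x y
  proof (intro integral_unique fundamental_theorem_of_calculus that)
    show "(g has_vector_derivative g' s) (at s within {x..y})" if "s \<in> {x..y}" for s
      using segment_subset[of x y] \<open>x \<in> I\<close> \<open>y \<in> I\<close> that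
      by (intro has_vector_derivative_within_subset[OF g]) auto
  qed
  show ?thesis
  proof (cases "a \<le> b")
    case True then show ?thesis using * I by (simp add: oint_le)
  next
    case False
    then have "oint b a g' = g a - g b" using * I by (simp add: oint_le)
    then show ?thesis using oint_swap[of a b g'] by simp
  qed
qed

text \<open>Moving the limits of integration into the integrand reduces continuity in the limits to
  continuity of an integral with fixed limits.\<close>

lemma oint_unit:
  assumes k: "continuous_on I k" and I: "a \<in> I" "b \<in> I"
  shows "oint a b k = integral {0..1} (\<lambda>s. (b - a) *\<^sub>R k (a + s * (b - a)))"
proof -
  define \<phi> where "\<phi> s = a + s * (b - a)" for s
  have \<phi>: "\<phi> s \<in> I" if "s \<in> {0..1}" for s
  proof -
    have "\<phi> s = (1 - s) *\<^sub>R a + s *\<^sub>R b" by (simp add: \<phi>_def algebra_simps)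
    then show ?thesis using convex_interval I that by (auto simp: convex_alt)
  qed
  have "((\<lambda>s. oint a (\<phi> s) k) has_vector_derivative (b - a) *\<^sub>R k (\<phi> s)) (at s within {0..1})"
    if "s \<in> {0..1}" for s
  proof -
    have "(\<phi> has_vector_derivative (b - a)) (at s within {0..1})"
      unfolding \<phi>_def by (auto intro!: derivative_eq_intros)
    moreover have "((\<lambda>u. oint a u k) has_vector_derivative k (\<phi> s)) (at (\<phi> s) within \<phi> ` {0..1})"
      using \<phi>
      by (intro has_vector_derivative_within_subset[OF oint_has_vector_derivative[OF k I(1) \<phi>[OF that]]]) auto
    ultimately have "((\<lambda>u. oint a u k) \<circ> \<phi> has_vector_derivative (b - a) *\<^sub>R k (\<phi> s)) (at s within {0..1})"
      by (rule vector_diff_chain_within)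
    then show ?thesis by (simp add: o_def)
  qed
  then have "((\<lambda>s. (b - a) *\<^sub>R k (\<phi> s)) has_integral (oint a (\<phi> 1) k - oint a (\<phi> 0) k)) {0..1}"
    by (intro fundamental_theorem_of_calculus) auto
  then have "integral {0..1} (\<lambda>s. (b - a) *\<^sub>R k (\<phi> s)) = oint a (\<phi> 1) k - oint a (\<phi> 0) k"
    by (rule integral_unique)
  moreover have "\<phi> 0 = a" "\<phi> 1 = b" by (auto simp: \<phi>_def)
  ultimately show ?thesis unfolding \<phi>_def by simp
qed

lemma continuous_on_oint:
  fixes k :: "'a::metric_space \<Rightarrow> real \<Rightarrow> complex"
  assumes k: "continuous_on (S \<times> I) (\<lambda>(z, t). k z t)"
    and a: "continuous_on S a" "\<And>z. z \<in> S \<Longrightarrow> a z \<in> I"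
    and b: "continuous_on S b" "\<And>z. z \<in> S \<Longrightarrow> b z \<in> I"
  shows "continuous_on S (\<lambda>z. oint (a z) (b z) (k z))"
proof -
  have conv: "a z + s * (b z - a z) \<in> I" if "z \<in> S" "s \<in> {0..1}" for z s
  proof -
    have "a z + s * (b z - a z) = (1 - s) *\<^sub>R a z + s *\<^sub>R b z" by (simp add: algebra_simps)
    then show ?thesis using convex_interval a(2) b(2) that by (auto simp: convex_alt)
  qed
  have "continuous_on (S \<times> cbox 0 1) (\<lambda>p. case p of (z, s) \<Rightarrow> (b z - a z) *\<^sub>R k z (a z + s * (b z - a z)))"
  proof -
    have ab: "continuous_on (S \<times> cbox 0 1) (\<lambda>x::'a \<times> real. b (fst x))"
        "continuous_on (S \<times> cbox 0 1) (\<lambda>x::'a \<times> real. a (fst x))"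
      by (rule continuous_on_compose2[OF b(1)] continuous_on_compose2[OF a(1)], auto intro!: continuous_intros)+
    then have "continuous_on (S \<times> cbox 0 1) (\<lambda>p. (fst p, a (fst p) + snd p * (b (fst p) - a (fst p))))"
      by (intro continuous_intros)
    moreover have "(\<lambda>p. (fst p, a (fst p) + snd p * (b (fst p) - a (fst p)))) ` (S \<times> cbox 0 1) \<subseteq> S \<times> I"
      using conv by auto
    ultimately have "continuous_on (S \<times> cbox 0 1) (\<lambda>p. k (fst p) (a (fst p) + snd p * (b (fst p) - a (fst p))))"
      using continuous_on_compose2[OF k] by (fastforce simp: split_beta)
    then show ?thesis unfolding split_beta by (intro continuous_intros ab)
  qed
  then have "continuous_on S (\<lambda>z. integral (cbox 0 1) (\<lambda>s. (b z - a z) *\<^sub>R k z (a z + s * (b z - a z))))"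
    by (rule integral_continuous_on_param)
  moreover have "continuous_on I (k z)" if "z \<in> S" for z
    by (rule continuous_on_compose2[OF k, of _ "\<lambda>t. (z, t)", simplified])
       (use that in \<open>auto intro!: continuous_intros\<close>)
  ultimately show ?thesis
    using a b by (auto simp: oint_unit cong: continuous_on_cong)
qed

lemma continuous_on_section:
  assumes "continuous_on (I \<times> I) (\<lambda>(x, y). k x y)" "x \<in> I"
  shows "continuous_on I (k x)" "continuous_on I (\<lambda>t. k t x)"
proof -
  have "continuous_on I (\<lambda>t. (x, t))" "continuous_on I (\<lambda>t. (t, x))"
    by (intro continuous_intros)+
  moreover have "(\<lambda>t. (x, t)) ` I \<subseteq> I \<times> I" "(\<lambda>t. (t, x)) ` I \<subseteq> I \<times> I"
    using assms(2) by auto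
  ultimately show "continuous_on I (k x)" "continuous_on I (\<lambda>t. k t x)"
    using continuous_on_compose2[OF assms(1), of I "\<lambda>t. (x, t)"]
      continuous_on_compose2[OF assms(1), of I "\<lambda>t. (t, x)"] by simp_all
qed

lemma oint_leibniz_fixed:
  assumes k: "continuous_on (I \<times> I) (\<lambda>(x, t). k x t)"
    and k1: "continuous_on (I \<times> I) (\<lambda>(x, t). k1 x t)"
    and d: "\<And>x t. x \<in> I \<Longrightarrow> t \<in> I \<Longrightarrow> ((\<lambda>x. k x t) has_vector_derivative k1 x t) (at x within I)"
    and I: "a \<in> I" "b \<in> I" "x \<in> I"
  shows "((\<lambda>x. oint a b (k x)) has_vector_derivative oint a b (k1 x)) (at x within I)"
proof -
  have *: "((\<lambda>x. integral {u..v} (k x)) has_vector_derivative integral {u..v} (k1 x)) (at x within I)"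
    if "u \<in> I" "v \<in> I" for u v
    unfolding cbox_interval[symmetric]
  proof (rule leibniz_rule_vector_derivative)
    have sub: "cbox u v \<subseteq> I" using segment_subset that by auto
    show "continuous_on (I \<times> cbox u v) (\<lambda>(x, t). k1 x t)"
      using k1 sub by (meson Sigma_mono continuous_on_subset order_refl)
    show "k x integrable_on cbox u v" if "x \<in> I" for x
      using continuous_on_section(1)[OF k that] sub continuous_on_subset integrable_continuous by blast
    show "((\<lambda>x. k x t) has_vector_derivative k1 x t) (at x within I)"
      if "x \<in> I" "t \<in> cbox u v" for x t using that sub d by blast
  qed (use I convex_interval in auto)
  show ?thesis unfolding oint_def
    by (intro has_vector_derivative_diff * I)
qed

text \<open>Differentiability on the square follows from the existence of both partial derivatives and the
  continuity of one of them; the derivative along the diagonal is then a case of the chain rule.\<close>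

lemma has_vector_derivative_partials:
  assumes fx: "((\<lambda>x. f x y) has_vector_derivative fx) (at x within I)"
    and fy: "\<And>x y. x \<in> I \<Longrightarrow> y \<in> I \<Longrightarrow> ((\<lambda>y. f x y) has_vector_derivative fy x y) (at y within I)"
    and c: "continuous_on (I \<times> I) (\<lambda>(x, y). fy x y)"
    and I: "x \<in> I" "y \<in> I"
  shows "((\<lambda>(x, y). f x y) has_derivative (\<lambda>(tx, ty). tx *\<^sub>R fx + ty *\<^sub>R fy x y)) (at (x, y) within I \<times> I)"
proof -
  have "((\<lambda>(x, y). f x y) has_derivative
      (\<lambda>(tx, ty). tx *\<^sub>R fx + blinfun_apply (blinfun_scaleR_left (fy x y)) ty)) (at (x, y) within I \<times> I)"
  proof (rule has_derivative_partialsI)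
    show "((\<lambda>x. f x y) has_derivative (\<lambda>tx. tx *\<^sub>R fx)) (at x within I)"
      using fx by (simp add: has_vector_derivative_def)
    show "((\<lambda>y. f x y) has_derivative blinfun_apply (blinfun_scaleR_left (fy x y))) (at y within I)"
      if "x \<in> I" "y \<in> I" for x y
      using fy[OF that] by (simp add: has_vector_derivative_def)
    have "continuous_on (I \<times> I) (\<lambda>p. blinfun_scaleR_left (case p of (x, y) \<Rightarrow> fy x y))"
      by (rule bounded_linear.continuous_on[OF bounded_linear_blinfun_scaleR_left c])
    then show "continuous (at (x, y) within I \<times> I) (\<lambda>(x, y). blinfun_scaleR_left (fy x y))"
      using I unfolding continuous_on_eq_continuous_within split_beta by (meson SigmaI)
  qed (use I convex_interval in auto)
  then show ?thesis by simp
qed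

lemma has_vector_derivative_diag:
  assumes fx: "((\<lambda>x. f x y) has_vector_derivative fx) (at y within I)"
    and fy: "\<And>x y. x \<in> I \<Longrightarrow> y \<in> I \<Longrightarrow> ((\<lambda>y. f x y) has_vector_derivative fy x y) (at y within I)"
    and c: "continuous_on (I \<times> I) (\<lambda>(x, y). fy x y)"
    and I: "y \<in> I"
  shows "((\<lambda>t. f t t) has_vector_derivative (fx + fy y y)) (at y within I)"
proof -
  have "((\<lambda>t. (t, t)) has_derivative (\<lambda>h. (h, h))) (at y within I)"
    by (auto intro!: derivative_eq_intros)
  moreover have "((\<lambda>(x, y). f x y) has_derivative (\<lambda>(tx, ty). tx *\<^sub>R fx + ty *\<^sub>R fy y y))
      (at (y, y) within (\<lambda>t. (t, t)) ` I)"
    using has_vector_derivative_partials[OF fx fy c I I]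
    by (rule has_derivative_subset) (use I in auto)
  ultimately have "((\<lambda>(x, y). f x y) \<circ> (\<lambda>t. (t, t)) has_derivative
      (\<lambda>(tx, ty). tx *\<^sub>R fx + ty *\<^sub>R fy y y) \<circ> (\<lambda>h. (h, h))) (at y within I)"
    by (rule diff_chain_within)
  then show ?thesis by (simp add: has_vector_derivative_def o_def scaleR_add_right)
qed

text \<open>The parameter occurs both in the upper limit and in the integrand: this is the derivative along
  the diagonal of the function that has separate variables in the two places.\<close>

lemma oint_leibniz:
  assumes k: "continuous_on (I \<times> I) (\<lambda>(x, t). k x t)"
    and k1: "continuous_on (I \<times> I) (\<lambda>(x, t). k1 x t)"
    and d: "\<And>x t. x \<in> I \<Longrightarrow> t \<in> I \<Longrightarrow> ((\<lambda>x. k x t) has_vector_derivative k1 x t) (at x within I)"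
    and I: "a \<in> I" "x \<in> I"
  shows "((\<lambda>x. oint a x (k x)) has_vector_derivative k x x + oint a x (k1 x)) (at x within I)"
proof -
  have "((\<lambda>t. oint a t (k t)) has_vector_derivative oint a x (k1 x) + k x x) (at x within I)"
  proof (rule has_vector_derivative_diag[where f = "\<lambda>x u. oint a u (k x)" and fy = k])
    show "((\<lambda>y. oint a x (k y)) has_vector_derivative oint a x (k1 x)) (at x within I)"
      using oint_leibniz_fixed[OF k k1 d I(1,2,2)] by blast
    show "((\<lambda>u. oint a u (k y)) has_vector_derivative k y u) (at u within I)" if "y \<in> I" "u \<in> I" for y u
      using oint_has_vector_derivative[OF continuous_on_section(1)[OF k that(1)] I(1) that(2)] .
  qed (fact k I)+
  then show ?thesis unfolding add.commute[of "k x x"] .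
qed

text \<open>Mixed partial derivatives.  The increment of \<open>g\<close> in the second variable is the integral of
  \<open>gy\<close>; differentiating under the integral sign gives the increment of \<open>gx\<close> as an integral of \<open>gxy\<close>.\<close>

lemma mixed_partial:
  fixes g gx gy gxy :: "real \<Rightarrow> real \<Rightarrow> complex"
  assumes gx: "\<And>x y. x \<in> I \<Longrightarrow> y \<in> I \<Longrightarrow> ((\<lambda>s. g s y) has_vector_derivative gx x y) (at x within I)"
    and gy: "\<And>x y. x \<in> I \<Longrightarrow> y \<in> I \<Longrightarrow> ((\<lambda>s. g x s) has_vector_derivative gy x y) (at y within I)"
    and gxy: "\<And>x y. x \<in> I \<Longrightarrow> y \<in> I \<Longrightarrow> ((\<lambda>s. gy s y) has_vector_derivative gxy x y) (at x within I)"
    and c2: "continuous_on (I \<times> I) (\<lambda>(x, y). gy x y)"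
    and c12: "continuous_on (I \<times> I) (\<lambda>(x, y). gxy x y)"
    and I: "x \<in> I" "y \<in> I"
  shows "((\<lambda>s. gx x s) has_vector_derivative gxy x y) (at y within I)"
proof -
  have incr: "gx x s - gx x y = oint y s (gxy x)" if "s \<in> I" for s
  proof -
    have "((\<lambda>x. oint y s (gy x)) has_vector_derivative oint y s (gxy x)) (at x within I)"
      by (rule oint_leibniz_fixed[OF c2 c12 gxy I(2) that I(1)])
    moreover have "oint y s (gy x') = g x' s - g x' y" if "x' \<in> I" for x'
      using oint_FTC[of "g x'" "gy x'" y s] gy I that \<open>s \<in> I\<close> by blast
    ultimately have "((\<lambda>x'. g x' s - g x' y) has_vector_derivative oint y s (gxy x)) (at x within I)"
      using has_vector_derivative_transform[OF I(1)] by (metis (no_types, lifting))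
    moreover have "((\<lambda>x'. g x' s - g x' y) has_vector_derivative gx x s - gx x y) (at x within I)"
      by (intro has_vector_derivative_diff gx I that)
    ultimately show ?thesis
      using vector_derivative_unique_within at_within_nontrivial I by blast
  qed
  have "((\<lambda>s. gx x y + oint y s (gxy x)) has_vector_derivative 0 + gxy x y) (at y within I)"
    by (intro has_vector_derivative_add has_vector_derivative_const oint_has_vector_derivative
        continuous_on_section(1)[OF c12] I)
  from has_vector_derivative_transform[OF I(2) _ this, of "gx x"] incr
  show ?thesis by (simp add: algebra_simps)
qed

end

section \<open>Kernels that are smooth on the square\<close>

definition partial1 :: "real set \<Rightarrow> (real \<Rightarrow> real \<Rightarrow> complex) \<Rightarrow> real \<Rightarrow> real \<Rightarrow> complex" where
  "partial1 I f = (\<lambda>x y. vector_derivative (\<lambda>s. f s y) (at x within I))"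

definition partial2 :: "real set \<Rightarrow> (real \<Rightarrow> real \<Rightarrow> complex) \<Rightarrow> real \<Rightarrow> real \<Rightarrow> complex" where
  "partial2 I f = (\<lambda>x y. vector_derivative (\<lambda>s. f x s) (at y within I))"

text \<open>On the triangle \<open>y \<le> x\<close> this is the kernel of \<open>(f \<Theta>) \<star> (g \<Theta>)\<close>.\<close>

definition volterra_product :: "(real \<Rightarrow> real \<Rightarrow> complex) \<Rightarrow> (real \<Rightarrow> real \<Rightarrow> complex) \<Rightarrow> real \<Rightarrow> real \<Rightarrow> complex" where
  "volterra_product f g = (\<lambda>x y. oint y x (\<lambda>s. f x s * g s y))"

text \<open>The derivative of a product is not a product but a sum of two; the class of all sums of products is
  closed under differentiation.\<close>

inductive sum_of_products :: "real set \<Rightarrow> (real \<Rightarrow> real \<Rightarrow> complex) \<Rightarrow> bool" for I where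
  product: "smooth2_on I f \<Longrightarrow> smooth2_on I g \<Longrightarrow> sum_of_products I (\<lambda>x y. f x y * g x y)"
| add: "sum_of_products I p \<Longrightarrow> sum_of_products I q \<Longrightarrow> sum_of_products I (\<lambda>x y. p x y + q x y)"

text \<open>The family of derivatives whose existence defines smoothness.\<close>

definition derivative_family ::
    "real set \<Rightarrow> (real \<Rightarrow> real \<Rightarrow> complex) \<Rightarrow> (nat \<Rightarrow> nat \<Rightarrow> real \<Rightarrow> real \<Rightarrow> complex) \<Rightarrow> bool" where
  "derivative_family I f F \<longleftrightarrow>
     (\<forall>x\<in>I. \<forall>y\<in>I. F 0 0 x y = f x y) \<and>
     (\<forall>i j. continuous_on (I \<times> I) (\<lambda>(x, y). F i j x y)) \<and>
     (\<forall>i j. \<forall>x\<in>I. \<forall>y\<in>I.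
        ((\<lambda>s. F i j s y) has_vector_derivative F (Suc i) j x y) (at x within I) \<and>
        ((\<lambda>s. F i j x s) has_vector_derivative F i (Suc j) x y) (at y within I))"

lemma smooth2_on_iff: "smooth2_on I f \<longleftrightarrow> (\<exists>F. derivative_family I f F)"
  by (simp add: smooth2_on_def derivative_family_def)

lemma derivative_familyD:
  assumes "derivative_family I f F"
  shows "x \<in> I \<Longrightarrow> y \<in> I \<Longrightarrow> F 0 0 x y = f x y"
    and "continuous_on (I \<times> I) (\<lambda>(x, y). F i j x y)"
    and "x \<in> I \<Longrightarrow> y \<in> I \<Longrightarrow> ((\<lambda>s. F i j s y) has_vector_derivative F (Suc i) j x y) (at x within I)"
    and "x \<in> I \<Longrightarrow> y \<in> I \<Longrightarrow> ((\<lambda>s. F i j x s) has_vector_derivative F i (Suc j) x y) (at y within I)"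
  using assms by (simp_all add: derivative_family_def)

lemma smooth2_on_subset: "smooth2_on I f \<Longrightarrow> S \<subseteq> I \<Longrightarrow> smooth2_on S f"
proof -
  assume "smooth2_on I f" and S: "S \<subseteq> I"
  then obtain F where F: "derivative_family I f F" by (auto simp: smooth2_on_iff)
  have "derivative_family S f F"
    unfolding derivative_family_def
  proof (intro conjI allI ballI)
    show "continuous_on (S \<times> S) (\<lambda>(x, y). F i j x y)" for i j
      by (rule continuous_on_subset[OF derivative_familyD(2)[OF F]]) (use S in auto)
    fix x y assume "x \<in> S" "y \<in> S"
    then have I: "x \<in> I" "y \<in> I" using S by auto
    show "F 0 0 x y = f x y" by (rule derivative_familyD(1)[OF F I])
    show "((\<lambda>s. F i j s y) has_vector_derivative F (Suc i) j x y) (at x within S)"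
      "((\<lambda>s. F i j x s) has_vector_derivative F i (Suc j) x y) (at y within S)" for i j
      by (rule has_vector_derivative_within_subset[OF derivative_familyD(3)[OF F I] S]
            has_vector_derivative_within_subset[OF derivative_familyD(4)[OF F I] S])+
  qed
  then show "smooth2_on S f" by (auto simp: smooth2_on_iff)
qed

lemma smooth2_on_cong:
  assumes "\<And>x y. x \<in> I \<Longrightarrow> y \<in> I \<Longrightarrow> f x y = g x y"
  shows "smooth2_on I f \<longleftrightarrow> smooth2_on I g"
  using assms unfolding smooth2_on_def by simp

context star_interval
begin

text \<open>A coinduction principle: to be smooth it is enough to belong to a class of continuous functions
  that is closed under both partial derivatives.  The derivatives of order \<open>(i, j)\<close> are obtained by
  iterating a choice of the partial derivatives; they fit together by symmetry of the mixed ones.\<close>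

lemma smooth2_coinduct:
  assumes X: "X f"
    and cont: "\<And>f. X f \<Longrightarrow> continuous_on (I \<times> I) (\<lambda>(x, y). f x y)"
    and step: "\<And>f. X f \<Longrightarrow> \<exists>g h. X g \<and> X h \<and> (\<forall>x\<in>I. \<forall>y\<in>I.
        ((\<lambda>s. f s y) has_vector_derivative g x y) (at x within I) \<and>
        ((\<lambda>s. f x s) has_vector_derivative h x y) (at y within I))"
  shows "smooth2_on I f"
proof -
  from step obtain D1 D2 where D: "\<And>f. X f \<Longrightarrow> X (D1 f) \<and> X (D2 f) \<and> (\<forall>x\<in>I. \<forall>y\<in>I.
        ((\<lambda>s. f s y) has_vector_derivative D1 f x y) (at x within I) \<and>
        ((\<lambda>s. f x s) has_vector_derivative D2 f x y) (at y within I))"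
    by metis
  define F where "F i j = (D1 ^^ i) ((D2 ^^ j) f)" for i j
  have X2: "X ((D2 ^^ j) f)" for j by (induction j) (auto simp: X D)
  have XF: "X (F i j)" for i j unfolding F_def by (induction i) (auto simp: X2 D)
  have F1: "((\<lambda>s. F i j s y) has_vector_derivative F (Suc i) j x y) (at x within I)"
    if "x \<in> I" "y \<in> I" for i j x y
    using D[OF XF[of i j]] that by (auto simp: F_def)
  have F2: "((\<lambda>s. F i j x s) has_vector_derivative F i (Suc j) x y) (at y within I)"
    if "x \<in> I" "y \<in> I" for i j x y
    using that
  proof (induction i arbitrary: j x y)
    case 0
    then show ?case using D[OF X2[of j]] by (auto simp: F_def)
  next
    case (Suc i)
    show ?case
      by (rule mixed_partial[where g = "F i j" and gx = "F (Suc i) j" and gy = "F i (Suc j)",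
            OF F1 Suc.IH F1 cont[OF XF] cont[OF XF] Suc.prems])
  qed
  show ?thesis unfolding smooth2_on_def
    by (rule exI[of _ F]) (use F1 F2 cont XF in \<open>auto simp: F_def\<close>)
qed

lemma smooth2_continuous: "smooth2_on I f \<Longrightarrow> continuous_on (I \<times> I) (\<lambda>(x, y). f x y)"
proof -
  assume "smooth2_on I f"
  then obtain F where F: "derivative_family I f F" by (auto simp: smooth2_on_iff)
  show ?thesis by (rule continuous_on_eq[OF derivative_familyD(2)[OF F, of 0 0]]) (auto simp: derivative_familyD(1)[OF F])
qed

lemma smooth2_partials:
  assumes "smooth2_on I f"
  shows "smooth2_on I (partial1 I f)" "smooth2_on I (partial2 I f)"
    and "x \<in> I \<Longrightarrow> y \<in> I \<Longrightarrow> ((\<lambda>s. f s y) has_vector_derivative partial1 I f x y) (at x within I)"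
    and "x \<in> I \<Longrightarrow> y \<in> I \<Longrightarrow> ((\<lambda>s. f x s) has_vector_derivative partial2 I f x y) (at y within I)"
proof -
  obtain F where F: "derivative_family I f F" using assms by (auto simp: smooth2_on_iff)
  note F0 = derivative_familyD(1)[OF F] and Fc = derivative_familyD(2)[OF F]
    and F1 = derivative_familyD(3)[OF F] and F2 = derivative_familyD(4)[OF F]
  have d1: "((\<lambda>s. f s y) has_vector_derivative F 1 0 x y) (at x within I)" if "x \<in> I" "y \<in> I" for x y
    using has_vector_derivative_transform[OF that(1) _ F1[OF that, of 0 0], of "\<lambda>s. f s y"] F0 that by simp
  have d2: "((\<lambda>s. f x s) has_vector_derivative F 0 1 x y) (at y within I)" if "x \<in> I" "y \<in> I" for x y
    using has_vector_derivative_transform[OF that(2) _ F2[OF that, of 0 0], of "\<lambda>s. f x s"] F0 that by simp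
  have e1: "partial1 I f x y = F 1 0 x y" if "x \<in> I" "y \<in> I" for x y
    unfolding partial1_def by (rule vector_derivative_within[OF at_within_nontrivial d1]) (use that in auto)
  have e2: "partial2 I f x y = F 0 1 x y" if "x \<in> I" "y \<in> I" for x y
    unfolding partial2_def by (rule vector_derivative_within[OF at_within_nontrivial d2]) (use that in auto)
  have "smooth2_on I (F 1 0)" unfolding smooth2_on_def
    by (rule exI[of _ "\<lambda>i j. F (Suc i) j"]) (use Fc F1 F2 in auto)
  then show "smooth2_on I (partial1 I f)" using smooth2_on_cong[of I "partial1 I f" "F 1 0"] e1 by simp
  have "smooth2_on I (F 0 1)" unfolding smooth2_on_def
    by (rule exI[of _ "\<lambda>i j. F i (Suc j)"]) (use Fc F1 F2 in auto)
  then show "smooth2_on I (partial2 I f)" using smooth2_on_cong[of I "partial2 I f" "F 0 1"] e2 by simp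
  show "x \<in> I \<Longrightarrow> y \<in> I \<Longrightarrow> ((\<lambda>s. f s y) has_vector_derivative partial1 I f x y) (at x within I)"
    using d1 e1 by simp
  show "x \<in> I \<Longrightarrow> y \<in> I \<Longrightarrow> ((\<lambda>s. f x s) has_vector_derivative partial2 I f x y) (at y within I)"
    using d2 e2 by simp
qed

lemma smooth2_const: "smooth2_on I (\<lambda>x y. c)"
  unfolding smooth2_on_def
  by (rule exI[of _ "\<lambda>i j x y. if i = 0 \<and> j = 0 then c else 0"]) (auto intro!: derivative_eq_intros)

lemma smooth2_add:
  assumes "smooth2_on I f" "smooth2_on I g"
  shows "smooth2_on I (\<lambda>x y. f x y + g x y)"
proof (rule smooth2_coinduct[where X = "\<lambda>q. \<exists>f g. smooth2_on I f \<and> smooth2_on I g \<and> q = (\<lambda>x y. f x y + g x y)"])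
  show "\<exists>f' g'. smooth2_on I f' \<and> smooth2_on I g' \<and> (\<lambda>x y. f x y + g x y) = (\<lambda>x y. f' x y + g' x y)"
    using assms by blast
next
  fix q assume "\<exists>f g. smooth2_on I f \<and> smooth2_on I g \<and> q = (\<lambda>x y. f x y + g x y)"
  then obtain f g where f: "smooth2_on I f" and g: "smooth2_on I g" and q: "q = (\<lambda>x y. f x y + g x y)" by blast
  show "continuous_on (I \<times> I) (\<lambda>(x, y). q x y)"
    using continuous_on_add[OF smooth2_continuous[OF f] smooth2_continuous[OF g]] by (simp add: q split_beta)
  show "\<exists>g h. (\<exists>f ga. smooth2_on I f \<and> smooth2_on I ga \<and> g = (\<lambda>x y. f x y + ga x y)) \<and>
             (\<exists>f g. smooth2_on I f \<and> smooth2_on I g \<and> h = (\<lambda>x y. f x y + g x y)) \<and>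
             (\<forall>x\<in>I. \<forall>y\<in>I. ((\<lambda>s. q s y) has_vector_derivative g x y) (at x within I) \<and>
                 ((\<lambda>s. q x s) has_vector_derivative h x y) (at y within I))"
  proof (intro exI conjI ballI)
    show "smooth2_on I (partial1 I f)" "smooth2_on I (partial1 I g)"
         "smooth2_on I (partial2 I f)" "smooth2_on I (partial2 I g)"
      by (intro smooth2_partials f g)+
  next
    fix x y assume I: "x \<in> I" "y \<in> I"
    show "((\<lambda>s. q s y) has_vector_derivative (partial1 I f x y + partial1 I g x y)) (at x within I)"
      "((\<lambda>s. q x s) has_vector_derivative (partial2 I f x y + partial2 I g x y)) (at y within I)"
      unfolding q by (intro has_vector_derivative_add smooth2_partials f g I)+
  qed (rule refl)+
qed

lemma smooth2_mult:
  assumes "smooth2_on I f" "smooth2_on I g"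
  shows "smooth2_on I (\<lambda>x y. f x y * g x y)"
proof (rule smooth2_coinduct[where X = "sum_of_products I"])
  show "sum_of_products I (\<lambda>x y. f x y * g x y)" using assms by (rule sum_of_products.product)
next
  fix q assume "sum_of_products I q"
  then show "continuous_on (I \<times> I) (\<lambda>(x, y). q x y)"
  proof induction
    case (product f g)
    then show ?case using continuous_on_mult[OF smooth2_continuous smooth2_continuous, of f g]
      by (simp add: split_beta)
  next
    case (add p q)
    then show ?case using continuous_on_add[of "I \<times> I" "\<lambda>(x, y). p x y" "\<lambda>(x, y). q x y"]
      by (simp add: split_beta)
  qed
next
  fix q assume "sum_of_products I q"
  then show "\<exists>g h. sum_of_products I g \<and> sum_of_products I h \<and> (\<forall>x\<in>I. \<forall>y\<in>I.
      ((\<lambda>s. q s y) has_vector_derivative g x y) (at x within I) \<and>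
      ((\<lambda>s. q x s) has_vector_derivative h x y) (at y within I))"
  proof induction
    case (product f g)
    note f = product(1) and g = product(2)
    show ?case
    proof (intro exI conjI ballI)
      show "sum_of_products I (\<lambda>x y. f x y * partial1 I g x y + partial1 I f x y * g x y)"
           "sum_of_products I (\<lambda>x y. f x y * partial2 I g x y + partial2 I f x y * g x y)"
        by (intro sum_of_products.intros smooth2_partials f g)+
    next
      fix x y assume I: "x \<in> I" "y \<in> I"
      show "((\<lambda>s. f s y * g s y) has_vector_derivative (f x y * partial1 I g x y + partial1 I f x y * g x y)) (at x within I)"
        "((\<lambda>s. f x s * g x s) has_vector_derivative (f x y * partial2 I g x y + partial2 I f x y * g x y)) (at y within I)"
        by (intro has_vector_derivative_mult smooth2_partials f g I)+
    qed
  next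
    case (add p q)
    from add.IH(1) obtain p1 p2 where p: "sum_of_products I p1" "sum_of_products I p2"
      "\<And>x y. x\<in>I \<Longrightarrow> y\<in>I \<Longrightarrow> ((\<lambda>s. p s y) has_vector_derivative p1 x y) (at x within I)"
      "\<And>x y. x\<in>I \<Longrightarrow> y\<in>I \<Longrightarrow> ((\<lambda>s. p x s) has_vector_derivative p2 x y) (at y within I)" by metis
    from add.IH(2) obtain q1 q2 where q: "sum_of_products I q1" "sum_of_products I q2"
      "\<And>x y. x\<in>I \<Longrightarrow> y\<in>I \<Longrightarrow> ((\<lambda>s. q s y) has_vector_derivative q1 x y) (at x within I)"
      "\<And>x y. x\<in>I \<Longrightarrow> y\<in>I \<Longrightarrow> ((\<lambda>s. q x s) has_vector_derivative q2 x y) (at y within I)" by metis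
    show ?case
    proof (intro exI conjI ballI)
      show "sum_of_products I (\<lambda>x y. p1 x y + q1 x y)" "sum_of_products I (\<lambda>x y. p2 x y + q2 x y)"
        by (intro sum_of_products.add p q)+
    next
      fix x y assume I: "x \<in> I" "y \<in> I"
      show "((\<lambda>s. p s y + q s y) has_vector_derivative (p1 x y + q1 x y)) (at x within I)"
        "((\<lambda>s. p x s + q x s) has_vector_derivative (p2 x y + q2 x y)) (at y within I)"
        by (intro has_vector_derivative_add p q I)+
    qed
  qed
qed

lemma smooth2_minus: "smooth2_on I f \<Longrightarrow> smooth2_on I (\<lambda>x y. - f x y)"
  using smooth2_mult[OF smooth2_const[of "-1"]] by simp

lemma smooth2_diff: "smooth2_on I f \<Longrightarrow> smooth2_on I g \<Longrightarrow> smooth2_on I (\<lambda>x y. f x y - g x y)"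
  using smooth2_add[OF _ smooth2_minus] by fastforce

lemma smooth2_sum: "(\<And>i. i \<in> S \<Longrightarrow> smooth2_on I (f i)) \<Longrightarrow> smooth2_on I (\<lambda>x y. \<Sum>i\<in>S. f i x y)"
  by (induction S rule: infinite_finite_induct) (auto intro: smooth2_const smooth2_add)

lemma smooth2_diagonal_has_vector_derivative:
  assumes "smooth2_on I f" "y \<in> I"
  shows "((\<lambda>s. f s s) has_vector_derivative (partial1 I f y y + partial2 I f y y)) (at y within I)"
  by (rule has_vector_derivative_diag)
     (use assms smooth2_partials smooth2_continuous in auto)

lemma smooth2_continuous_diagonal:
  assumes "smooth2_on I f"
  shows "continuous_on I (\<lambda>t. f t t)"
  using smooth2_diagonal_has_vector_derivative[OF assms] has_vector_derivative_continuous
    continuous_on_eq_continuous_within by blast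

lemma continuous_on_fst_snd:
  fixes c :: "real \<Rightarrow> complex"
  assumes "continuous_on I c"
  shows "continuous_on (I \<times> I) (\<lambda>(x, y). c x)" "continuous_on (I \<times> I) (\<lambda>(x, y). c y)"
  unfolding split_beta
  by (rule continuous_on_compose2[OF assms]; auto intro: continuous_intros)+

lemma smooth2_diagonal:
  assumes "smooth2_on I f"
  shows "smooth2_on I (\<lambda>x y. f x x)" "smooth2_on I (\<lambda>x y. f y y)"
proof -
  define X where "X q \<longleftrightarrow> (\<exists>f. smooth2_on I f \<and> q = (\<lambda>x y::real. f x x))" for q
  define Y where "Y q \<longleftrightarrow> (\<exists>f. smooth2_on I f \<and> q = (\<lambda>x::real. \<lambda>y. f y y))" for q
  have deriv: "smooth2_on I (\<lambda>x y. partial1 I f x y + partial2 I f x y)" if "smooth2_on I f" for f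
    by (intro smooth2_add smooth2_partials that)
  have zero: "X (\<lambda>x y. 0)" "Y (\<lambda>x y. 0)"
    unfolding X_def Y_def by (rule exI[of _ "\<lambda>x y. 0"], simp add: smooth2_const)+
  show "smooth2_on I (\<lambda>x y. f x x)"
  proof (rule smooth2_coinduct[where X = X])
    show "X (\<lambda>x y. f x x)" using assms by (auto simp: X_def)
  next
    fix q assume "X q"
    then obtain f where f: "smooth2_on I f" and q: "q = (\<lambda>x y. f x x)" by (auto simp: X_def)
    show "continuous_on (I \<times> I) (\<lambda>(x, y). q x y)"
      unfolding q using continuous_on_fst_snd(1)[OF smooth2_continuous_diagonal[OF f]] by simp
    have "X (\<lambda>x y. partial1 I f x x + partial2 I f x x)" using deriv[OF f] by (auto simp: X_def)
    then show "\<exists>g h. X g \<and> X h \<and> (\<forall>x\<in>I. \<forall>y\<in>I. ((\<lambda>s. q s y) has_vector_derivative g x y) (at x within I) \<and>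
          ((\<lambda>s. q x s) has_vector_derivative h x y) (at y within I))"
      using zero(1) smooth2_diagonal_has_vector_derivative[OF f] unfolding q
      by (intro exI[of _ "\<lambda>x y. partial1 I f x x + partial2 I f x x"] exI[of _ "\<lambda>x y. 0"]) auto
  qed
  show "smooth2_on I (\<lambda>x y. f y y)"
  proof (rule smooth2_coinduct[where X = Y])
    show "Y (\<lambda>x y. f y y)" using assms by (auto simp: Y_def)
  next
    fix q assume "Y q"
    then obtain f where f: "smooth2_on I f" and q: "q = (\<lambda>x y. f y y)" by (auto simp: Y_def)
    show "continuous_on (I \<times> I) (\<lambda>(x, y). q x y)"
      unfolding q using continuous_on_fst_snd(2)[OF smooth2_continuous_diagonal[OF f]] by simp
    have "Y (\<lambda>x y. partial1 I f y y + partial2 I f y y)" using deriv[OF f] by (auto simp: Y_def)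
    then show "\<exists>g h. Y g \<and> Y h \<and> (\<forall>x\<in>I. \<forall>y\<in>I. ((\<lambda>s. q s y) has_vector_derivative g x y) (at x within I) \<and>
          ((\<lambda>s. q x s) has_vector_derivative h x y) (at y within I))"
      using zero(2) smooth2_diagonal_has_vector_derivative[OF f] unfolding q
      by (intro exI[of _ "\<lambda>x y. 0"] exI[of _ "\<lambda>x y. partial1 I f y y + partial2 I f y y"]) auto
  qed
qed

lemma smooth2_section:
  assumes "smooth2_on I f" "a \<in> I"
  shows "smooth2_on I (\<lambda>x y. f x a)"
proof -
  obtain F where F: "derivative_family I f F" using assms by (auto simp: smooth2_on_iff)
  have "derivative_family I (\<lambda>x y. f x a) (\<lambda>i j x y. if j = 0 then F i 0 x a else 0)"
    unfolding derivative_family_def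
  proof (intro conjI allI ballI)
    show "continuous_on (I \<times> I) (\<lambda>(x, y). if j = (0::nat) then F i 0 x a else 0)" for i j
      using continuous_on_fst_snd(1)[OF continuous_on_section(2)[OF derivative_familyD(2)[OF F] assms(2)], of i 0]
      by (cases "j = 0") (simp_all add: split_beta)
  qed (use derivative_familyD[OF F] assms in auto)
  then show ?thesis by (auto simp: smooth2_on_iff)
qed

lemma volterra_product_continuous:
  assumes f: "smooth2_on I f" and g: "smooth2_on I g"
  shows "continuous_on (I \<times> I) (\<lambda>(x, y). volterra_product f g x y)"
proof -
  have "continuous_on ((I \<times> I) \<times> I) (\<lambda>p. (case (fst (fst p), snd p) of (x, s) \<Rightarrow> f x s) *
      (case (snd p, snd (fst p)) of (s, y) \<Rightarrow> g s y))"
    by (intro continuous_on_mult continuous_on_compose2[OF smooth2_continuous[OF f]]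
        continuous_on_compose2[OF smooth2_continuous[OF g]] continuous_intros) auto
  then have "continuous_on ((I \<times> I) \<times> I) (\<lambda>(z, s). f (fst z) s * g s (snd z))"
    by (simp add: split_beta)
  then have "continuous_on (I \<times> I) (\<lambda>z. oint (snd z) (fst z) (\<lambda>s. f (fst z) s * g s (snd z)))"
    by (rule continuous_on_oint) (auto intro!: continuous_intros)
  then show ?thesis by (simp add: volterra_product_def split_beta)
qed

lemma volterra_product_partials:
  assumes f: "smooth2_on I f" and g: "smooth2_on I g" and I: "x \<in> I" "y \<in> I"
  shows "((\<lambda>s. volterra_product f g s y) has_vector_derivative
      f x x * g x y + volterra_product (partial1 I f) g x y) (at x within I)"
    and "((\<lambda>s. volterra_product f g x s) has_vector_derivative
      volterra_product f (partial2 I g) x y - f x y * g y y) (at y within I)"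
proof -
  have prod: "continuous_on (I \<times> I) (\<lambda>(s, t). p s t * c t)"
    if p: "smooth2_on I p" and c: "continuous_on I c" for p and c :: "real \<Rightarrow> complex"
    using continuous_on_mult[OF smooth2_continuous[OF p] continuous_on_fst_snd(2)[OF c]]
    by (simp add: split_beta)
  have gy: "continuous_on I (\<lambda>t. g t y)"
    using continuous_on_section(2)[OF smooth2_continuous[OF g] I(2)] .
  show "((\<lambda>s. volterra_product f g s y) has_vector_derivative
      f x x * g x y + volterra_product (partial1 I f) g x y) (at x within I)"
    unfolding volterra_product_def
    by (rule oint_leibniz[OF prod[OF f gy] prod[OF smooth2_partials(1)[OF f] gy]])
       (use I in \<open>auto intro!: has_vector_derivative_mult_left smooth2_partials f\<close>)
  have swap: "continuous_on (I \<times> I) (\<lambda>(s, t). c t * p t s)"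
    if p: "smooth2_on I p" and c: "continuous_on I c" for p and c :: "real \<Rightarrow> complex"
  proof -
    have "continuous_on (I \<times> I) (\<lambda>z. c (snd z) * (case (snd z, fst z) of (x, y) \<Rightarrow> p x y))"
      by (intro continuous_on_mult continuous_on_compose2[OF c]
          continuous_on_compose2[OF smooth2_continuous[OF p]] continuous_intros) auto
    then show ?thesis by (simp add: split_beta)
  qed
  have fx: "continuous_on I (f x)"
    using continuous_on_section(1)[OF smooth2_continuous[OF f] I(1)] .
  have "((\<lambda>s. oint x s (\<lambda>t. f x t * g t s)) has_vector_derivative
      f x y * g y y + oint x y (\<lambda>t. f x t * partial2 I g t y)) (at y within I)"
    by (rule oint_leibniz[OF swap[OF g fx] swap[OF smooth2_partials(2)[OF g] fx]])
       (use I in \<open>auto intro!: has_vector_derivative_mult_right smooth2_partials g\<close>)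
  from has_vector_derivative_minus[OF this]
  show "((\<lambda>s. volterra_product f g x s) has_vector_derivative
      volterra_product f (partial2 I g) x y - f x y * g y y) (at y within I)"
    unfolding volterra_product_def oint_swap[where b = x] by simp
qed

text \<open>Differentiating the product of \<open>f\<close> and \<open>g\<close> differentiates one factor and produces a boundary term
  that is already known to be smooth.  Hence the products, up to smooth summands, form a class to which
  the coinduction principle applies.\<close>

lemma smooth2_volterra_product:
  assumes "smooth2_on I f" "smooth2_on I g"
  shows "smooth2_on I (volterra_product f g)"
proof -
  define X where "X q \<longleftrightarrow> (\<exists>f g s. smooth2_on I f \<and> smooth2_on I g \<and> smooth2_on I s \<and>
      q = (\<lambda>x y. volterra_product f g x y + s x y))" for q
  have XI: "X (\<lambda>x y. volterra_product f g x y + s x y)"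
    if "smooth2_on I f" "smooth2_on I g" "smooth2_on I s" for f g s
    using that by (auto simp: X_def)
  show ?thesis
  proof (rule smooth2_coinduct[where X = X])
    show "X (volterra_product f g)" using XI[OF assms smooth2_const[of 0]] by simp
  next
    fix q assume "X q"
    then obtain f g s where f: "smooth2_on I f" and g: "smooth2_on I g" and s: "smooth2_on I s"
      and q: "q = (\<lambda>x y. volterra_product f g x y + s x y)" by (auto simp: X_def)
    show "continuous_on (I \<times> I) (\<lambda>(x, y). q x y)"
      using continuous_on_add[OF volterra_product_continuous[OF f g] smooth2_continuous[OF s]]
      unfolding q split_beta .
    define q1 where "q1 = (\<lambda>x y. volterra_product (partial1 I f) g x y + (f x x * g x y + partial1 I s x y))"
    define q2 where "q2 = (\<lambda>x y. volterra_product f (partial2 I g) x y + (partial2 I s x y - f x y * g y y))"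
    have "X q1" "X q2" unfolding q1_def q2_def
      by (rule XI, (intro smooth2_add smooth2_diff smooth2_mult smooth2_diagonal(1)[OF f]
            smooth2_diagonal(2)[OF g] smooth2_partials f g s)+)+
    moreover have "((\<lambda>s. q s y) has_vector_derivative q1 x y) (at x within I)"
      "((\<lambda>t. q x t) has_vector_derivative q2 x y) (at y within I)" if I: "x \<in> I" "y \<in> I" for x y
    proof -
      have "((\<lambda>s. q s y) has_vector_derivative
          (f x x * g x y + volterra_product (partial1 I f) g x y) + partial1 I s x y) (at x within I)"
        unfolding q by (intro has_vector_derivative_add volterra_product_partials smooth2_partials f g s I)
      then show "((\<lambda>s. q s y) has_vector_derivative q1 x y) (at x within I)"
        by (simp add: q1_def algebra_simps)
      have "((\<lambda>t. q x t) has_vector_derivative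
          (volterra_product f (partial2 I g) x y - f x y * g y y) + partial2 I s x y) (at y within I)"
        unfolding q by (intro has_vector_derivative_add volterra_product_partials smooth2_partials f g s I)
      then show "((\<lambda>t. q x t) has_vector_derivative q2 x y) (at y within I)"
        by (simp add: q2_def algebra_simps)
    qed
    ultimately show "\<exists>g h. X g \<and> X h \<and> (\<forall>x\<in>I. \<forall>y\<in>I. ((\<lambda>s. q s y) has_vector_derivative g x y) (at x within I) \<and>
          ((\<lambda>s. q x s) has_vector_derivative h x y) (at y within I))"
      by (intro exI[of _ q1] exI[of _ q2] conjI ballI)
  qed
qed

end

section \<open>Test functions\<close>

context star_interval
begin

abbreviation "J \<equiv> interior I"
abbreviation "TF \<equiv> test_fun I"

lemma interior_star_interval: "star_interval J"
proof (rule star_interval.intro)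
  show "is_interval J" unfolding is_interval_convex_1 by (rule convex_interior[OF convex_interval])
  show "interior J \<noteq> {}" using interior_nonempty by simp
qed

lemma at_within_J: "t \<in> J \<Longrightarrow> at t within J = at t" "t \<in> J \<Longrightarrow> at t within I = at t"
  by (rule at_within_open, assumption, rule open_interior) (rule at_within_interior)

lemma J_subset: "t \<in> J \<Longrightarrow> t \<in> I"
  by (rule subsetD[OF interior_subset])

lemma smooth2_on_J: "smooth2_on I f \<Longrightarrow> smooth2_on J f"
  by (rule smooth2_on_subset[OF _ interior_subset])

lemma test_funE:
  assumes "h \<in> TF"
  obtains a where "a \<in> J" "\<And>t. t \<in> J \<Longrightarrow> t \<le> a \<Longrightarrow> h t = 0"
proof -
  obtain b where b: "b \<in> J" "\<And>t. t \<in> J \<Longrightarrow> t < b \<Longrightarrow> h t = 0" using assms by (auto simp: test_fun_def)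
  obtain e where e: "e > 0" "ball b e \<subseteq> J" using b(1) open_contains_ball open_interior by blast
  \<comment> \<open>a smaller bound turns \<open><\<close> into \<open>\<le>\<close>\<close>
  have "b - e/2 \<in> J" using e by (auto simp: dist_real_def subset_eq)
  then show ?thesis using that[of "b - e/2"] b e by auto
qed

text \<open>Test functions are smooth kernels that do not depend on the second variable, so that they inherit
  the closure properties of smooth kernels.\<close>

lemma test_fun_iff:
  "h \<in> TF \<longleftrightarrow> smooth2_on J (\<lambda>x y. h x) \<and> (\<exists>a\<in>J. \<forall>t\<in>J. t < a \<longrightarrow> h t = 0)"
proof -
  have "(\<forall>n. \<forall>t\<in>J. (vderiv ^^ n) h differentiable (at t)) \<longleftrightarrow> smooth2_on J (\<lambda>x y. h x)"
  proof
    assume *: "\<forall>n. \<forall>t\<in>J. (vderiv ^^ n) h differentiable (at t)"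
    have d: "((vderiv ^^ n) h has_vector_derivative (vderiv ^^ Suc n) h t) (at t)" if "t \<in> J" for n t
      using * that by (simp add: vderiv_def vector_derivative_works)
    have c: "continuous_on J ((vderiv ^^ n) h)" for n
      using d has_vector_derivative_continuous by (blast intro: continuous_at_imp_continuous_on)
    have "derivative_family J (\<lambda>x y. h x) (\<lambda>i j x y. if j = 0 then (vderiv ^^ i) h x else 0)"
      unfolding derivative_family_def
    proof (intro conjI allI ballI)
      show "continuous_on (J \<times> J) (\<lambda>(x, y). if j = (0::nat) then (vderiv ^^ i) h x else 0)" for i j
        using star_interval.continuous_on_fst_snd(1)[OF interior_star_interval c, of i]
        by (cases "j = 0") (simp_all add: split_beta)
      fix i j :: nat and x y assume "x \<in> J" "y \<in> J"
      then show "((\<lambda>s. if j = 0 then (vderiv ^^ i) h s else 0) has_vector_derivative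
          (if j = 0 then (vderiv ^^ Suc i) h x else 0)) (at x within J)"
        using has_vector_derivative_at_within[OF d] by (cases "j = 0") simp_all
      show "((\<lambda>s. if j = 0 then (vderiv ^^ i) h x else 0) has_vector_derivative
          (if Suc j = 0 then (vderiv ^^ i) h x else 0)) (at y within J)"
        by simp
    qed auto
    then show "smooth2_on J (\<lambda>x y. h x)" by (auto simp: smooth2_on_iff)
  next
    assume "smooth2_on J (\<lambda>x y. h x)"
    then obtain F where F: "derivative_family J (\<lambda>x y. h x) F" by (auto simp: smooth2_on_iff)
    obtain y where y: "y \<in> J" using interior_nonempty by auto
    have d: "((\<lambda>s. F n 0 s y) has_vector_derivative F (Suc n) 0 t y) (at t)" if "t \<in> J" for n t
      using derivative_familyD(3)[OF F that y, of n 0] that by (simp add: at_within_J)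
    have eq: "\<forall>t\<in>J. (vderiv ^^ n) h t = F n 0 t y" for n
    proof (induction n)
      case 0 then show ?case using derivative_familyD(1)[OF F _ y] by simp
    next
      case (Suc n)
      have "vderiv ((vderiv ^^ n) h) t = F (Suc n) 0 t y" if "t \<in> J" for t
        unfolding vderiv_def
        by (rule vector_derivative_at, rule has_vector_derivative_transform_within_open[OF d open_interior])
           (use that Suc vderiv_def in auto)
      then show ?case by simp
    qed
    show "\<forall>n. \<forall>t\<in>J. (vderiv ^^ n) h differentiable (at t)"
    proof (intro allI ballI)
      fix n t assume t: "t \<in> J"
      have "((vderiv ^^ n) h has_vector_derivative F (Suc n) 0 t y) (at t)"
        by (rule has_vector_derivative_transform_within_open[OF d[OF t] open_interior t]) (use eq in auto)
      then show "(vderiv ^^ n) h differentiable (at t)" by (rule differentiableI_vector)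
    qed
  qed
  then show ?thesis by (auto simp: test_fun_def)
qed

lemma test_fun_cong: "h \<in> TF \<Longrightarrow> (\<And>t. t \<in> J \<Longrightarrow> g t = h t) \<Longrightarrow> g \<in> TF"
  unfolding test_fun_iff using smooth2_on_cong[of J "\<lambda>x y. h x" "\<lambda>x y. g x"] by auto

lemma test_fun_zero: "(\<lambda>t. 0) \<in> TF"
  using star_interval.smooth2_const[OF interior_star_interval] interior_nonempty
  by (auto simp: test_fun_iff)

lemma test_fun_add:
  assumes "h \<in> TF" "g \<in> TF"
  shows "(\<lambda>t. h t + g t) \<in> TF"
proof -
  obtain a where a: "a \<in> J" "\<And>t. t \<in> J \<Longrightarrow> t \<le> a \<Longrightarrow> h t = 0" using test_funE[OF assms(1)] by blast
  obtain b where b: "b \<in> J" "\<And>t. t \<in> J \<Longrightarrow> t \<le> b \<Longrightarrow> g t = 0" using test_funE[OF assms(2)] by blast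
  have "\<exists>c\<in>J. \<forall>t\<in>J. t < c \<longrightarrow> h t + g t = 0"
    by (rule bexI[of _ "min a b"]) (use a b in \<open>auto simp: min_def\<close>)
  then show ?thesis
    using star_interval.smooth2_add[OF interior_star_interval] assms unfolding test_fun_iff by blast
qed

lemma test_fun_mult:
  assumes "smooth2_on I (\<lambda>x y. c x)" "h \<in> TF"
  shows "(\<lambda>t. c t * h t) \<in> TF"
proof -
  have "smooth2_on J (\<lambda>x y. c x * h x)"
    using star_interval.smooth2_mult[OF interior_star_interval smooth2_on_J[OF assms(1)]] assms(2)
    unfolding test_fun_iff by blast
  then show ?thesis using assms(2) unfolding test_fun_iff by force
qed

lemma test_fun_uminus: "h \<in> TF \<Longrightarrow> (\<lambda>t. - h t) \<in> TF"
  using test_fun_mult[OF smooth2_const[of "-1"]] by simp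

lemma test_fun_has_vector_derivative:
  assumes "h \<in> TF" "t \<in> J"
  shows "(h has_vector_derivative vderiv h t) (at t)"
proof -
  have "(vderiv ^^ 0) h differentiable (at t)" using assms unfolding test_fun_def by blast
  then show ?thesis by (simp add: vderiv_def vector_derivative_works)
qed

lemma test_fun_continuous: "h \<in> TF \<Longrightarrow> continuous_on J h"
  using test_fun_has_vector_derivative has_vector_derivative_continuous
  by (blast intro: continuous_at_imp_continuous_on)

lemma test_fun_vderiv:
  assumes "h \<in> TF"
  shows "vderiv h \<in> TF"
proof -
  have "(vderiv ^^ n) (vderiv h) differentiable (at t)" if "t \<in> J" for n t
  proof -
    have "(vderiv ^^ Suc n) h differentiable (at t)" using assms that unfolding test_fun_def by blast
    then show ?thesis by (simp only: funpow_Suc_right o_apply)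
  qed
  moreover obtain a where a: "a \<in> J" "\<And>t. t \<in> J \<Longrightarrow> t \<le> a \<Longrightarrow> h t = 0" using test_funE[OF assms] by blast
  have "vderiv h t = 0" if "t \<in> J" "t < a" for t
    unfolding vderiv_def
    by (rule vector_derivative_at, rule has_vector_derivative_transform_within_open[of "\<lambda>t. 0" 0 t "J \<inter> {..<a}"])
       (use a that in auto)
  ultimately show ?thesis using a(1) unfolding test_fun_def by blast
qed

text \<open>A function that vanishes near the left end of the interval is integrated from any point to the
  left of its support; this replaces the integral from the left end by one with fixed limits.\<close>

lemma integral_left:
  assumes a: "a \<in> J" "\<And>t. t \<in> J \<Longrightarrow> t \<le> a \<Longrightarrow> k t = 0" and x: "x \<in> J"
  shows "integral {t \<in> J. t \<le> x} k = oint a x k"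
proof -
  interpret J: star_interval J by (rule interior_star_interval)
  have "oint a x k = integral {a..x} k"
  proof (cases "a \<le> x")
    case True then show ?thesis by (rule oint_le)
  next
    case False
    then have "integral {x..a} k = integral {x..a} (\<lambda>t. 0)"
      using a J.segment_subset[OF x a(1)] by (intro integral_cong) auto
    then show ?thesis using False by (simp add: oint_def)
  qed
  also have "\<dots> = integral UNIV (\<lambda>t. if t \<in> {a..x} then k t else 0)"
    by (rule Henstock_Kurzweil_Integration.integral_restrict_UNIV[symmetric])
  also have "(\<lambda>t. if t \<in> {a..x} then k t else 0) = (\<lambda>t. if t \<in> {t \<in> J. t \<le> x} then k t else 0)"
    using a J.segment_subset[OF a(1) x] by (auto simp: fun_eq_iff subset_eq)
  also have "integral UNIV \<dots> = integral {t \<in> J. t \<le> x} k"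
    by (rule Henstock_Kurzweil_Integration.integral_restrict_UNIV)
  finally show ?thesis by simp
qed

text \<open>Once the lower limit is a point \<open>a\<close> to the left of the support of \<open>h\<close>, the function is the section at
  \<open>a\<close> of the product of the kernel \<open>f\<close> with the kernel \<open>h(x)\<close>, hence smooth.\<close>

lemma test_fun_volterra:
  assumes f: "smooth2_on I f" and h: "h \<in> TF"
  shows "(\<lambda>x. integral {t \<in> J. t \<le> x} (\<lambda>t. f x t * h t)) \<in> TF"
proof -
  interpret J: star_interval J by (rule interior_star_interval)
  obtain a where a: "a \<in> J" "\<And>t. t \<in> J \<Longrightarrow> t \<le> a \<Longrightarrow> h t = 0" using test_funE[OF h] by blast
  have eq: "integral {t \<in> J. t \<le> x} (\<lambda>t. f x t * h t) = oint a x (\<lambda>t. f x t * h t)" if "x \<in> J" for x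
    using integral_left[OF a(1) _ that] a(2) by simp
  have "smooth2_on J (volterra_product f (\<lambda>x y. h x))"
    using J.smooth2_volterra_product smooth2_on_J[OF f] h unfolding test_fun_iff by blast
  from J.smooth2_section[OF this a(1)]
  have "smooth2_on J (\<lambda>x y. oint a x (\<lambda>t. f x t * h t))" by (simp add: volterra_product_def)
  moreover have "oint a x (\<lambda>t. f x t * h t) = 0" if "x \<in> J" "x < a" for x
  proof -
    have "integral {t \<in> J. t \<le> x} (\<lambda>t. f x t * h t) = integral {t \<in> J. t \<le> x} (\<lambda>t. 0)"
      using a that by (intro integral_cong) auto
    then show ?thesis using eq that by simp
  qed
  ultimately have "(\<lambda>x. oint a x (\<lambda>t. f x t * h t)) \<in> TF"
    unfolding test_fun_iff using a(1) by blast
  then show ?thesis by (rule test_fun_cong) (use eq in auto)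
qed

end

section \<open>The ring of operators on test functions\<close>

text \<open>Distributions act on test functions, and the star product is the composition of these actions.
  The last condition, dependence on the values in the interior only, is what makes the unit neutral on
  the right: the action of the unit truncates a test function to the interior.\<close>

definition star_operators :: "real set \<Rightarrow> distr set" where
  "star_operators I = {d.
     (\<forall>t h. \<not> (t \<in> interior I \<and> h \<in> test_fun I) \<longrightarrow> d t h = 0) \<and>
     (\<forall>h\<in>test_fun I. (\<lambda>t. d t h) \<in> test_fun I) \<and>
     (\<forall>h\<in>test_fun I. \<forall>g\<in>test_fun I. \<forall>t. d t (\<lambda>s. h s + g s) = d t h + d t g) \<and>
     (\<forall>h\<in>test_fun I. \<forall>g. (\<forall>s\<in>interior I. g s = h s) \<longrightarrow> (\<forall>t. d t g = d t h))}"

lemma star_assoc: "(a \<star> b) \<star> c = a \<star> (b \<star> c)"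
  by (simp add: star_def)

lemma star_add_left: "(a + b) \<star> c = a \<star> c + b \<star> c"
  by (simp add: star_def fun_eq_iff)

lemma star_diff_left: "(a - b) \<star> c = a \<star> c - b \<star> c"
  by (simp add: star_def fun_eq_iff)

lemma star_uminus_left: "(- a) \<star> c = - (a \<star> c)"
  by (simp add: star_def fun_eq_iff)

lemma star_zero_left [simp]: "0 \<star> c = 0"
  by (simp add: star_def fun_eq_iff)

lemma sum_distr_apply: "(\<Sum>i\<in>S. a i) t h = (\<Sum>i\<in>S. (a i :: distr) t h)"
  by (induction S rule: infinite_finite_induct) simp_all

lemma star_sum_left: "(\<Sum>i\<in>S. a i) \<star> c = (\<Sum>i\<in>S. a i \<star> c)"
  by (intro ext) (simp add: star_def sum_distr_apply)

context star_interval
begin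

abbreviation "Ops \<equiv> star_operators I"

lemma ops_outside: "d \<in> Ops \<Longrightarrow> \<not> (t \<in> J \<and> h \<in> TF) \<Longrightarrow> d t h = 0"
  unfolding star_operators_def by blast

lemma ops_test_fun: "d \<in> Ops \<Longrightarrow> h \<in> TF \<Longrightarrow> (\<lambda>t. d t h) \<in> TF"
  unfolding star_operators_def by blast

lemma ops_additive: "d \<in> Ops \<Longrightarrow> h \<in> TF \<Longrightarrow> g \<in> TF \<Longrightarrow> d t (\<lambda>s. h s + g s) = d t h + d t g"
  unfolding star_operators_def by blast

lemma ops_local: "d \<in> Ops \<Longrightarrow> h \<in> TF \<Longrightarrow> (\<And>s. s \<in> J \<Longrightarrow> g s = h s) \<Longrightarrow> d t g = d t h"
  unfolding star_operators_def by blast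

lemma opsI:
  assumes "\<And>t h. \<not> (t \<in> J \<and> h \<in> TF) \<Longrightarrow> d t h = 0"
    and "\<And>h. h \<in> TF \<Longrightarrow> (\<lambda>t. d t h) \<in> TF"
    and "\<And>t h g. t \<in> J \<Longrightarrow> h \<in> TF \<Longrightarrow> g \<in> TF \<Longrightarrow> d t (\<lambda>s. h s + g s) = d t h + d t g"
    and "\<And>t h g. t \<in> J \<Longrightarrow> h \<in> TF \<Longrightarrow> (\<And>s. s \<in> J \<Longrightarrow> g s = h s) \<Longrightarrow> d t g = d t h"
  shows "d \<in> Ops"
proof -
  have "d t (\<lambda>s. h s + g s) = d t h + d t g" if "h \<in> TF" "g \<in> TF" for t h g
  proof (cases "t \<in> J")
    case True
    then show ?thesis by (rule assms(3)[OF _ that])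
  next
    case False
    then show ?thesis by (simp add: assms(1))
  qed
  moreover have "d t g = d t h" if "h \<in> TF" "\<forall>s\<in>J. g s = h s" for t h g
  proof (cases "t \<in> J")
    case True
    then show ?thesis using that by (intro assms(4)) auto
  next
    case False
    then show ?thesis by (simp add: assms(1))
  qed
  ultimately show ?thesis unfolding star_operators_def mem_Collect_eq
    by (intro conjI allI impI ballI assms(1,2))
qed

lemma ops_eqI:
  assumes "d \<in> Ops" "e \<in> Ops" "\<And>t h. t \<in> J \<Longrightarrow> h \<in> TF \<Longrightarrow> d t h = e t h"
  shows "d = e"
proof (intro ext)
  show "d t h = e t h" for t h
    using assms ops_outside[of d t h] ops_outside[of e t h] by (cases "t \<in> J \<and> h \<in> TF") auto
qed

lemma ops_zero_fun: "d \<in> Ops \<Longrightarrow> d t (\<lambda>s. 0) = 0"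
  using ops_additive[OF _ test_fun_zero test_fun_zero, of d t] by simp

lemma ops_zero [simp]: "0 \<in> Ops"
  by (rule opsI) (auto simp: test_fun_zero)

lemma ops_add: "d \<in> Ops \<Longrightarrow> e \<in> Ops \<Longrightarrow> d + e \<in> Ops"
  by (rule opsI) (auto simp: ops_outside ops_additive test_fun_add ops_test_fun
      intro: arg_cong2[where f = "(+)"] ops_local)

lemma ops_uminus: "d \<in> Ops \<Longrightarrow> - d \<in> Ops"
  by (rule opsI) (auto simp: ops_outside ops_additive test_fun_uminus ops_test_fun intro: ops_local)

lemma ops_diff: "d \<in> Ops \<Longrightarrow> e \<in> Ops \<Longrightarrow> d - e \<in> Ops"
  using ops_add[OF _ ops_uminus] by fastforce

lemma ops_star: "d \<in> Ops \<Longrightarrow> e \<in> Ops \<Longrightarrow> d \<star> e \<in> Ops"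
proof (rule opsI)
  assume d: "d \<in> Ops" and e: "e \<in> Ops"
  show "(d \<star> e) t h = 0" if "\<not> (t \<in> J \<and> h \<in> TF)" for t h
  proof (cases "h \<in> TF")
    case True
    then show ?thesis using that ops_outside[OF d] by (simp add: star_def)
  next
    case False
    then show ?thesis using ops_outside[OF e] ops_zero_fun[OF d] by (simp add: star_def)
  qed
  show "(\<lambda>t. (d \<star> e) t h) \<in> TF" if "h \<in> TF" for h
    using that d e by (simp add: star_def ops_test_fun)
  show "(d \<star> e) t (\<lambda>s. h s + g s) = (d \<star> e) t h + (d \<star> e) t g" if "h \<in> TF" "g \<in> TF" for t h g
    unfolding star_def ops_additive[OF e that]
    by (rule ops_additive[OF d ops_test_fun[OF e that(1)] ops_test_fun[OF e that(2)]])
  show "(d \<star> e) t g = (d \<star> e) t h" if "h \<in> TF" "\<And>s. s \<in> J \<Longrightarrow> g s = h s" for t h g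
    unfolding star_def using ops_local[OF e that(1), of g] that(2) by simp
qed

lemma one_star_apply: "one_star I t h = (if t \<in> J \<and> h \<in> TF then h t else 0)"
  by (simp add: const_delta_def dform_def)

lemma ops_one [simp]: "one_star I \<in> Ops"
  by (rule opsI)
     (auto simp: one_star_apply test_fun_add intro: test_fun_cong)

lemma ops_sum: "(\<And>i. i \<in> S \<Longrightarrow> d i \<in> Ops) \<Longrightarrow> (\<Sum>i\<in>S. d i) \<in> Ops"
  by (induction S rule: infinite_finite_induct) (auto intro: ops_add)

lemma star_one_left: "d \<in> Ops \<Longrightarrow> one_star I \<star> d = d"
proof (rule ops_eqI)
  fix t h assume "d \<in> Ops" "t \<in> J" "h \<in> TF"
  then show "(one_star I \<star> d) t h = d t h"
    by (simp add: star_def one_star_apply ops_test_fun)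
qed (simp_all add: ops_star)

lemma star_one_right: "d \<in> Ops \<Longrightarrow> d \<star> one_star I = d"
proof (rule ops_eqI)
  fix t h assume d: "d \<in> Ops" and h: "h \<in> TF"
  show "(d \<star> one_star I) t h = d t h"
    unfolding star_def by (rule ops_local[OF d h]) (simp add: one_star_apply h)
qed (simp_all add: ops_star)

lemma star_add_right:
  assumes "d \<in> Ops" "a \<in> Ops" "b \<in> Ops"
  shows "d \<star> (a + b) = d \<star> a + d \<star> b"
proof (rule ops_eqI)
  show "(d \<star> (a + b)) t h = (d \<star> a + d \<star> b) t h" if "h \<in> TF" for t h
    using ops_additive[OF assms(1) ops_test_fun[OF assms(2) that] ops_test_fun[OF assms(3) that], of t]
    by (simp add: star_def)
qed (intro ops_star ops_add assms)+

lemma star_zero_right [simp]: "d \<in> Ops \<Longrightarrow> d \<star> 0 = 0"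
  by (simp add: star_def fun_eq_iff ops_zero_fun)

lemma star_uminus_right:
  assumes "d \<in> Ops" "a \<in> Ops"
  shows "d \<star> (- a) = - (d \<star> a)"
proof -
  have "d \<star> (- a) + d \<star> a = d \<star> 0"
    using star_add_right[OF assms(1) ops_uminus[OF assms(2)] assms(2)] by simp
  then show ?thesis using assms(1) by (simp add: eq_neg_iff_add_eq_0)
qed

lemma star_diff_right:
  assumes "d \<in> Ops" "a \<in> Ops" "b \<in> Ops"
  shows "d \<star> (a - b) = d \<star> a - d \<star> b"
  using star_add_right[OF assms(1,2) ops_uminus[OF assms(3)]] star_uminus_right[OF assms(1,3)] by simp

lemma star_sum_right:
  assumes "d \<in> Ops" "\<And>i. i \<in> S \<Longrightarrow> a i \<in> Ops"
  shows "d \<star> (\<Sum>i\<in>S. a i) = (\<Sum>i\<in>S. d \<star> a i)"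
  using assms(2)
  by (induction S rule: infinite_finite_induct) (simp_all add: assms(1) star_add_right ops_sum)

end

section \<open>Multiplication, differentiation and Volterra operators\<close>

definition mult_op :: "real set \<Rightarrow> (real \<Rightarrow> complex) \<Rightarrow> distr" where
  "mult_op I c = (\<lambda>t h. if t \<in> interior I \<and> h \<in> test_fun I then c t * h t else 0)"

definition deriv_op :: "real set \<Rightarrow> distr" where
  "deriv_op I = (\<lambda>t h. if t \<in> interior I \<and> h \<in> test_fun I then vderiv h t else 0)"

lemma theta_apply:
  "theta I f t h = (if t \<in> interior I \<and> h \<in> test_fun I
     then integral {s \<in> interior I. s \<le> t} (\<lambda>s. f t s * h s) else 0)"
  by (simp add: theta_def dform_def)

context star_interval
begin

abbreviation "Mul \<equiv> mult_op I"
abbreviation "Der \<equiv> deriv_op I"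
abbreviation "Vol \<equiv> theta I"
abbreviation "Integ \<equiv> theta I (\<lambda>x y. 1 :: complex)"
abbreviation "Unit \<equiv> one_star I"
abbreviation "smooth1 c \<equiv> smooth2_on I (\<lambda>x y. c x)"
abbreviation "smooth2 f \<equiv> smooth2_on I f"

lemma vector_derivative_const_within: "x \<in> I \<Longrightarrow> vector_derivative (\<lambda>s. c) (at x within I) = (0 :: complex)"
  by (rule vector_derivative_within[OF at_within_nontrivial has_vector_derivative_const])

lemma theta_oint:
  assumes "a \<in> J" "\<And>s. s \<in> J \<Longrightarrow> s \<le> a \<Longrightarrow> h s = 0" "h \<in> TF" "t \<in> J"
  shows "Vol f t h = oint a t (\<lambda>s. f t s * h s)"
  using integral_left[OF assms(1) _ assms(4), of "\<lambda>s. f t s * h s"] assms by (simp add: theta_apply)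

lemma smooth2_continuous_J:
  assumes "smooth2 f" "t \<in> J"
  shows "continuous_on J (f t)"
proof -
  have "continuous_on I (f t)"
    by (rule continuous_on_section(1)[OF smooth2_continuous[OF assms(1)] J_subset[OF assms(2)]])
  then show ?thesis by (rule continuous_on_subset) (rule interior_subset)
qed

lemma ops_mult:
  assumes "smooth1 c"
  shows "Mul c \<in> Ops"
proof (rule opsI)
  show "(\<lambda>t. Mul c t h) \<in> TF" if "h \<in> TF" for h
    by (rule test_fun_cong[OF test_fun_mult[OF assms that]]) (simp add: mult_op_def that)
  show "Mul c t g = Mul c t h" if "t \<in> J" "h \<in> TF" "\<And>s. s \<in> J \<Longrightarrow> g s = h s" for t h g
    using that test_fun_cong[OF that(2), of g] by (simp add: mult_op_def)
qed (auto simp: mult_op_def test_fun_add algebra_simps)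

lemma vderiv_cong: "(\<And>s. s \<in> J \<Longrightarrow> g s = h s) \<Longrightarrow> h \<in> TF \<Longrightarrow> t \<in> J \<Longrightarrow> vderiv g t = vderiv h t"
  unfolding vderiv_def[of g]
  by (rule vector_derivative_at,
      rule has_vector_derivative_transform_within_open[OF test_fun_has_vector_derivative open_interior]) auto

lemma vderiv_add: "g \<in> TF \<Longrightarrow> h \<in> TF \<Longrightarrow> t \<in> J \<Longrightarrow> vderiv (\<lambda>s. g s + h s) t = vderiv g t + vderiv h t"
  unfolding vderiv_def[of "\<lambda>s. g s + h s"]
  by (intro vector_derivative_at has_vector_derivative_add test_fun_has_vector_derivative)

lemma ops_deriv: "Der \<in> Ops"
proof (rule opsI)
  show "(\<lambda>t. Der t h) \<in> TF" if "h \<in> TF" for h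
    by (rule test_fun_cong[OF test_fun_vderiv[OF that]]) (simp add: deriv_op_def that)
  show "Der t g = Der t h" if "t \<in> J" "h \<in> TF" "\<And>s. s \<in> J \<Longrightarrow> g s = h s" for t h g
    using that test_fun_cong[OF that(2), of g] vderiv_cong[of g h t] by (simp add: deriv_op_def)
qed (auto simp: deriv_op_def test_fun_add vderiv_add)

lemma ops_theta:
  assumes f: "smooth2 f"
  shows "Vol f \<in> Ops"
proof (rule opsI)
  interpret J: star_interval J by (rule interior_star_interval)
  show "(\<lambda>t. Vol f t h) \<in> TF" if "h \<in> TF" for h
    by (rule test_fun_cong[OF test_fun_volterra[OF f that]]) (simp add: theta_apply that)
  show "Vol f t (\<lambda>s. h s + g s) = Vol f t h + Vol f t g" if tJ: "t \<in> J" and h: "h \<in> TF" and g: "g \<in> TF" for t h g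
  proof -
    obtain a where a: "a \<in> J" "\<And>t. t \<in> J \<Longrightarrow> t \<le> a \<Longrightarrow> h t = 0" using test_funE[OF h] by blast
    obtain b where b: "b \<in> J" "\<And>t. t \<in> J \<Longrightarrow> t \<le> b \<Longrightarrow> g t = 0" using test_funE[OF g] by blast
    define c where "c = min a b"
    have c: "c \<in> J" "\<And>t. t \<in> J \<Longrightarrow> t \<le> c \<Longrightarrow> h t = 0" "\<And>t. t \<in> J \<Longrightarrow> t \<le> c \<Longrightarrow> g t = 0"
      using a b by (auto simp: c_def min_def split: if_splits)
    note cont = continuous_on_mult[OF smooth2_continuous_J[OF f tJ] test_fun_continuous]
    have "oint c t (\<lambda>s. f t s * h s + f t s * g s) = oint c t (\<lambda>s. f t s * h s) + oint c t (\<lambda>s. f t s * g s)"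
      by (rule J.oint_add[OF cont[OF h] cont[OF g] c(1) tJ])
    then show ?thesis
      using theta_oint[OF c(1,2) h tJ] theta_oint[OF c(1,3) g tJ]
        theta_oint[OF c(1) _ test_fun_add[OF h g] tJ] c(2,3)
      by (simp add: distrib_left)
  qed
  show "Vol f t g = Vol f t h" if h: "h \<in> TF" and gh: "\<And>s. s \<in> J \<Longrightarrow> g s = h s" for t h g
  proof -
    have "integral {s \<in> J. s \<le> t} (\<lambda>s. f t s * g s) = integral {s \<in> J. s \<le> t} (\<lambda>s. f t s * h s)"
      by (rule integral_cong) (use gh in auto)
    then show ?thesis using h test_fun_cong[OF h, of g] gh by (simp add: theta_apply)
  qed
qed (auto simp: theta_apply)

lemma mult_cong: "(\<And>t. t \<in> J \<Longrightarrow> c t = d t) \<Longrightarrow> Mul c = Mul d"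
  by (auto simp: mult_op_def fun_eq_iff)

lemma theta_cong:
  assumes "\<And>t s. t \<in> J \<Longrightarrow> s \<in> J \<Longrightarrow> f t s = g t s"
  shows "Vol f = Vol g"
proof -
  have "integral {s \<in> J. s \<le> t} (\<lambda>s. f t s * h s) = integral {s \<in> J. s \<le> t} (\<lambda>s. g t s * h s)"
    if "t \<in> J" for t h by (rule integral_cong) (use that assms in auto)
  then show ?thesis by (auto simp: theta_apply fun_eq_iff)
qed

lemma mult_zero [simp]: "Mul (\<lambda>t. 0) = 0"
  by (auto simp: mult_op_def fun_eq_iff)

lemma mult_one: "Mul (\<lambda>t. 1) = Unit"
  by (auto simp: mult_op_def one_star_apply fun_eq_iff)

lemma mult_add: "Mul c + Mul d = Mul (\<lambda>t. c t + d t)"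
  by (auto simp: mult_op_def fun_eq_iff algebra_simps)

lemma mult_diff: "Mul c - Mul d = Mul (\<lambda>t. c t - d t)"
  by (auto simp: mult_op_def fun_eq_iff algebra_simps)

lemma mult_sum: "(\<Sum>k\<in>S. Mul (c k)) = Mul (\<lambda>t. \<Sum>k\<in>S. c k t)"
  by (auto simp: fun_eq_iff sum_distr_apply mult_op_def sum_distrib_right)

lemma theta_zero [simp]: "Vol (\<lambda>x y. 0) = 0"
  by (auto simp: theta_apply fun_eq_iff)

lemma theta_scale: "Mul c \<star> Vol f = Vol (\<lambda>x y. c x * f x y)" if "smooth2 f" "smooth1 c" for f c
proof (rule ops_eqI)
  show "(Mul c \<star> Vol f) t h = Vol (\<lambda>x y. c x * f x y) t h" if "t \<in> J" "h \<in> TF" for t h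
    using that ops_test_fun[OF ops_theta[OF \<open>smooth2 f\<close>] that(2)]
    by (simp add: star_def mult_op_def theta_apply[of I "\<lambda>x y. c x * f x y"] theta_apply[of I f t] mult.assoc)
qed (intro ops_star ops_mult ops_theta smooth2_mult that)+

lemma theta_add: "Vol f + Vol g = Vol (\<lambda>x y. f x y + g x y)" if f: "smooth2 f" and g: "smooth2 g" for f g
proof (rule ops_eqI)
  interpret J: star_interval J by (rule interior_star_interval)
  show "(Vol f + Vol g) t h = Vol (\<lambda>x y. f x y + g x y) t h" if tJ: "t \<in> J" and h: "h \<in> TF" for t h
  proof -
    obtain a where a: "a \<in> J" "\<And>t. t \<in> J \<Longrightarrow> t \<le> a \<Longrightarrow> h t = 0" using test_funE[OF h] by blast
    note cont = continuous_on_mult[OF smooth2_continuous_J[OF _ tJ] test_fun_continuous[OF h]]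
    have "oint a t (\<lambda>s. f t s * h s + g t s * h s) = oint a t (\<lambda>s. f t s * h s) + oint a t (\<lambda>s. g t s * h s)"
      by (rule J.oint_add[OF cont[OF f] cont[OF g] a(1) tJ])
    then show ?thesis using theta_oint[OF a h tJ] by (simp add: distrib_right)
  qed
qed (intro ops_add ops_theta smooth2_add f g)+

lemma theta_uminus: "- Vol f = Vol (\<lambda>x y. - f x y)"
  by (auto simp: theta_apply fun_eq_iff)

lemma theta_diff: "Vol f - Vol g = Vol (\<lambda>x y. f x y - g x y)" if "smooth2 f" "smooth2 g" for f g
  using theta_add[OF that(1) smooth2_minus[OF that(2)]] theta_uminus[of g, symmetric] by simp

lemma mult_mult: "Mul c \<star> Mul d = Mul (\<lambda>t. c t * d t)" if "smooth1 c" "smooth1 d" for c d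
proof (rule ops_eqI)
  show "(Mul c \<star> Mul d) t h = Mul (\<lambda>t. c t * d t) t h" if "t \<in> J" "h \<in> TF" for t h
    using that ops_test_fun[OF ops_mult[OF \<open>smooth1 d\<close>] that(2)]
    by (simp add: star_def mult_op_def mult.assoc)
qed (intro ops_star ops_mult smooth2_mult that)+

lemma smooth2_fst: "smooth1 c \<Longrightarrow> smooth2_on I (\<lambda>x y. c y)"
  using smooth2_diagonal(2)[of "\<lambda>x y. c x"] by simp

lemma theta_mult: "Vol f \<star> Mul c = Vol (\<lambda>x y. f x y * c y)" if f: "smooth2 f" and c: "smooth1 c" for f c
proof (rule ops_eqI)
  show "(Vol f \<star> Mul c) t h = Vol (\<lambda>x y. f x y * c y) t h" if "t \<in> J" "h \<in> TF" for t h
  proof -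
    have "integral {s \<in> J. s \<le> t} (\<lambda>s. f t s * Mul c s h) = integral {s \<in> J. s \<le> t} (\<lambda>s. f t s * c s * h s)"
      by (rule integral_cong) (use that in \<open>auto simp: mult_op_def\<close>)
    then show ?thesis using that ops_test_fun[OF ops_mult[OF c] that(2)] by (simp add: star_def theta_apply)
  qed
qed (intro ops_star ops_theta ops_mult smooth2_mult smooth2_fst that)+

text \<open>The product rule.\<close>

lemma deriv_mult:
  assumes c: "smooth1 c" and d: "smooth1 d"
    and cd: "\<And>t. t \<in> J \<Longrightarrow> (c has_vector_derivative d t) (at t)"
  shows "Der \<star> Mul c = Mul d + Mul c \<star> Der"
proof (rule ops_eqI)
  show "(Der \<star> Mul c) t h = (Mul d + Mul c \<star> Der) t h" if t: "t \<in> J" and h: "h \<in> TF" for t h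
  proof -
    have "vderiv (\<lambda>s. Mul c s h) t = vderiv (\<lambda>s. c s * h s) t"
      by (rule vderiv_cong[OF _ test_fun_mult[OF c h] t]) (simp add: mult_op_def h)
    also have "\<dots> = c t * vderiv h t + d t * h t"
      unfolding vderiv_def[of "\<lambda>s. c s * h s"]
      by (intro vector_derivative_at has_vector_derivative_mult cd test_fun_has_vector_derivative t h)
    finally show ?thesis
      using t h ops_test_fun[OF ops_mult[OF c] h] ops_test_fun[OF ops_deriv h]
      by (simp add: star_def deriv_op_def mult_op_def)
  qed
qed (intro ops_star ops_add ops_deriv ops_mult c d)+

text \<open>Differentiation under the integral sign.\<close>

lemma deriv_theta:
  assumes f: "smooth2 f"
  shows "Der \<star> Vol f = Mul (\<lambda>t. f t t) + Vol (partial1 I f)"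
proof (rule ops_eqI)
  interpret J: star_interval J by (rule interior_star_interval)
  show "(Der \<star> Vol f) t h = (Mul (\<lambda>t. f t t) + Vol (partial1 I f)) t h" if t: "t \<in> J" and h: "h \<in> TF" for t h
  proof -
    obtain a where a: "a \<in> J" "\<And>t. t \<in> J \<Longrightarrow> t \<le> a \<Longrightarrow> h t = 0" using test_funE[OF h] by blast
    have prod: "continuous_on (J \<times> J) (\<lambda>(x, s). p x s * h s)" if "smooth2 p" for p
      using continuous_on_mult[OF J.smooth2_continuous[OF smooth2_on_J[OF that]]
          J.continuous_on_fst_snd(2)[OF test_fun_continuous[OF h]]]
      by (simp add: split_beta)
    have "((\<lambda>x. oint a x (\<lambda>s. f x s * h s)) has_vector_derivative
        f t t * h t + oint a t (\<lambda>s. partial1 I f t s * h s)) (at t within J)"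
    proof (rule J.oint_leibniz[OF prod[OF f] prod[OF smooth2_partials(1)[OF f]] _ a(1) t])
      fix x s assume x: "x \<in> J" and s: "s \<in> J"
      have "((\<lambda>x. f x s) has_vector_derivative partial1 I f x s) (at x within J)"
        by (rule has_vector_derivative_within_subset[OF smooth2_partials(3)[OF f J_subset[OF x] J_subset[OF s]] interior_subset])
      then show "((\<lambda>x. f x s * h s) has_vector_derivative partial1 I f x s * h s) (at x within J)"
        by (rule has_vector_derivative_mult_left)
    qed
    then have *: "((\<lambda>x. oint a x (\<lambda>s. f x s * h s)) has_vector_derivative
        f t t * h t + oint a t (\<lambda>s. partial1 I f t s * h s)) (at t)"
      unfolding at_within_J(1)[OF t] .
    have "vderiv (\<lambda>x. Vol f x h) t = f t t * h t + oint a t (\<lambda>s. partial1 I f t s * h s)"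
      unfolding vderiv_def
      by (rule vector_derivative_at, rule has_vector_derivative_transform_within_open[OF * open_interior t])
         (simp add: theta_oint[OF a h])
    then show ?thesis
      using t h ops_test_fun[OF ops_theta[OF f] h] theta_oint[OF a h t]
      by (simp add: star_def deriv_op_def mult_op_def)
  qed
qed (intro ops_star ops_add ops_deriv ops_mult ops_theta smooth2_diagonal(1)[OF f] smooth2_partials f)+

text \<open>Integration by parts; the boundary term at the lower limit vanishes because the test function
  does.\<close>

lemma theta_deriv:
  assumes f: "smooth2 f"
  shows "Vol f \<star> Der = Mul (\<lambda>t. f t t) - Vol (partial2 I f)"
proof (rule ops_eqI)
  interpret J: star_interval J by (rule interior_star_interval)
  show "(Vol f \<star> Der) t h = (Mul (\<lambda>t. f t t) - Vol (partial2 I f)) t h" if t: "t \<in> J" and h: "h \<in> TF" for t h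
  proof -
    have Dh: "(\<lambda>s. Der s h) \<in> TF" by (rule ops_test_fun[OF ops_deriv h])
    obtain b where b: "b \<in> J" "\<And>t. t \<in> J \<Longrightarrow> t \<le> b \<Longrightarrow> h t = 0" using test_funE[OF h] by blast
    obtain c where c: "c \<in> J" "\<And>t. t \<in> J \<Longrightarrow> t \<le> c \<Longrightarrow> Der t h = 0" using test_funE[OF Dh] by blast
    define a where "a = min b c"
    have a: "a \<in> J" "\<And>t. t \<in> J \<Longrightarrow> t \<le> a \<Longrightarrow> h t = 0" using b c by (auto simp: a_def min_def split: if_splits)
    have "\<And>t. t \<in> J \<Longrightarrow> t \<le> a \<Longrightarrow> Der t h = 0" using c by (auto simp: a_def)
    note left = theta_oint[OF a(1) this Dh t]
    have cont: "continuous_on J (\<lambda>s. p t s * g s)" if "smooth2 p" "g \<in> TF" for p g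
      by (rule continuous_on_mult[OF smooth2_continuous_J[OF that(1) t] test_fun_continuous[OF that(2)]])
    have "oint a t (\<lambda>s. f t s * vderiv h s + partial2 I f t s * h s) = f t t * h t - f t a * h a"
    proof (rule J.oint_FTC[OF _ a(1) t])
      fix s assume s: "s \<in> J"
      show "((\<lambda>s. f t s * h s) has_vector_derivative f t s * vderiv h s + partial2 I f t s * h s) (at s within J)"
        by (intro has_vector_derivative_mult
            has_vector_derivative_within_subset[OF smooth2_partials(4)[OF f J_subset[OF t] J_subset[OF s]] interior_subset]
            has_vector_derivative_at_within[OF test_fun_has_vector_derivative[OF h s]])
    qed
    moreover have "oint a t (\<lambda>s. f t s * vderiv h s + partial2 I f t s * h s) =
        oint a t (\<lambda>s. f t s * vderiv h s) + oint a t (\<lambda>s. partial2 I f t s * h s)"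
      by (rule J.oint_add[OF cont[OF f test_fun_vderiv[OF h]] cont[OF smooth2_partials(2)[OF f] h] a(1) t])
    moreover have "oint a t (\<lambda>s. f t s * Der s h) = oint a t (\<lambda>s. f t s * vderiv h s)"
      by (rule J.oint_cong[OF _ a(1) t]) (simp add: deriv_op_def h)
    moreover have "h a = 0" using a by simp
    ultimately have "oint a t (\<lambda>s. f t s * Der s h) = f t t * h t - oint a t (\<lambda>s. partial2 I f t s * h s)"
      by (simp add: algebra_simps)
    then show ?thesis
      using t h left theta_oint[OF a h t] by (simp add: star_def mult_op_def)
  qed
qed (intro ops_star ops_diff ops_deriv ops_mult ops_theta smooth2_diagonal(1)[OF f] smooth2_partials f)+

lemma smooth2_section_left:
  assumes "smooth2_on I f" "a \<in> I"
  shows "smooth2_on I (\<lambda>x y. f a y)"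
proof -
  obtain F where F: "derivative_family I f F" using assms by (auto simp: smooth2_on_iff)
  have "derivative_family I (\<lambda>x y. f a y) (\<lambda>i j x y. if i = 0 then F 0 j a y else 0)"
    unfolding derivative_family_def
  proof (intro conjI allI ballI)
    show "continuous_on (I \<times> I) (\<lambda>(x, y). if i = (0::nat) then F 0 j a y else 0)" for i j
      using continuous_on_fst_snd(2)[OF continuous_on_section(1)[OF derivative_familyD(2)[OF F] assms(2)], of 0 j]
      by (cases "i = 0") (simp_all add: split_beta)
  qed (use derivative_familyD[OF F] assms in auto)
  then show ?thesis by (auto simp: smooth2_on_iff)
qed

text \<open>Interchanging the two integrations over a triangle.  Let the outer factor keep its first argument
  \<open>t\<close> and replace the upper limit \<open>t\<close> by a variable \<open>x\<close>: then both sides vanish at the lower limit and have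
  the same derivative with respect to \<open>x\<close>.\<close>

lemma theta_theta:
  assumes f: "smooth2 f" and g: "smooth2 g"
  shows "Vol f \<star> Vol g = Vol (volterra_product f g)"
proof (rule ops_eqI)
  interpret J: star_interval J by (rule interior_star_interval)
  show "(Vol f \<star> Vol g) t h = Vol (volterra_product f g) t h" if t: "t \<in> J" and h: "h \<in> TF" for t h
  proof -
    obtain a where a: "a \<in> J" "\<And>t. t \<in> J \<Longrightarrow> t \<le> a \<Longrightarrow> h t = 0" using test_funE[OF h] by blast
    \<comment> \<open>the outer kernel with its first argument frozen at \<open>t\<close>\<close>
    define ft where "ft = (\<lambda>(x::real) (y::real). f t y)"
    have ft: "smooth2 ft" unfolding ft_def by (rule smooth2_section_left[OF f J_subset[OF t]])
    have Vg: "(\<lambda>s. Vol g s h) \<in> TF" by (rule ops_test_fun[OF ops_theta[OF g] h])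
    have Vg0: "Vol g s h = 0" if "s \<in> J" "s \<le> a" for s
    proof -
      have "integral {r \<in> J. r \<le> s} (\<lambda>r. g s r * h r) = integral {r \<in> J. r \<le> s} (\<lambda>r. 0)"
        by (rule integral_cong) (use a that in auto)
      then show ?thesis by (simp add: theta_apply)
    qed
    define \<Phi> where "\<Phi> x = oint a x (\<lambda>s. f t s * Vol g s h)" for x
    define \<Psi> where "\<Psi> x = oint a x (\<lambda>s. volterra_product ft g x s * h s)" for x
    have \<Phi>: "(\<Phi> has_vector_derivative f t x * oint a x (\<lambda>s. g x s * h s)) (at x within J)" if "x \<in> J" for x
    proof -
      have "(\<Phi> has_vector_derivative f t x * Vol g x h) (at x within J)"
        unfolding \<Phi>_def
        by (rule J.oint_has_vector_derivative[OF
              continuous_on_mult[OF smooth2_continuous_J[OF f t] test_fun_continuous[OF Vg]] a(1) that])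
      moreover have "Vol g x h = oint a x (\<lambda>s. g x s * h s)" by (rule theta_oint[OF a h that])
      ultimately show ?thesis by simp
    qed
    have prod: "continuous_on (J \<times> J) (\<lambda>(x, s). p x s * h s)" if "smooth2 p" for p
      using continuous_on_mult[OF J.smooth2_continuous[OF smooth2_on_J[OF that]]
          J.continuous_on_fst_snd(2)[OF test_fun_continuous[OF h]]]
      by (simp add: split_beta)
    \<comment> \<open>the derivative of the product kernel in its first argument; only the upper limit contributes\<close>
    define k where "k = (\<lambda>x y. ft x x * g x y)"
    have k: "smooth2 k" unfolding k_def by (intro smooth2_mult smooth2_diagonal(1)[OF ft] g)
    have \<Psi>: "(\<Psi> has_vector_derivative f t x * oint a x (\<lambda>s. g x s * h s)) (at x within J)" if x: "x \<in> J" for x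
    proof -
      have "(\<Psi> has_vector_derivative volterra_product ft g x x * h x + oint a x (\<lambda>s. k x s * h s)) (at x within J)"
        unfolding \<Psi>_def
      proof (rule J.oint_leibniz[OF prod[OF smooth2_volterra_product[OF ft g]] prod[OF k] _ a(1) x])
        fix x s assume x: "x \<in> J" and s: "s \<in> J"
        have "partial1 I ft x r = 0" for r
          unfolding partial1_def ft_def by (rule vector_derivative_const_within[OF J_subset[OF x]])
        then have "volterra_product (partial1 I ft) g x s = 0" by (simp add: volterra_product_def oint_def)
        then have "((\<lambda>x. volterra_product ft g x s) has_vector_derivative k x s) (at x within I)"
          using volterra_product_partials(1)[OF ft g J_subset[OF x] J_subset[OF s]] by (simp add: k_def)
        then have "((\<lambda>x. volterra_product ft g x s) has_vector_derivative k x s) (at x within J)"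
          by (rule has_vector_derivative_within_subset) (rule interior_subset)
        then show "((\<lambda>x. volterra_product ft g x s * h s) has_vector_derivative k x s * h s) (at x within J)"
          by (rule has_vector_derivative_mult_left)
      qed
      moreover have "oint a x (\<lambda>s. k x s * h s) = f t x * oint a x (\<lambda>s. g x s * h s)"
        by (simp add: k_def ft_def oint_def mult.assoc right_diff_distrib)
      ultimately show ?thesis by (simp add: volterra_product_def)
    qed
    have "oint a t (\<lambda>x. 0) = (\<Phi> t - \<Psi> t) - (\<Phi> a - \<Psi> a)"
      by (rule J.oint_FTC[where g = "\<lambda>x. \<Phi> x - \<Psi> x"])
         (use has_vector_derivative_diff[OF \<Phi> \<Psi>] a t in auto)
    then have "\<Phi> t = \<Psi> t" by (simp add: \<Phi>_def \<Psi>_def oint_def)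
    moreover have "(Vol f \<star> Vol g) t h = \<Phi> t"
      unfolding star_def \<Phi>_def by (rule theta_oint[OF a(1) Vg0 Vg t])
    moreover have "Vol (volterra_product f g) t h = \<Psi> t"
      by (simp add: theta_oint[OF a h t] \<Psi>_def volterra_product_def ft_def)
    ultimately show ?thesis by simp
  qed
qed (intro ops_star ops_theta smooth2_volterra_product f g)+

text \<open>Differentiation and integration from the left end are inverse to each other because test functions
  vanish near the left end.\<close>

lemma deriv_int: "Der \<star> Integ = Unit"
  using deriv_theta[OF smooth2_const[of 1]]
    theta_cong[of "partial1 I (\<lambda>x y. 1)" "\<lambda>x y. 0"] mult_one
  by (simp add: partial1_def vector_derivative_const_within J_subset)

lemma int_deriv: "Integ \<star> Der = Unit"
  using theta_deriv[OF smooth2_const[of 1]]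
    theta_cong[of "partial2 I (\<lambda>x y. 1)" "\<lambda>x y. 0"] mult_one
  by (simp add: partial2_def vector_derivative_const_within J_subset)

end

section \<open>The order filtration\<close>

definition volterra_ops :: "real set \<Rightarrow> distr set" where
  "volterra_ops I = {theta I f | f. smooth2_on I f}"

definition order_zero :: "real set \<Rightarrow> distr set" where
  "order_zero I = {mult_op I c + theta I f | c f. smooth2_on I (\<lambda>x y. c x) \<and> smooth2_on I f}"

text \<open>The powers of \<open>\<delta>'\<close> for all integer exponents; the inverse of \<open>\<delta>'\<close> is \<open>\<Theta>\<close>.  An element of order
  at most \<open>k\<close> is \<open>(c(t') \<delta> + f \<Theta>) \<star> \<delta>\<^sup>(\<^sup>k\<^sup>)\<close>, and the function \<open>c\<close> is its symbol of order \<open>k\<close>.\<close>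

definition deriv_pow :: "real set \<Rightarrow> int \<Rightarrow> distr" where
  "deriv_pow I k =
     (if 0 \<le> k then ((\<star>) (deriv_op I) ^^ nat k) (one_star I)
      else ((\<star>) (theta I (\<lambda>x y. 1)) ^^ nat (- k)) (one_star I))"

definition order_le :: "real set \<Rightarrow> int \<Rightarrow> distr set" where
  "order_le I k = {X \<star> deriv_pow I k | X. X \<in> order_zero I}"

context star_interval
begin

abbreviation "VO \<equiv> volterra_ops I"
abbreviation "O0 \<equiv> order_zero I"
abbreviation "D \<equiv> deriv_pow I"
abbreviation "Ord \<equiv> order_le I"

lemma VOI: "smooth2 f \<Longrightarrow> Vol f \<in> VO"
  by (auto simp: volterra_ops_def)

lemma VOE: "X \<in> VO \<Longrightarrow> (\<And>f. smooth2 f \<Longrightarrow> X = Vol f \<Longrightarrow> P) \<Longrightarrow> P"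
  by (auto simp: volterra_ops_def)

lemma O0I: "smooth1 c \<Longrightarrow> smooth2 f \<Longrightarrow> Mul c + Vol f \<in> O0"
  by (auto simp: order_zero_def)

lemma O0E: "X \<in> O0 \<Longrightarrow> (\<And>c f. smooth1 c \<Longrightarrow> smooth2 f \<Longrightarrow> X = Mul c + Vol f \<Longrightarrow> P) \<Longrightarrow> P"
  by (auto simp: order_zero_def)

lemma VO_O0: "X \<in> VO \<Longrightarrow> X \<in> O0"
  by (erule VOE) (use O0I[OF smooth2_const[of 0]] in simp)

lemma mult_O0: "smooth1 c \<Longrightarrow> Mul c \<in> O0"
  using O0I[OF _ smooth2_const[of 0]] by simp

lemma VO_ops: "X \<in> VO \<Longrightarrow> X \<in> Ops"
  by (erule VOE) (simp add: ops_theta)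

lemma O0_ops: "X \<in> O0 \<Longrightarrow> X \<in> Ops"
  by (erule O0E) (simp add: ops_theta ops_mult ops_add)

lemma VO_add: "X \<in> VO \<Longrightarrow> Y \<in> VO \<Longrightarrow> X + Y \<in> VO"
  by (elim VOE) (simp add: theta_add VOI smooth2_add)

lemma VO_uminus: "X \<in> VO \<Longrightarrow> - X \<in> VO"
  by (elim VOE) (simp add: theta_uminus VOI smooth2_minus)

lemma VO_diff: "X \<in> VO \<Longrightarrow> Y \<in> VO \<Longrightarrow> X - Y \<in> VO"
  by (elim VOE) (simp add: theta_diff VOI smooth2_diff)

lemma VO_zero: "0 \<in> VO"
  using VOI[OF smooth2_const[of 0]] by simp

lemma VO_sum: "(\<And>i. i \<in> S \<Longrightarrow> X i \<in> VO) \<Longrightarrow> (\<Sum>i\<in>S. X i) \<in> VO"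
  by (induction S rule: infinite_finite_induct) (auto intro: VO_add VO_zero)

lemma VO_star: "X \<in> VO \<Longrightarrow> Y \<in> VO \<Longrightarrow> X \<star> Y \<in> VO"
  by (elim VOE) (simp add: theta_theta VOI smooth2_volterra_product)

lemma mult_VO: "smooth1 c \<Longrightarrow> X \<in> VO \<Longrightarrow> Mul c \<star> X \<in> VO"
  by (elim VOE) (simp add: theta_scale VOI smooth2_mult)

lemma VO_mult: "smooth1 c \<Longrightarrow> X \<in> VO \<Longrightarrow> X \<star> Mul c \<in> VO"
  by (elim VOE) (simp add: theta_mult VOI smooth2_mult smooth2_fst)

lemma O0_VO: "X \<in> O0 \<Longrightarrow> Y \<in> VO \<Longrightarrow> X \<star> Y \<in> VO"
  by (elim O0E) (simp add: star_add_left mult_VO VO_star VOI VO_add)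

lemma VO_O0_star: "X \<in> VO \<Longrightarrow> Y \<in> O0 \<Longrightarrow> X \<star> Y \<in> VO"
  by (elim O0E) (simp add: star_add_right VO_ops ops_mult ops_theta VO_mult VO_star VOI VO_add)

lemma O0_add: "X \<in> O0 \<Longrightarrow> Y \<in> O0 \<Longrightarrow> X + Y \<in> O0"
proof (elim O0E)
  fix c f d g assume *: "smooth1 c" "smooth2 f" "X = Mul c + Vol f" "smooth1 d" "smooth2 g" "Y = Mul d + Vol g"
  then have "X + Y = (Mul c + Mul d) + (Vol f + Vol g)" by (simp add: algebra_simps)
  then show ?thesis using * by (simp add: mult_add theta_add O0I smooth2_add)
qed

text \<open>The symbol of a product is the product of the symbols.\<close>

lemma O0_star_principal:
  assumes "smooth1 c" "X \<in> VO" "smooth1 d" "Y \<in> VO"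
  obtains Z where "Z \<in> VO" "(Mul c + X) \<star> (Mul d + Y) = Mul (\<lambda>t. c t * d t) + Z"
proof
  show "Mul c \<star> Y + X \<star> Mul d + X \<star> Y \<in> VO"
    by (intro VO_add mult_VO VO_mult VO_star assms)
  show "(Mul c + X) \<star> (Mul d + Y) = Mul (\<lambda>t. c t * d t) + (Mul c \<star> Y + X \<star> Mul d + X \<star> Y)"
    using assms
    by (simp add: star_add_left star_add_right VO_ops ops_mult mult_mult[OF assms(1,3), symmetric] algebra_simps)
qed

lemma O0_iff: "X \<in> O0 \<longleftrightarrow> (\<exists>c Y. smooth1 c \<and> Y \<in> VO \<and> X = Mul c + Y)"
  by (auto simp: order_zero_def volterra_ops_def)

lemma O0_star: "X \<in> O0 \<Longrightarrow> Y \<in> O0 \<Longrightarrow> X \<star> Y \<in> O0"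
proof -
  assume "X \<in> O0" "Y \<in> O0"
  then obtain c X' d Y' where *: "smooth1 c" "X' \<in> VO" "smooth1 d" "Y' \<in> VO" "X = Mul c + X'" "Y = Mul d + Y'"
    unfolding O0_iff by blast
  obtain Z where "Z \<in> VO" "(Mul c + X') \<star> (Mul d + Y') = Mul (\<lambda>t. c t * d t) + Z"
    using O0_star_principal[OF *(1-4)] by blast
  then show ?thesis unfolding O0_iff *(5,6) using smooth2_mult[OF *(1,3)]
    by (intro exI[of _ "\<lambda>t. c t * d t"] exI[of _ Z] conjI)
qed

lemma unit_O0: "Unit \<in> O0"
  using mult_O0[OF smooth2_const[of 1]] by (simp add: mult_one)

lemma O0_uminus: "X \<in> O0 \<Longrightarrow> - X \<in> O0"
proof -
  assume X: "X \<in> O0"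
  have "Mul (\<lambda>t. -1) = - Unit" by (auto simp: mult_op_def one_star_apply fun_eq_iff)
  then have "Mul (\<lambda>t. -1) \<star> X = - X" by (simp add: star_uminus_left star_one_left O0_ops X)
  then show ?thesis using O0_star[OF mult_O0[OF smooth2_const[of "-1"]] X] by simp
qed

lemma integ_VO: "Integ \<in> VO"
  by (intro VOI smooth2_const)

lemma integ_ops: "Integ \<in> Ops"
  by (rule VO_ops[OF integ_VO])

lemma deriv_VO: "X \<in> VO \<Longrightarrow> Der \<star> X \<in> O0"
  by (erule VOE) (simp add: deriv_theta O0I smooth2_diagonal(1) smooth2_partials)

lemma VO_deriv: "X \<in> VO \<Longrightarrow> X \<star> Der \<in> O0"
proof (erule VOE)
  fix f assume f: "smooth2 f" and X: "X = Vol f"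
  have "X \<star> Der = Mul (\<lambda>t. f t t) + Vol (\<lambda>x y. - partial2 I f x y)"
    unfolding X theta_deriv[OF f] theta_uminus[symmetric] by simp
  then show ?thesis using O0I[OF smooth2_diagonal(1)[OF f] smooth2_minus[OF smooth2_partials(2)[OF f]]] by simp
qed

lemma deriv_int_cancel: "X \<in> Ops \<Longrightarrow> Der \<star> (Integ \<star> X) = X"
  by (simp add: star_assoc[symmetric] deriv_int star_one_left)

lemma int_deriv_cancel: "X \<in> Ops \<Longrightarrow> Integ \<star> (Der \<star> X) = X"
  by (simp add: star_assoc[symmetric] int_deriv star_one_left)

lemma deriv_pow_ops: "D k \<in> Ops"
proof -
  have "((\<star>) X ^^ n) Unit \<in> Ops" if "X \<in> Ops" for X n
    by (induction n) (simp_all add: ops_star that)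
  then show ?thesis by (simp add: deriv_pow_def integ_ops ops_deriv)
qed

lemma deriv_pow_0: "D 0 = Unit"
  by (simp add: deriv_pow_def)

lemma deriv_pow_Suc: "D (k + 1) = Der \<star> D k"
proof (cases "0 \<le> k")
  case True
  then have "nat (k + 1) = Suc (nat k)" by simp
  then show ?thesis using True by (simp add: deriv_pow_def)
next
  case False
  have "D k = Integ \<star> D (k + 1)"
  proof (cases "k = -1")
    case True then show ?thesis by (simp add: deriv_pow_def)
  next
    case False
    then have "nat (- k) = Suc (nat (- (k + 1)))" using \<open>\<not> 0 \<le> k\<close> by simp
    then show ?thesis using False \<open>\<not> 0 \<le> k\<close> by (simp add: deriv_pow_def)
  qed
  then show ?thesis by (simp add: deriv_int_cancel deriv_pow_ops)
qed

lemma deriv_pow_pred: "D (k - 1) = Integ \<star> D k"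
  using deriv_pow_Suc[of "k - 1"] by (simp add: int_deriv_cancel deriv_pow_ops)

lemma deriv_pow_add: "D (a + b) = D a \<star> D b"
proof (induction a rule: int_induct[of _ 0])
  case base
  show ?case by (simp add: deriv_pow_0 star_one_left deriv_pow_ops)
next
  case (step1 i)
  have "D (i + 1 + b) = Der \<star> D (i + b)" using deriv_pow_Suc[of "i + b"] by (simp add: algebra_simps)
  then show ?case by (simp add: step1 deriv_pow_Suc star_assoc)
next
  case (step2 i)
  have "D (i - 1 + b) = Integ \<star> D (i + b)" using deriv_pow_pred[of "i + b"] by (simp add: algebra_simps)
  then show ?case by (simp add: step2 deriv_pow_pred star_assoc)
qed

lemma deriv_pow_1: "D 1 = Der" "D (-1) = Integ"
  using deriv_pow_Suc[of 0] deriv_pow_pred[of 0]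
  by (simp_all add: deriv_pow_0 star_one_right ops_deriv integ_ops)

lemma deriv_pow_neg_O0: "D (- int n) \<in> O0"
proof (induction n)
  case 0 then show ?case by (simp add: deriv_pow_0 unit_O0)
next
  case (Suc n)
  have "- int (Suc n) = - int n - 1" by simp
  then have "D (- int (Suc n)) = Integ \<star> D (- int n)" by (simp only: deriv_pow_pred)
  then show ?case using Suc O0_star[OF VO_O0[OF integ_VO]] by simp
qed

text \<open>Conjugation by \<open>\<delta>'\<close> preserves the elements of order \<open>0\<close>, because a Volterra operator becomes one
  of order \<open>0\<close> after one differentiation.\<close>

lemma deriv_pow_commute:
  assumes "X \<in> O0"
  shows "\<exists>Y\<in>O0. D k \<star> X = Y \<star> D k"
proof (induction k rule: int_induct[of _ 0])
  case base
  show ?case using assms by (intro bexI[of _ X]) (simp_all add: deriv_pow_0 star_one_left star_one_right O0_ops)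
next
  case (step1 i)
  then obtain Y where Y: "Y \<in> O0" "D i \<star> X = Y \<star> D i" by blast
  have "D (i + 1) \<star> X = (Der \<star> (Y \<star> Integ)) \<star> D (i + 1)"
    by (simp add: deriv_pow_Suc star_assoc Y int_deriv_cancel deriv_pow_ops)
  moreover have "Der \<star> (Y \<star> Integ) \<in> O0" by (intro deriv_VO O0_VO Y integ_VO)
  ultimately show ?case by blast
next
  case (step2 i)
  then obtain Y where Y: "Y \<in> O0" "D i \<star> X = Y \<star> D i" by blast
  have "D (i - 1) \<star> X = ((Integ \<star> Y) \<star> Der) \<star> D (i - 1)"
    by (simp add: deriv_pow_pred star_assoc Y deriv_int_cancel deriv_pow_ops)
  moreover have "(Integ \<star> Y) \<star> Der \<in> O0" by (intro VO_deriv VO_O0_star Y integ_VO)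
  ultimately show ?case by blast
qed

lemma OrdI: "X \<in> O0 \<Longrightarrow> X \<star> D k \<in> Ord k"
  by (auto simp: order_le_def)

lemma OrdE: "X \<in> Ord k \<Longrightarrow> (\<And>Y. Y \<in> O0 \<Longrightarrow> X = Y \<star> D k \<Longrightarrow> P) \<Longrightarrow> P"
  by (auto simp: order_le_def)

lemma Ord_ops: "X \<in> Ord k \<Longrightarrow> X \<in> Ops"
  by (erule OrdE) (simp add: ops_star O0_ops deriv_pow_ops)

lemma Ord_0: "Ord 0 = O0"
proof -
  have "X \<star> D 0 = X" if "X \<in> O0" for X using that by (simp add: deriv_pow_0 star_one_right O0_ops)
  then show ?thesis unfolding order_le_def by force
qed

lemma deriv_pow_Ord: "D k \<in> Ord k"
  using OrdI[OF unit_O0, of k] by (simp add: star_one_left deriv_pow_ops)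

lemma Ord_star:
  assumes "X \<in> Ord a" "Y \<in> Ord b"
  shows "X \<star> Y \<in> Ord (a + b)"
proof -
  obtain X' where X: "X' \<in> O0" "X = X' \<star> D a" using OrdE[OF assms(1)] by blast
  obtain Y' where Y: "Y' \<in> O0" "Y = Y' \<star> D b" using OrdE[OF assms(2)] by blast
  obtain Z where Z: "Z \<in> O0" "D a \<star> Y' = Z \<star> D a" using deriv_pow_commute[OF Y(1)] by blast
  have "X \<star> Y = X' \<star> ((D a \<star> Y') \<star> D b)" by (simp add: X Y star_assoc)
  also have "\<dots> = (X' \<star> Z) \<star> D (a + b)" by (simp add: Z star_assoc deriv_pow_add)
  finally show ?thesis using OrdI[OF O0_star[OF X(1) Z(1)]] by simp
qed

lemma Ord_star': "X \<in> Ord a \<Longrightarrow> Y \<in> Ord b \<Longrightarrow> a + b = c \<Longrightarrow> X \<star> Y \<in> Ord c"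
  using Ord_star by blast

lemma Ord_mono:
  assumes "X \<in> Ord a" "a \<le> b"
  shows "X \<in> Ord b"
proof -
  obtain Y where Y: "Y \<in> O0" "X = Y \<star> D a" using OrdE[OF assms(1)] by blast
  have "D a = D (- int (nat (b - a))) \<star> D b"
    unfolding deriv_pow_add[symmetric] using assms(2) by simp
  then have "X = (Y \<star> D (- int (nat (b - a)))) \<star> D b" unfolding Y(2) star_assoc by (rule arg_cong)
  also have "\<dots> \<in> Ord b" by (intro OrdI O0_star Y deriv_pow_neg_O0)
  finally show ?thesis .
qed

lemma Ord_add: "X \<in> Ord k \<Longrightarrow> Y \<in> Ord k \<Longrightarrow> X + Y \<in> Ord k"
  by (elim OrdE) (simp add: star_add_left[symmetric] OrdI O0_add)

lemma Ord_uminus: "X \<in> Ord k \<Longrightarrow> - X \<in> Ord k"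
  by (elim OrdE) (simp add: star_uminus_left[symmetric] OrdI O0_uminus)

lemma Ord_diff: "X \<in> Ord k \<Longrightarrow> Y \<in> Ord k \<Longrightarrow> X - Y \<in> Ord k"
  using Ord_add[OF _ Ord_uminus] by fastforce

lemma Ord_zero: "0 \<in> Ord k"
  using OrdI[OF VO_O0[OF VO_zero], of k] by simp

lemma Ord_sum: "(\<And>i. i \<in> S \<Longrightarrow> X i \<in> Ord k) \<Longrightarrow> (\<Sum>i\<in>S. X i) \<in> Ord k"
  by (induction S rule: infinite_finite_induct) (auto intro: Ord_add Ord_zero)

lemma Ord_neg1: "Ord (-1) = VO"
proof (intro subset_antisym subsetI)
  show "X \<in> VO" if "X \<in> Ord (-1)" for X
    using that by (elim OrdE) (simp add: deriv_pow_1 O0_VO integ_VO)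
  show "X \<in> Ord (-1)" if "X \<in> VO" for X
  proof -
    have "X = (X \<star> Der) \<star> D (-1)"
      by (simp add: deriv_pow_1 star_assoc deriv_int star_one_right VO_ops that)
    then show ?thesis using OrdI[OF VO_deriv[OF that], of "-1"] by simp
  qed
qed

end

section \<open>Differential operators and the class D(I)\<close>

text \<open>Differential operators are built up by the Horner scheme \<open>c\<^sub>0 + (c\<^sub>1 + (c\<^sub>2 + \<dots>) \<star> \<delta>') \<star> \<delta>'\<close>, with the
  coefficients on the left; peeling off the lowest coefficient is the step that inductions on the order
  use.\<close>

inductive_set differential_ops :: "real set \<Rightarrow> distr set" for I where
  zero: "0 \<in> differential_ops I"
| horner: "smooth2_on I (\<lambda>x y. c x) \<Longrightarrow> P \<in> differential_ops I \<Longrightarrow>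
    mult_op I c + P \<star> deriv_op I \<in> differential_ops I"

context star_interval
begin

abbreviation "DO \<equiv> differential_ops I"

lemma DO_ops: "P \<in> DO \<Longrightarrow> P \<in> Ops"
  by (induction rule: differential_ops.induct) (intro ops_zero ops_add ops_star ops_mult ops_deriv; assumption)+

lemma DO_deriv: "P \<in> DO \<Longrightarrow> P \<star> Der \<in> DO"
  using differential_ops.horner[OF smooth2_const[of 0]] by simp

lemma DO_mult: "smooth1 c \<Longrightarrow> Mul c \<in> DO"
  using differential_ops.horner[OF _ differential_ops.zero] by simp

lemma DO_add: "P \<in> DO \<Longrightarrow> Q \<in> DO \<Longrightarrow> P + Q \<in> DO"
proof (induction arbitrary: Q rule: differential_ops.induct)
  case zero then show ?case by (simp del: zero_fun_apply plus_fun_apply)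
next
  case (horner c P)
  from horner.prems show ?case
  proof (cases rule: differential_ops.cases)
    case zero
    then show ?thesis using differential_ops.horner[OF horner.hyps] by (simp del: zero_fun_apply plus_fun_apply)
  next
    case (horner d R)
    have "Mul c + P \<star> Der + Q = Mul (\<lambda>t. c t + d t) + (P + R) \<star> Der"
      by (simp add: horner(1) mult_add[symmetric] star_add_left algebra_simps del: plus_fun_apply)
    moreover have "Mul (\<lambda>t. c t + d t) + (P + R) \<star> Der \<in> DO"
      by (intro differential_ops.horner smooth2_add horner.IH \<open>smooth1 c\<close> horner(2) horner(3))
    ultimately show ?thesis by (simp only:)
  qed
qed

lemma DO_sum: "(\<And>i. i \<in> S \<Longrightarrow> X i \<in> DO) \<Longrightarrow> (\<Sum>i\<in>S. X i) \<in> DO"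
  by (induction S rule: infinite_finite_induct) (auto intro: DO_add differential_ops.zero)

lemma DO_Ord: "P \<in> DO \<Longrightarrow> \<exists>n::nat. P \<in> Ord (int n)"
proof (induction rule: differential_ops.induct)
  case zero then show ?case using Ord_zero by blast
next
  case (horner c P)
  then obtain n where n: "P \<in> Ord (int n)" by blast
  have "Mul c \<in> Ord (int n + 1)"
    by (rule Ord_mono[of _ 0]) (use mult_O0[OF horner(1)] in \<open>simp_all add: Ord_0\<close>)
  moreover have "P \<star> Der \<in> Ord (int n + 1)"
    using Ord_star[OF n deriv_pow_Ord[of 1]] by (simp add: deriv_pow_1)
  ultimately have "Mul c + P \<star> Der \<in> Ord (int (Suc n))" using Ord_add by (simp add: add.commute)
  then show ?case by blast
qed

lemma vderiv_pow_test_fun: "h \<in> TF \<Longrightarrow> (vderiv ^^ n) h \<in> TF"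
  by (induction n) (simp_all add: test_fun_vderiv)

lemma vderiv_pow_cong:
  assumes "\<And>s. s \<in> J \<Longrightarrow> g s = h s" "h \<in> TF" "t \<in> J"
  shows "(vderiv ^^ n) g t = (vderiv ^^ n) h t"
  using assms(3)
proof (induction n arbitrary: t)
  case 0 then show ?case using assms by simp
next
  case (Suc n)
  have "vderiv ((vderiv ^^ n) g) t = vderiv ((vderiv ^^ n) h) t"
    by (rule vderiv_cong[OF Suc.IH vderiv_pow_test_fun[OF assms(2)] Suc.prems])
  then show ?case by simp
qed

lemma vderiv_pow_add:
  assumes "g \<in> TF" "h \<in> TF" "t \<in> J"
  shows "(vderiv ^^ n) (\<lambda>s. g s + h s) t = (vderiv ^^ n) g t + (vderiv ^^ n) h t"
  using assms(3)
proof (induction n arbitrary: t)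
  case (Suc n)
  have "vderiv ((vderiv ^^ n) (\<lambda>s. g s + h s)) t = vderiv (\<lambda>s. (vderiv ^^ n) g s + (vderiv ^^ n) h s) t"
    by (rule vderiv_cong[OF _ test_fun_add Suc.prems]) (intro Suc.IH vderiv_pow_test_fun assms; assumption?)+
  also have "\<dots> = vderiv ((vderiv ^^ n) g) t + vderiv ((vderiv ^^ n) h) t"
    by (intro vderiv_add vderiv_pow_test_fun assms Suc.prems)
  finally show ?case by simp
qed simp

lemma test_fun_section:
  assumes "smooth2 c" "h \<in> TF" "t \<in> J"
  shows "(\<lambda>s. c t s * h s) \<in> TF"
proof -
  have "smooth1 (c t)"
    using smooth2_diagonal(1)[OF smooth2_section_left[OF assms(1) J_subset[OF assms(3)]]] .
  then show ?thesis by (rule test_fun_mult[OF _ assms(2)])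
qed

text \<open>The coefficients in the definition of the class D(I) may depend on both variables.  The product
  rule moves the dependence on the second variable out of the derivatives.\<close>

lemma vderiv_pow_product_DO:
  assumes "smooth2 c"
  shows "(\<lambda>t h. if t \<in> J \<and> h \<in> TF then (vderiv ^^ i) (\<lambda>s. c t s * h s) t else 0) \<in> DO"
  using assms
proof (induction i arbitrary: c)
  case 0
  have "(\<lambda>t h. if t \<in> J \<and> h \<in> TF then (vderiv ^^ 0) (\<lambda>s. c t s * h s) t else 0) = Mul (\<lambda>t. c t t)"
    by (auto simp: mult_op_def fun_eq_iff)
  then show ?case using DO_mult[OF smooth2_diagonal(1)[OF 0]] by simp
next
  case (Suc i)
  define E where "E c = (\<lambda>t h. if t \<in> J \<and> h \<in> TF then (vderiv ^^ i) (\<lambda>s. c t s * h s) t else 0)" for c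
  have "(\<lambda>t h. if t \<in> J \<and> h \<in> TF then (vderiv ^^ Suc i) (\<lambda>s. c t s * h s) t else 0) =
      E (partial2 I c) + E c \<star> Der"
  proof (intro ext)
    fix t h
    show "(if t \<in> J \<and> h \<in> TF then (vderiv ^^ Suc i) (\<lambda>s. c t s * h s) t else 0) =
      (E (partial2 I c) + E c \<star> Der) t h"
    proof (cases "t \<in> J \<and> h \<in> TF")
      case False
      then show ?thesis using ops_outside[OF ops_star[OF DO_ops[OF Suc.IH[OF Suc.prems]] ops_deriv]]
        by (auto simp: E_def)
    next
      case True
      then have t: "t \<in> J" and h: "h \<in> TF" by auto
      note TF1 = test_fun_section[OF smooth2_partials(2)[OF Suc.prems] h t]
        and TF2 = test_fun_section[OF Suc.prems test_fun_vderiv[OF h] t]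
      have "vderiv (\<lambda>s. c t s * h s) s = c t s * vderiv h s + partial2 I c t s * h s" if s: "s \<in> J" for s
        unfolding vderiv_def[of "\<lambda>s. c t s * h s"]
        by (intro vector_derivative_at has_vector_derivative_mult test_fun_has_vector_derivative[OF h s]
            smooth2_partials(4)[OF Suc.prems J_subset[OF t] J_subset[OF s], unfolded at_within_J(2)[OF s]])
      then have "(vderiv ^^ i) (vderiv (\<lambda>s. c t s * h s)) t =
          (vderiv ^^ i) (\<lambda>s. c t s * vderiv h s + partial2 I c t s * h s) t"
        by (intro vderiv_pow_cong test_fun_add TF1 TF2 t)
      also have "\<dots> = (vderiv ^^ i) (\<lambda>s. c t s * vderiv h s) t + (vderiv ^^ i) (\<lambda>s. partial2 I c t s * h s) t"
        by (rule vderiv_pow_add[OF TF2 TF1 t])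
      also have "(vderiv ^^ i) (\<lambda>s. c t s * vderiv h s) t = (vderiv ^^ i) (\<lambda>s. c t s * Der s h) t"
        by (rule vderiv_pow_cong[symmetric, OF _ TF2 t]) (simp add: deriv_op_def h)
      finally show ?thesis
        using t h ops_test_fun[OF ops_deriv h]
        by (simp only: funpow_Suc_right o_apply) (simp add: E_def star_def)
    qed
  qed
  moreover have "E (partial2 I c) + E c \<star> Der \<in> DO"
    unfolding E_def by (intro DO_add DO_deriv Suc.IH Suc.prems smooth2_partials)
  ultimately show ?case by simp
qed

lemma dform_decompose:
  assumes "smooth2 b" "\<And>i. i \<le> M \<Longrightarrow> smooth2 (c i)"
  shows "\<exists>P\<in>DO. dform I b M c = Vol b + P"
proof
  define E where "E i = (\<lambda>t h. if t \<in> J \<and> h \<in> TF then (vderiv ^^ i) (\<lambda>s. c i t s * h s) t else 0)" for i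
  show "(\<Sum>i\<le>M. E i) \<in> DO"
    unfolding E_def by (intro DO_sum vderiv_pow_product_DO assms(2)) simp
  show "dform I b M c = Vol b + (\<Sum>i\<le>M. E i)"
    by (intro ext) (auto simp: dform_def theta_apply sum_distr_apply E_def)
qed

lemma DO_apply:
  assumes "P \<in> DO"
  shows "\<exists>M e. (\<forall>i. smooth1 (e i)) \<and>
      (\<forall>t h. t \<in> J \<longrightarrow> h \<in> TF \<longrightarrow> P t h = (\<Sum>i\<le>(M::nat). e i t * (vderiv ^^ i) h t))"
    using assms
  proof (induction rule: differential_ops.induct)
    case zero
    show ?case by (intro exI[of _ 0] exI[of _ "\<lambda>i t. 0"]) (simp add: smooth2_const)
  next
    case (horner c P)
    then obtain M e where e: "\<forall>i. smooth1 (e i)"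
      "\<forall>t h. t \<in> J \<longrightarrow> h \<in> TF \<longrightarrow> P t h = (\<Sum>i\<le>M. e i t * (vderiv ^^ i) h t)" by blast
    define e' where "e' i = (case i of 0 \<Rightarrow> c | Suc j \<Rightarrow> e j)" for i
    have "(Mul c + P \<star> Der) t h = (\<Sum>i\<le>Suc M. e' i t * (vderiv ^^ i) h t)" if t: "t \<in> J" and h: "h \<in> TF" for t h
    proof -
      have "P t (\<lambda>s. Der s h) = P t (vderiv h)"
        by (rule ops_local[OF DO_ops[OF horner(2)] test_fun_vderiv[OF h]]) (simp add: deriv_op_def h)
      also have "\<dots> = (\<Sum>i\<le>M. e i t * (vderiv ^^ i) (vderiv h) t)"
        using e(2) t test_fun_vderiv[OF h] by blast
      also have "\<dots> = (\<Sum>i\<le>M. e' (Suc i) t * (vderiv ^^ Suc i) h t)"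
        by (simp only: e'_def nat.case funpow_Suc_right o_apply)
      finally show ?thesis
        unfolding sum.atMost_Suc_shift using t h by (simp add: star_def mult_op_def e'_def)
    qed
    moreover have "smooth1 (e' i)" for i using e(1) horner(1) by (cases i) (simp_all add: e'_def)
    ultimately show ?case by blast
  qed

lemma vderiv_pow_scale:
  assumes "h \<in> TF" "t \<in> J"
  shows "(vderiv ^^ n) (\<lambda>s. c * h s) t = c * (vderiv ^^ n) h t"
  using assms(2)
proof (induction n arbitrary: t)
  case (Suc n)
  have TF: "(\<lambda>s. c * (vderiv ^^ n) h s) \<in> TF"
    by (rule test_fun_mult[OF smooth2_const vderiv_pow_test_fun[OF assms(1)]])
  have "vderiv ((vderiv ^^ n) (\<lambda>s. c * h s)) t = vderiv (\<lambda>s. c * (vderiv ^^ n) h s) t"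
    by (rule vderiv_cong[OF Suc.IH TF Suc.prems])
  also have "\<dots> = c * vderiv ((vderiv ^^ n) h) t"
    unfolding vderiv_def[of "\<lambda>s. c * (vderiv ^^ n) h s"]
    by (intro vector_derivative_at has_vector_derivative_mult_right test_fun_has_vector_derivative
        vderiv_pow_test_fun assms(1) Suc.prems)
  finally show ?case by simp
qed simp

lemma D_class_DO:
  assumes "smooth2 f" "P \<in> DO"
  shows "Vol f + P \<in> D_class I"
proof -
  obtain M :: nat and e where e: "\<forall>i. smooth1 (e i)"
    "\<forall>t h. t \<in> J \<longrightarrow> h \<in> TF \<longrightarrow> P t h = (\<Sum>i\<le>M. e i t * (vderiv ^^ i) h t)"
    using DO_apply[OF assms(2)] by blast
  have "Vol f + P = dform I f M (\<lambda>i x y. e i x)"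
  proof (intro ext)
    fix t h
    show "(Vol f + P) t h = dform I f M (\<lambda>i x y. e i x) t h"
    proof (cases "t \<in> J \<and> h \<in> TF")
      case True
      then have "P t h = (\<Sum>i\<le>M. (vderiv ^^ i) (\<lambda>s. e i t * h s) t)"
        by (simp add: e(2) vderiv_pow_scale)
      then show ?thesis using True by (simp add: theta_apply dform_def)
    next
      case False
      then show ?thesis using ops_outside[OF DO_ops[OF assms(2)] False] by (auto simp: theta_apply dform_def)
    qed
  qed
  then show ?thesis unfolding D_class_def mem_Collect_eq
    by (intro exI[of _ f] exI[of _ M] exI[of _ "\<lambda>i x y. e i x"]) (simp add: assms(1) e(1))
qed

text \<open>An element of D(I) is a Volterra operator plus a differential operator, and both have finite order.
  Conversely, multiplying \<open>c \<delta> + f \<Theta>\<close> by \<open>\<delta>'\<close> from the right again gives such a sum, by integration by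
  parts; the terms of negative order are contained in those of order \<open>0\<close>.\<close>

theorem D_class_eq: "D_class I = (\<Union>k. Ord k)"
proof (intro subset_antisym subsetI)
  fix d assume "d \<in> D_class I"
  then obtain f M c where *: "smooth2 f" "\<And>i. i \<le> M \<Longrightarrow> smooth2 (c i)" "d = dform I f M c"
    unfolding D_class_def by blast
  obtain P where P: "P \<in> DO" "d = Vol f + P" using dform_decompose[where c = c, OF *(1,2)] *(3) by blast
  obtain n where n: "P \<in> Ord (int n)" using DO_Ord[OF P(1)] by blast
  have "Vol f \<in> Ord (int n)"
    using VO_O0[OF VOI[OF *(1)]] by (rule_tac Ord_mono[of _ 0]) (simp_all add: Ord_0)
  then show "d \<in> (\<Union>k. Ord k)" using Ord_add[OF _ n] P(2) by blast
next
  fix d assume "d \<in> (\<Union>k. Ord k)"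
  then obtain k where "d \<in> Ord k" by blast
  then have "d \<in> Ord (int (nat k))" by (rule Ord_mono) simp
  then obtain X where X: "X \<in> O0" "d = X \<star> D (int (nat k))" by (rule OrdE)
  have "\<exists>f P. smooth2 f \<and> P \<in> DO \<and> X \<star> D (int n) = Vol f + P" for n
  proof (induction n)
    case 0
    obtain c f where "smooth1 c" "smooth2 f" "X = Mul c + Vol f" using O0E[OF X(1)] by blast
    moreover have "X \<star> D (int 0) = X" using O0_ops[OF X(1)] by (simp add: deriv_pow_0 star_one_right)
    ultimately have "smooth2 f \<and> Mul c \<in> DO \<and> X \<star> D (int 0) = Vol f + Mul c"
      using DO_mult[of c] add.commute[of "Mul c" "Vol f"] by (simp only: simp_thms)
    then show ?case by blast
  next
    case (Suc n)
    then obtain f P where f: "smooth2 f" and P: "P \<in> DO" and eq: "X \<star> D (int n) = Vol f + P" by blast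
    have "int (Suc n) = int n + 1" by simp
    then have "X \<star> D (int (Suc n)) = (X \<star> D (int n)) \<star> Der"
      by (simp only: deriv_pow_add deriv_pow_1 star_assoc)
    also have "\<dots> = Vol (\<lambda>x y. - partial2 I f x y) + (Mul (\<lambda>t. f t t) + P \<star> Der)"
      unfolding eq star_add_left theta_deriv[OF f] theta_uminus[symmetric] by (simp add: algebra_simps del: plus_fun_apply)
    finally have "X \<star> D (int (Suc n)) = Vol (\<lambda>x y. - partial2 I f x y) + (Mul (\<lambda>t. f t t) + P \<star> Der)" .
    moreover have "smooth2 (\<lambda>x y. - partial2 I f x y)" by (intro smooth2_minus smooth2_partials f)
    moreover have "Mul (\<lambda>t. f t t) + P \<star> Der \<in> DO" by (intro differential_ops.horner smooth2_diagonal(1)[OF f] P)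
    ultimately show ?case by blast
  qed
  then obtain f P where "smooth2 f" "P \<in> DO" "X \<star> D (int (nat k)) = Vol f + P" by blast
  then show "d \<in> D_class I" using D_class_DO[of f P] X(2) by (simp only:)
qed

lemma D_class_ops: "d \<in> D_class I \<Longrightarrow> d \<in> Ops"
  unfolding D_class_eq by (auto dest: Ord_ops)

lemma Ord_D_class: "X \<in> Ord k \<Longrightarrow> X \<in> D_class I"
  unfolding D_class_eq by blast

lemma D_class_star: "d \<in> D_class I \<Longrightarrow> e \<in> D_class I \<Longrightarrow> d \<star> e \<in> D_class I"
proof -
  assume "d \<in> D_class I" "e \<in> D_class I"
  then obtain a b where "d \<in> Ord a" "e \<in> Ord b" unfolding D_class_eq by blast
  then show ?thesis using Ord_D_class[OF Ord_star] by blast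
qed

lemma D_class_add: "d \<in> D_class I \<Longrightarrow> e \<in> D_class I \<Longrightarrow> d + e \<in> D_class I"
proof -
  assume "d \<in> D_class I" "e \<in> D_class I"
  then obtain a b where "d \<in> Ord a" "e \<in> Ord b" unfolding D_class_eq by blast
  then have "d \<in> Ord (max a b)" "e \<in> Ord (max a b)" using Ord_mono[of _ _ "max a b"] by auto
  then show ?thesis by (rule Ord_D_class[OF Ord_add])
qed

lemma D_class_sum: "(\<And>i. i \<in> S \<Longrightarrow> X i \<in> D_class I) \<Longrightarrow> (\<Sum>i\<in>S. X i) \<in> D_class I"
  by (induction S rule: infinite_finite_induct) (auto intro: D_class_add Ord_D_class[OF Ord_zero])

end

section \<open>The principal symbol\<close>

text \<open>All derivatives of \<open>exp (- 1/x)\<close>, extended by \<open>0\<close> to \<open>x \<le> 0\<close>, have the form \<open>p(1/x) exp (- 1/x)\<close> for a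
  polynomial \<open>p\<close>.\<close>

definition bump :: "real poly \<Rightarrow> real \<Rightarrow> real" where
  "bump p x = (if 0 < x then poly p (inverse x) * exp (- inverse x) else 0)"

lemma poly_div_exp_tendsto_0: "((\<lambda>u. poly p u * exp (- u)) \<longlongrightarrow> (0::real)) at_top"
proof -
  have "((\<lambda>u. \<Sum>i\<le>degree p. coeff p i * (u ^ i / exp u)) \<longlongrightarrow> (\<Sum>i\<le>degree p. coeff p i * 0)) at_top"
    by (intro tendsto_sum tendsto_mult tendsto_const tendsto_power_div_exp_0)
  then show ?thesis
    by (simp add: poly_altdef sum_distrib_right exp_minus divide_inverse mult.assoc)
qed

lemma bump_tendsto_0: "(bump p \<longlongrightarrow> 0) (at_right 0)"
proof -
  have "((\<lambda>x. poly p (inverse x) * exp (- inverse x)) \<longlongrightarrow> 0) (at_right 0)"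
    using filterlim_compose[OF poly_div_exp_tendsto_0 filterlim_inverse_at_top_right] .
  then show ?thesis
    by (rule Lim_transform_eventually)
       (auto simp: bump_def eventually_at_right_less intro!: eventually_at_rightI[of 0 1])
qed

lemma bump_has_derivative:
  "(bump p has_real_derivative bump (monom 1 2 * (p - pderiv p)) x) (at x)"
proof -
  consider "x < 0" | "x > 0" | "x = 0" by linarith
  then show ?thesis
  proof cases
    case 1
    have "((\<lambda>x. 0) has_real_derivative 0) (at x)" by simp
    then have "(bump p has_real_derivative 0) (at x)"
      by (rule has_field_derivative_transform_within_open[where S = "{..<0}"]) (use 1 in \<open>auto simp: bump_def\<close>)
    then show ?thesis using 1 by (simp add: bump_def)
  next
    case 2
    have "((\<lambda>x. poly p (inverse x) * exp (- inverse x)) has_real_derivative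
        (poly (pderiv p) (inverse x) * (- (inverse x)\<^sup>2)) * exp (- inverse x) +
        (exp (- inverse x) * (inverse x)\<^sup>2) * poly p (inverse x)) (at x)"
      using 2 by (auto intro!: derivative_eq_intros DERIV_chain2[OF poly_DERIV] simp: power2_eq_square)
    then have "(bump p has_real_derivative
        (poly (pderiv p) (inverse x) * (- (inverse x)\<^sup>2)) * exp (- inverse x) +
        (exp (- inverse x) * (inverse x)\<^sup>2) * poly p (inverse x)) (at x)"
      by (rule has_field_derivative_transform_within_open[where S = "{0<..}"]) (use 2 in \<open>auto simp: bump_def\<close>)
    then show ?thesis using 2
      by (simp add: bump_def poly_monom algebra_simps)
  next
    case 3
    have "((\<lambda>h. bump p h / h) \<longlongrightarrow> 0) (at_right 0)"
    proof (rule Lim_transform_eventually[OF bump_tendsto_0[of "pCons 0 p"]])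
      show "\<forall>\<^sub>F x in at_right 0. bump (pCons 0 p) x = bump p x / x"
        by (auto simp: bump_def divide_inverse intro!: eventually_at_rightI[of 0 1])
    qed
    moreover have "((\<lambda>h. bump p h / h) \<longlongrightarrow> 0) (at_left 0)"
      by (rule tendsto_eventually) (auto simp: bump_def intro!: eventually_at_leftI[of "-1" 0])
    ultimately have "((\<lambda>h. bump p h / h) \<longlongrightarrow> 0) (at 0)" by (rule filterlim_split_at[rotated])
    then show ?thesis using 3 by (simp add: DERIV_def bump_def)
  qed
qed

context star_interval
begin

lemma smooth2_bump: "smooth2_on I (\<lambda>x y. complex_of_real (bump p (x - a)))"
proof -
  define X where "X q \<longleftrightarrow> q = (\<lambda>x y. 0) \<or> (\<exists>p. q = (\<lambda>x y::real. complex_of_real (bump p (x - a))))" for q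
  have d: "((\<lambda>x. complex_of_real (bump p (x - a))) has_vector_derivative
      complex_of_real (bump (monom 1 2 * (p - pderiv p)) (x - a))) (at x within S)" for p x S
  proof -
    have "((\<lambda>x. bump p (x - a)) has_real_derivative bump (monom 1 2 * (p - pderiv p)) (x - a) * 1) (at x)"
      by (rule DERIV_chain2[OF bump_has_derivative]) (auto intro!: derivative_eq_intros)
    then have "((\<lambda>x. bump p (x - a)) has_vector_derivative bump (monom 1 2 * (p - pderiv p)) (x - a)) (at x within S)"
      by (auto simp: has_real_derivative_iff_has_vector_derivative intro: has_vector_derivative_at_within)
    then show ?thesis by (rule bounded_linear.has_vector_derivative[OF bounded_linear_of_real])
  qed
  show ?thesis
  proof (rule smooth2_coinduct[where X = X])
    show "X (\<lambda>x y. complex_of_real (bump p (x - a)))" by (auto simp: X_def)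
  next
    fix q assume q: "X q"
    have "continuous_on I (\<lambda>x. complex_of_real (bump p (x - a)))" for p
      unfolding continuous_on_eq_continuous_within using d has_vector_derivative_continuous by blast
    from continuous_on_fst_snd(1)[OF this] q show "continuous_on (I \<times> I) (\<lambda>(x, y). q x y)"
      by (auto simp: X_def split_beta)
    from q show "\<exists>g h. X g \<and> X h \<and> (\<forall>x\<in>I. \<forall>y\<in>I. ((\<lambda>s. q s y) has_vector_derivative g x y) (at x within I) \<and>
          ((\<lambda>s. q x s) has_vector_derivative h x y) (at y within I))"
      unfolding X_def[of q]
    proof (elim disjE exE)
      assume "q = (\<lambda>x y. 0)"
      then show ?thesis by (intro exI[of _ "\<lambda>x y. 0"]) (auto simp: X_def)
    next
      fix p assume p: "q = (\<lambda>x y. complex_of_real (bump p (x - a)))"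
      show ?thesis
        by (intro exI[of _ "\<lambda>x y. complex_of_real (bump (monom 1 2 * (p - pderiv p)) (x - a))"] exI[of _ "\<lambda>x y. 0"])
           (use d in \<open>auto simp: X_def p\<close>)
    qed
  qed
qed

lemma bump_test_fun:
  assumes "a \<in> J"
  shows "(\<lambda>x. complex_of_real (bump 1 (x - a))) \<in> TF"
  unfolding test_fun_iff
  using star_interval.smooth2_bump[OF interior_star_interval] assms by (auto simp: bump_def intro!: bexI[of _ a])

lemma bump_mono: "0 \<le> bump 1 x" "x \<le> y \<Longrightarrow> bump 1 x \<le> bump 1 y"
  by (auto simp: bump_def intro: le_imp_inverse_le)

text \<open>A Volterra operator only sees the past, so on a test function that switches on just before
  \<open>t\<close> it takes values at \<open>t\<close> that are small compared with the value of the test function.\<close>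

lemma mult_eq_theta_imp_zero:
  assumes eq: "Mul c = Vol g" and g: "smooth2 g" and t: "t \<in> J"
  shows "c t = 0"
proof (rule ccontr)
  assume "c t \<noteq> 0"
  interpret J: star_interval J by (rule interior_star_interval)
  obtain e where e: "e > 0" "ball t e \<subseteq> J" using t open_contains_ball open_interior by blast
  define b where "b = t - e / 2"
  have b: "b \<in> J" "b < t" using e by (auto simp: b_def dist_real_def subset_eq)
  have "{b..t} \<subseteq> J" using J.segment_subset b t by auto
  have "compact ((g t) ` {b..t})"
    by (rule compact_continuous_image[OF continuous_on_subset[OF smooth2_continuous_J[OF g t] \<open>{b..t} \<subseteq> J\<close>]]) simp
  then obtain C where C: "C > 0" "\<And>s. s \<in> {b..t} \<Longrightarrow> cmod (g t s) \<le> C"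
    using compact_imp_bounded bounded_pos by (metis image_eqI)
  \<comment> \<open>so close to \<open>t\<close> that the integral over \<open>{a..t}\<close> cannot reach the value \<open>c t\<close>\<close>
  define a where "a = max b (t - cmod (c t) / (2 * C))"
  have a: "b \<le> a" "a < t" "(t - a) * C < cmod (c t)"
  proof -
    have pos: "0 < cmod (c t) / (2 * C)" using C \<open>c t \<noteq> 0\<close> by simp
    then show "b \<le> a" "a < t" using b by (auto simp: a_def)
    have "t - a \<le> cmod (c t) / (2 * C)" by (auto simp: a_def)
    then have "(t - a) * C \<le> cmod (c t) / 2" using C(1) by (simp add: field_simps)
    moreover have "0 < cmod (c t)" using \<open>c t \<noteq> 0\<close> by simp
    ultimately show "(t - a) * C < cmod (c t)" by linarith
  qed
  have aJ: "a \<in> J" using a \<open>{b..t} \<subseteq> J\<close> by auto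
  define h where "h x = complex_of_real (bump 1 (x - a))" for x
  have h: "h \<in> TF" unfolding h_def by (rule bump_test_fun[OF aJ])
  have h0: "h s = 0" if "s \<le> a" for s using that by (simp add: h_def bump_def)
  have "c t * h t = Vol g t h" using eq t h by (simp add: mult_op_def fun_eq_iff) metis
  also have "\<dots> = integral {a..t} (\<lambda>s. g t s * h s)"
    using theta_oint[OF aJ _ h t, of g] h0 a by (simp add: oint_le)
  finally have "cmod (c t * h t) = cmod (integral {a..t} (\<lambda>s. g t s * h s))" by simp
  also have "\<dots> \<le> (C * bump 1 (t - a)) * (t - a)"
  proof (rule integral_bound)
    show "a \<le> t" using a by simp
    show "continuous_on {a..t} (\<lambda>s. g t s * h s)"
      by (rule continuous_on_subset[OF continuous_on_mult[OF smooth2_continuous_J[OF g t] test_fun_continuous[OF h]]])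
         (use \<open>{b..t} \<subseteq> J\<close> a in auto)
    show "cmod (g t s * h s) \<le> C * bump 1 (t - a)" if "s \<in> {a..t}" for s
      unfolding norm_mult
      by (rule mult_mono) (use that a C bump_mono[of "s - a"] bump_mono(2)[of "s - a" "t - a"] in \<open>auto simp: h_def\<close>)
  qed
  finally have "cmod (c t) * bump 1 (t - a) \<le> ((t - a) * C) * bump 1 (t - a)"
    using bump_mono(1)[of "t - a"] by (simp add: norm_mult h_def mult_ac)
  moreover have "bump 1 (t - a) > 0" using a by (simp add: bump_def)
  ultimately show False using a(3) by simp
qed

text \<open>The symbol of order \<open>0\<close> is well defined.\<close>

lemma symbol_zero:
  assumes "Mul c + X \<in> VO" "X \<in> VO" "t \<in> J"
  shows "c t = 0"
proof -
  have "Mul c \<in> VO" using VO_diff[OF assms(1,2)] by simp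
  then show ?thesis using mult_eq_theta_imp_zero assms(3) by (elim VOE)
qed

lemma Ord_cancel: "X \<star> D a \<in> Ord b \<Longrightarrow> X \<in> Ops \<Longrightarrow> X \<in> Ord (b - a)"
proof -
  assume "X \<star> D a \<in> Ord b" "X \<in> Ops"
  then have "(X \<star> D a) \<star> D (- a) \<in> Ord (b + - a)" by (intro Ord_star deriv_pow_Ord)
  moreover have "(X \<star> D a) \<star> D (- a) = X"
    unfolding star_assoc deriv_pow_add[symmetric] using \<open>X \<in> Ops\<close> by (simp add: deriv_pow_0 star_one_right)
  ultimately show ?thesis by simp
qed

text \<open>A differential operator and a Volterra operator have only \<open>0\<close> in common.  If \<open>c + P \<star> \<delta>'\<close> has order
  \<open>-1\<close>, then \<open>P \<star> \<delta>'\<close> has order \<open>0\<close> and \<open>P\<close> has order \<open>-1\<close>, so that \<open>P = 0\<close> by induction; what remains is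
  the symbol \<open>c\<close> of an element of order \<open>-1\<close>.\<close>

lemma DO_VO_zero: "P \<in> DO \<Longrightarrow> P \<in> VO \<Longrightarrow> P = 0"
proof (induction rule: differential_ops.induct)
  case zero
  show ?case by (rule refl)
next
  case (horner c P)
  have c: "Mul c \<in> Ord 0" using mult_O0[OF horner.hyps(1)] by (simp only: Ord_0)
  have "Mul c + P \<star> Der \<in> Ord (-1)" using horner.prems by (simp only: Ord_neg1)
  then have "Mul c + P \<star> Der \<in> Ord 0" by (rule Ord_mono) simp
  from Ord_diff[OF this c] have "P \<star> Der \<in> Ord 0" by (simp only: add_diff_cancel_left')
  then have "P \<star> D 1 \<in> Ord 0" by (simp only: deriv_pow_1)
  from Ord_cancel[OF this DO_ops[OF horner.hyps(2)]] have "P \<in> VO" by (simp add: Ord_neg1)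
  then have P: "P = 0" by (rule horner.IH)
  then have "Mul c \<in> VO" using horner.prems by (simp only: star_zero_left add_0_right)
  then have "c t = 0" if "t \<in> J" for t using symbol_zero[OF _ VO_zero that, of c] by (simp only: add_0_right)
  then have "Mul c = Mul (\<lambda>t. 0)" by (intro mult_cong)
  then show ?case by (simp only: P mult_zero star_zero_left add_0_right)
qed

lemma Vol_integ: "smooth2 f \<Longrightarrow> Vol f = (Mul (\<lambda>t. f t t) - Vol (partial2 I f)) \<star> Integ"
  by (simp add: theta_deriv[symmetric] star_assoc deriv_int star_one_right ops_theta)

text \<open>Integrating by parts twice, \<open>b \<Theta> = b(t, t) \<Theta> - \<partial>\<^sub>2 b(t, t) \<Theta> \<star> \<Theta> + \<dots>\<close>, where the first term is absent
  for an element of order \<open>-2\<close>.  So its symbol is minus the second partial derivative of its kernel on the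
  diagonal, the function that the absence of a breakdown requires to be nonzero.  The terms supported
  on the diagonal in the representation of \<open>d\<close> sum to a differential operator of order \<open>-1\<close>, hence to \<open>0\<close>.\<close>

lemma theta_coeff_order_minus_2:
  assumes "theta_coeff I d b" "d \<in> Ord (-2)"
  obtains X where "X \<in> VO" "d = (Mul (\<lambda>t. - partial2 I b t t) + X) \<star> D (-2)" "smooth2 b"
proof -
  obtain M c where b: "smooth2 b" and c: "\<And>i. i \<le> M \<Longrightarrow> smooth2 (c i)" and d: "d = dform I b M c"
    using assms(1) unfolding theta_coeff_def by blast
  obtain P where P: "P \<in> DO" "d = Vol b + P" using dform_decompose[where c = c, OF b c] d by blast
  have "d \<in> VO" using Ord_mono[OF assms(2), of "-1"] by (simp add: Ord_neg1)
  then have "P \<in> VO" using VO_diff[OF _ VOI[OF b], of d] P(2) by simp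
  then have d2: "d = Vol b" using DO_VO_zero[OF P(1)] P(2) by simp
  note b2 = smooth2_partials(2)[OF b]
  have "d = (Mul (\<lambda>t. b t t) - Vol (partial2 I b)) \<star> D (-1)"
    unfolding d2 deriv_pow_1 by (rule Vol_integ[OF b])
  then have "Mul (\<lambda>t. b t t) - Vol (partial2 I b) \<in> Ord (-2 - -1)"
    using assms(2) Ord_cancel[of "Mul (\<lambda>t. b t t) - Vol (partial2 I b)" "-1" "-2"]
    by (simp add: ops_diff ops_mult ops_theta smooth2_diagonal(1)[OF b] b2)
  then have "Mul (\<lambda>t. b t t) + (- Vol (partial2 I b)) \<in> VO" by (simp add: Ord_neg1)
  then have diag: "b t t = 0" if "t \<in> J" for t
    using symbol_zero[OF _ VO_uminus[OF VOI[OF b2]] that] by blast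
  have "Mul (\<lambda>t. b t t) = 0" using mult_cong[of "\<lambda>t. b t t" "\<lambda>t. 0"] diag by simp
  then have "d = (- Vol (partial2 I b)) \<star> Integ" using Vol_integ[OF b] d2 by simp
  also have "- Vol (partial2 I b) = (- (Mul (\<lambda>t. partial2 I b t t) - Vol (partial2 I (partial2 I b)))) \<star> Integ"
    unfolding star_uminus_left using Vol_integ[OF b2] by simp
  also have "- (Mul (\<lambda>t. partial2 I b t t) - Vol (partial2 I (partial2 I b))) =
      Mul (\<lambda>t. - partial2 I b t t) + Vol (partial2 I (partial2 I b))"
    by (auto simp: mult_op_def fun_eq_iff)
  finally have d3: "d = ((Mul (\<lambda>t. - partial2 I b t t) + Vol (partial2 I (partial2 I b))) \<star> Integ) \<star> Integ" .
  have "Integ \<star> Integ = D (-2)" using deriv_pow_add[of "-1" "-1"] by (simp add: deriv_pow_1)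
  then have "d = (Mul (\<lambda>t. - partial2 I b t t) + Vol (partial2 I (partial2 I b))) \<star> D (-2)"
    by (simp only: d3 star_assoc)
  then show ?thesis using that[OF VOI[OF smooth2_partials(2)[OF b2]] _ b] by blast
qed

text \<open>If the right inverse \<open>G\<close> had positive order \<open>n\<close> with symbol \<open>e\<close>, then \<open>c e\<close> would be the symbol of order
  \<open>n\<close> of the unit, which is \<open>0\<close>.  So \<open>e = 0\<close> and the order of \<open>G\<close> can be lowered, down to \<open>0\<close>.\<close>

lemma elliptic_inverse_order:
  assumes c: "smooth1 c" "\<And>t. t \<in> J \<Longrightarrow> c t \<noteq> 0" and X: "X \<in> VO"
    and G: "G \<in> Ord (int n)" and one: "(Mul c + X) \<star> G = Unit"
  shows "G \<in> Ord 0"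
  using G
proof (induction n)
  case 0 then show ?case by simp
next
  case (Suc n)
  obtain E where E: "E \<in> O0" "G = E \<star> D (int (Suc n))" using OrdE[OF Suc.prems] by blast
  obtain e L where e: "smooth1 e" "L \<in> VO" "E = Mul e + L" using E(1) unfolding O0_iff by blast
  obtain Z where Z: "Z \<in> VO" "(Mul c + X) \<star> E = Mul (\<lambda>t. c t * e t) + Z"
    using O0_star_principal[OF c(1) X e(1,2)] e(3) by blast
  have "((Mul c + X) \<star> E) \<star> D (int (Suc n)) = Unit" using one by (simp only: E(2) star_assoc)
  then have "((Mul c + X) \<star> E) \<star> D (int (Suc n)) \<in> Ord 0" by (simp only: Ord_0 unit_O0)
  from Ord_cancel[OF this] have "(Mul c + X) \<star> E \<in> Ord (- int (Suc n))"
    using O0_ops[OF E(1)] by (simp add: ops_star ops_add ops_mult c VO_ops X)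
  then have "Mul (\<lambda>t. c t * e t) + Z \<in> Ord (-1)" unfolding Z(2) by (rule Ord_mono) simp
  then have "c t * e t = 0" if "t \<in> J" for t
    using symbol_zero[OF _ Z(1) that, of "\<lambda>t. c t * e t"] by (simp only: Ord_neg1)
  then have "Mul e = Mul (\<lambda>t. 0)" using c(2) by (intro mult_cong) auto
  then have "E \<in> Ord (-1)" using e by (simp add: Ord_neg1)
  then have "G \<in> Ord (-1 + int (Suc n))" unfolding E(2) by (intro Ord_star deriv_pow_Ord)
  then show ?case using Suc.IH by simp
qed

text \<open>An inverse in D(I) has some finite order to start from; multiplying it by \<open>\<Theta> \<star> \<Theta>\<close>
  reduces the claim to the inverse of an element of order \<open>0\<close>.\<close>

lemma inverse_order_2:
  assumes d: "d \<in> Ord (-2)" "theta_coeff I d b" and nz: "\<And>t. t \<in> J \<Longrightarrow> partial2 I b t t \<noteq> 0"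
    and g: "g \<in> D_class I" "d \<star> g = Unit"
  shows "g \<in> Ord 2"
proof -
  obtain X where X: "X \<in> VO" "d = (Mul (\<lambda>t. - partial2 I b t t) + X) \<star> D (-2)" "smooth2 b"
    by (rule theta_coeff_order_minus_2[OF d(2,1)])
  obtain k where "g \<in> Ord k" using g(1) unfolding D_class_eq by blast
  then have "D (-2) \<star> g \<in> Ord (-2 + k)" by (intro Ord_star deriv_pow_Ord)
  then have G: "D (-2) \<star> g \<in> Ord (int (nat (-2 + k)))" by (rule Ord_mono) simp
  have c: "smooth1 (\<lambda>t. - partial2 I b t t)"
    by (intro smooth2_minus smooth2_diagonal(1) smooth2_partials X)
  have "(Mul (\<lambda>t. - partial2 I b t t) + X) \<star> (D (-2) \<star> g) = Unit"
    using g(2) unfolding X(2) star_assoc .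
  from elliptic_inverse_order[OF c _ X(1) G this] nz have "D (-2) \<star> g \<in> Ord 0" by simp
  then have "D 2 \<star> (D (-2) \<star> g) \<in> Ord (2 + 0)" by (intro Ord_star deriv_pow_Ord)
  moreover have "D 2 \<star> (D (-2) \<star> g) = g"
    unfolding star_assoc[symmetric] deriv_pow_add[symmetric]
    by (simp add: deriv_pow_0 star_one_left D_class_ops g)
  ultimately show ?thesis by simp
qed

end

section \<open>Matrices of operators\<close>

lemma index_mat_star:
  assumes "X \<in> carrier_mat n k" "Y \<in> carrier_mat k m" "i < n" "j < m"
  shows "(X \<star>\<^sub>m\<^sub>m Y) $$ (i, j) = (\<Sum>l<k. X $$ (i, l) \<star> Y $$ (l, j))"
  using assms by (simp add: mat_star_def vdot_def)

lemma mat_star_carrier [simp]: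
  "X \<in> carrier_mat n k \<Longrightarrow> Y \<in> carrier_mat k m \<Longrightarrow> X \<star>\<^sub>m\<^sub>m Y \<in> carrier_mat n m"
  by (auto simp: mat_star_def)

lemma Id_star_carrier [simp]: "Id_star I n \<in> carrier_mat n n"
  by (simp add: Id_star_def)

lemma index_Id_star: "i < n \<Longrightarrow> j < n \<Longrightarrow> Id_star I n $$ (i, j) = (if i = j then one_star I else 0)"
  by (simp add: Id_star_def)

definition mats_over :: "distr set \<Rightarrow> nat \<Rightarrow> nat \<Rightarrow> distr mat set" where
  "mats_over S n m = {M \<in> carrier_mat n m. \<forall>i<n. \<forall>j<m. M $$ (i, j) \<in> S}"

lemma mats_over_carrier: "M \<in> mats_over S n m \<Longrightarrow> M \<in> carrier_mat n m"
  by (simp add: mats_over_def)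

lemma mats_over_index: "M \<in> mats_over S n m \<Longrightarrow> i < n \<Longrightarrow> j < m \<Longrightarrow> M $$ (i, j) \<in> S"
  by (simp add: mats_over_def)

lemma mats_overI: "M \<in> carrier_mat n m \<Longrightarrow> (\<And>i j. i < n \<Longrightarrow> j < m \<Longrightarrow> M $$ (i, j) \<in> S) \<Longrightarrow> M \<in> mats_over S n m"
  by (simp add: mats_over_def)

lemma mats_over_mono: "M \<in> mats_over S n m \<Longrightarrow> S \<subseteq> T \<Longrightarrow> M \<in> mats_over T n m"
  by (auto simp: mats_over_def)

lemma D_mat_eq: "D_mat I n = mats_over (D_class I) n n"
  by (simp add: D_mat_def mats_over_def)

context star_interval
begin

abbreviation "OM \<equiv> mats_over Ops"
abbreviation "IdM \<equiv> Id_star I"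

lemma OM_star:
  assumes "X \<in> OM n k" "Y \<in> OM k m"
  shows "X \<star>\<^sub>m\<^sub>m Y \<in> OM n m"
proof (rule mats_overI)
  fix i j assume ij: "i < n" "j < m"
  show "(X \<star>\<^sub>m\<^sub>m Y) $$ (i, j) \<in> Ops"
    unfolding index_mat_star[OF mats_over_carrier[OF assms(1)] mats_over_carrier[OF assms(2)] ij]
    by (intro ops_sum ops_star) (use assms ij in \<open>auto intro: mats_over_index\<close>)
qed (rule mat_star_carrier[OF mats_over_carrier[OF assms(1)] mats_over_carrier[OF assms(2)]])

lemma Id_OM: "IdM n \<in> OM n n"
  by (rule mats_overI) (simp_all add: index_Id_star)

lemma OM_diff: "X \<in> OM n m \<Longrightarrow> Y \<in> OM n m \<Longrightarrow> X - Y \<in> OM n m"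
  by (auto simp: mats_over_def ops_diff)

lemma mat_star_assoc:
  assumes X: "X \<in> OM n k" and Y: "Y \<in> OM k l" and Z: "Z \<in> OM l m"
  shows "(X \<star>\<^sub>m\<^sub>m Y) \<star>\<^sub>m\<^sub>m Z = X \<star>\<^sub>m\<^sub>m (Y \<star>\<^sub>m\<^sub>m Z)"
proof (rule eq_matI)
  note c = mats_over_carrier[OF X] mats_over_carrier[OF Y] mats_over_carrier[OF Z]
  note cXY = mat_star_carrier[OF c(1,2)] and cYZ = mat_star_carrier[OF c(2,3)]
  show "dim_row ((X \<star>\<^sub>m\<^sub>m Y) \<star>\<^sub>m\<^sub>m Z) = dim_row (X \<star>\<^sub>m\<^sub>m (Y \<star>\<^sub>m\<^sub>m Z))"
       "dim_col ((X \<star>\<^sub>m\<^sub>m Y) \<star>\<^sub>m\<^sub>m Z) = dim_col (X \<star>\<^sub>m\<^sub>m (Y \<star>\<^sub>m\<^sub>m Z))"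
    by (simp_all add: mat_star_def)
  fix i j assume "i < dim_row (X \<star>\<^sub>m\<^sub>m (Y \<star>\<^sub>m\<^sub>m Z))" "j < dim_col (X \<star>\<^sub>m\<^sub>m (Y \<star>\<^sub>m\<^sub>m Z))"
  then have ij: "i < n" "j < m" using c by (simp_all add: mat_star_def)
  have "((X \<star>\<^sub>m\<^sub>m Y) \<star>\<^sub>m\<^sub>m Z) $$ (i, j) = (\<Sum>b<l. (\<Sum>a<k. X $$ (i, a) \<star> (Y $$ (a, b) \<star> Z $$ (b, j))))"
    by (simp add: index_mat_star[OF cXY c(3) ij] index_mat_star[OF c(1,2) ij(1)] star_sum_left star_assoc)
  also have "\<dots> = (\<Sum>a<k. \<Sum>b<l. X $$ (i, a) \<star> (Y $$ (a, b) \<star> Z $$ (b, j)))"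
    by (rule sum.swap)
  also have "\<dots> = (\<Sum>a<k. X $$ (i, a) \<star> (\<Sum>b<l. Y $$ (a, b) \<star> Z $$ (b, j)))"
    by (intro sum.cong refl star_sum_right[symmetric] ops_star)
       (use ij X Y Z in \<open>auto intro: mats_over_index\<close>)
  also have "\<dots> = (X \<star>\<^sub>m\<^sub>m (Y \<star>\<^sub>m\<^sub>m Z)) $$ (i, j)"
    by (simp add: index_mat_star[OF c(1) cYZ ij] index_mat_star[OF c(2,3) _ ij(2)])
  finally show "((X \<star>\<^sub>m\<^sub>m Y) \<star>\<^sub>m\<^sub>m Z) $$ (i, j) = (X \<star>\<^sub>m\<^sub>m (Y \<star>\<^sub>m\<^sub>m Z)) $$ (i, j)" .
qed

lemma Id_mat_star:
  assumes X: "X \<in> OM n m"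
  shows "IdM n \<star>\<^sub>m\<^sub>m X = X" "X \<star>\<^sub>m\<^sub>m IdM m = X"
proof -
  note c = mats_over_carrier[OF X]
  show "IdM n \<star>\<^sub>m\<^sub>m X = X"
  proof (rule eq_matI)
    fix i j assume "i < dim_row X" "j < dim_col X"
    then have ij: "i < n" "j < m" using c by auto
    have "(\<Sum>l<n. IdM n $$ (i, l) \<star> X $$ (l, j)) = (\<Sum>l<n. if i = l then X $$ (l, j) else 0)"
      by (intro sum.cong refl) (use ij X in \<open>auto simp: index_Id_star star_one_left mats_over_index\<close>)
    also have "\<dots> = X $$ (i, j)" using ij by simp
    finally show "(IdM n \<star>\<^sub>m\<^sub>m X) $$ (i, j) = X $$ (i, j)"
      by (simp only: index_mat_star[OF Id_star_carrier c ij])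
  qed (use c in \<open>auto simp: mat_star_def Id_star_def\<close>)
  show "X \<star>\<^sub>m\<^sub>m IdM m = X"
  proof (rule eq_matI)
    fix i j assume "i < dim_row X" "j < dim_col X"
    then have ij: "i < n" "j < m" using c by auto
    have "(\<Sum>l<m. X $$ (i, l) \<star> IdM m $$ (l, j)) = (\<Sum>l<m. if l = j then X $$ (i, l) else 0)"
      by (intro sum.cong refl) (use ij X in \<open>auto simp: index_Id_star star_one_right mats_over_index\<close>)
    also have "\<dots> = X $$ (i, j)" using ij by simp
    finally show "(X \<star>\<^sub>m\<^sub>m IdM m) $$ (i, j) = X $$ (i, j)"
      by (simp only: index_mat_star[OF c Id_star_carrier ij])
  qed (use c in \<open>auto simp: mat_star_def Id_star_def\<close>)
qed

lemma mat_star_diff_left: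
  assumes X: "X \<in> OM n k" and Y: "Y \<in> OM n k" and Z: "Z \<in> OM k m"
  shows "(X - Y) \<star>\<^sub>m\<^sub>m Z = X \<star>\<^sub>m\<^sub>m Z - Y \<star>\<^sub>m\<^sub>m Z"
proof (rule eq_matI)
  note c = mats_over_carrier[OF X] mats_over_carrier[OF Y] mats_over_carrier[OF Z]
  note cXY = mats_over_carrier[OF OM_diff[OF X Y]]
  show "dim_row ((X - Y) \<star>\<^sub>m\<^sub>m Z) = dim_row (X \<star>\<^sub>m\<^sub>m Z - Y \<star>\<^sub>m\<^sub>m Z)"
       "dim_col ((X - Y) \<star>\<^sub>m\<^sub>m Z) = dim_col (X \<star>\<^sub>m\<^sub>m Z - Y \<star>\<^sub>m\<^sub>m Z)"
    using c by (auto simp: mat_star_def)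
  fix i j assume "i < dim_row (X \<star>\<^sub>m\<^sub>m Z - Y \<star>\<^sub>m\<^sub>m Z)" "j < dim_col (X \<star>\<^sub>m\<^sub>m Z - Y \<star>\<^sub>m\<^sub>m Z)"
  then have ij: "i < n" "j < m" using c by (auto simp: mat_star_def)
  have "((X - Y) \<star>\<^sub>m\<^sub>m Z) $$ (i, j) = (X \<star>\<^sub>m\<^sub>m Z) $$ (i, j) - (Y \<star>\<^sub>m\<^sub>m Z) $$ (i, j)"
    using ij c
    by (simp add: index_mat_star[OF cXY c(3) ij] index_mat_star[OF c(1,3) ij] index_mat_star[OF c(2,3) ij]
        star_diff_left sum_subtractf)
  also have "\<dots> = (X \<star>\<^sub>m\<^sub>m Z - Y \<star>\<^sub>m\<^sub>m Z) $$ (i, j)"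
    by (rule index_minus_mat(1)[symmetric]) (use ij c in \<open>auto simp: mat_star_def\<close>)
  finally show "((X - Y) \<star>\<^sub>m\<^sub>m Z) $$ (i, j) = (X \<star>\<^sub>m\<^sub>m Z - Y \<star>\<^sub>m\<^sub>m Z) $$ (i, j)" .
qed

lemma mat_star_diff_right:
  assumes X: "X \<in> OM k m" and Y: "Y \<in> OM k m" and Z: "Z \<in> OM n k"
  shows "Z \<star>\<^sub>m\<^sub>m (X - Y) = Z \<star>\<^sub>m\<^sub>m X - Z \<star>\<^sub>m\<^sub>m Y"
proof (rule eq_matI)
  note c = mats_over_carrier[OF X] mats_over_carrier[OF Y] mats_over_carrier[OF Z]
  note cXY = mats_over_carrier[OF OM_diff[OF X Y]]
  show "dim_row (Z \<star>\<^sub>m\<^sub>m (X - Y)) = dim_row (Z \<star>\<^sub>m\<^sub>m X - Z \<star>\<^sub>m\<^sub>m Y)"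
       "dim_col (Z \<star>\<^sub>m\<^sub>m (X - Y)) = dim_col (Z \<star>\<^sub>m\<^sub>m X - Z \<star>\<^sub>m\<^sub>m Y)"
    using c by (auto simp: mat_star_def)
  fix i j assume "i < dim_row (Z \<star>\<^sub>m\<^sub>m X - Z \<star>\<^sub>m\<^sub>m Y)" "j < dim_col (Z \<star>\<^sub>m\<^sub>m X - Z \<star>\<^sub>m\<^sub>m Y)"
  then have ij: "i < n" "j < m" using c by (auto simp: mat_star_def)
  have "(\<Sum>l<k. Z $$ (i, l) \<star> (X - Y) $$ (l, j)) = (\<Sum>l<k. Z $$ (i, l) \<star> X $$ (l, j) - Z $$ (i, l) \<star> Y $$ (l, j))"
    by (intro sum.cong refl) (use ij c X Y Z in \<open>auto simp: star_diff_right mats_over_index\<close>)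
  then have "(Z \<star>\<^sub>m\<^sub>m (X - Y)) $$ (i, j) = (Z \<star>\<^sub>m\<^sub>m X) $$ (i, j) - (Z \<star>\<^sub>m\<^sub>m Y) $$ (i, j)"
    by (simp only: index_mat_star[OF c(3) cXY ij] index_mat_star[OF c(3,1) ij] index_mat_star[OF c(3,2) ij]
        sum_subtractf)
  also have "\<dots> = (Z \<star>\<^sub>m\<^sub>m X - Z \<star>\<^sub>m\<^sub>m Y) $$ (i, j)"
    by (rule index_minus_mat(1)[symmetric]) (use ij c in \<open>auto simp: mat_star_def\<close>)
  finally show "(Z \<star>\<^sub>m\<^sub>m (X - Y)) $$ (i, j) = (Z \<star>\<^sub>m\<^sub>m X - Z \<star>\<^sub>m\<^sub>m Y) $$ (i, j)" .
qed

lemma mat_power_OM: "M \<in> OM n n \<Longrightarrow> mat_star_power I M j \<in> OM n n"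
  by (induction j) (auto simp: Id_OM OM_star dest: mats_over_carrier)

lemma mat_power_commute:
  assumes M: "M \<in> OM n n"
  shows "mat_star_power I M j \<star>\<^sub>m\<^sub>m M = M \<star>\<^sub>m\<^sub>m mat_star_power I M j"
proof (induction j)
  case 0
  have "dim_row M = n" using mats_over_carrier[OF M] by auto
  then show ?case by (simp add: Id_mat_star[OF M])
next
  case (Suc j)
  show ?case by (simp add: mat_star_assoc[OF M mat_power_OM[OF M] M] Suc)
qed

lemma similar_mat_power:
  assumes A: "A \<in> OM n n" and V: "V \<in> OM n n" and W: "W \<in> OM n n"
    and WV: "W \<star>\<^sub>m\<^sub>m V = IdM n" and VW: "V \<star>\<^sub>m\<^sub>m W = IdM n" and T: "T = W \<star>\<^sub>m\<^sub>m (A \<star>\<^sub>m\<^sub>m V)"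
  shows "mat_star_power I T j = W \<star>\<^sub>m\<^sub>m (mat_star_power I A j \<star>\<^sub>m\<^sub>m V)"
proof (induction j)
  case 0
  have "dim_row A = n" "dim_row W = n" using mats_over_carrier[OF A] mats_over_carrier[OF W] by auto
  moreover have "dim_row T = dim_row W" by (simp add: T mat_star_def)
  ultimately show ?case by (simp add: Id_mat_star[OF V] WV)
next
  case (Suc j)
  note Aj = mat_power_OM[OF A, of j]
  have "mat_star_power I T (Suc j) = (W \<star>\<^sub>m\<^sub>m (A \<star>\<^sub>m\<^sub>m V)) \<star>\<^sub>m\<^sub>m (W \<star>\<^sub>m\<^sub>m (mat_star_power I A j \<star>\<^sub>m\<^sub>m V))"
    by (simp add: Suc) (simp add: T)
  also have "\<dots> = W \<star>\<^sub>m\<^sub>m (A \<star>\<^sub>m\<^sub>m ((V \<star>\<^sub>m\<^sub>m W) \<star>\<^sub>m\<^sub>m (mat_star_power I A j \<star>\<^sub>m\<^sub>m V)))"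
    by (simp add: mat_star_assoc[OF _ _ OM_star[OF W OM_star[OF Aj V]]] mat_star_assoc[OF V W OM_star[OF Aj V]]
        mat_star_assoc[OF W OM_star[OF A V] OM_star[OF W OM_star[OF Aj V]]]
        mat_star_assoc[OF A V OM_star[OF W OM_star[OF Aj V]]])
  also have "\<dots> = W \<star>\<^sub>m\<^sub>m (mat_star_power I A (Suc j) \<star>\<^sub>m\<^sub>m V)"
    by (simp add: VW Id_mat_star[OF OM_star[OF Aj V]] mat_star_assoc[OF A Aj V])
  finally show ?case .
qed

text \<open>Neumann series: \<open>R = M\<^sup>0 + \<dots> + M\<^sup>n\<^sup>-\<^sup>1 + M\<^sup>n R\<close> for a right inverse \<open>R\<close> of \<open>Id - M\<close>.\<close>

lemma neumann_remainder:
  assumes M: "M \<in> OM n n" and R: "R \<in> OM n n" and inv: "(IdM n - M) \<star>\<^sub>m\<^sub>m R = IdM n"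
    and ij: "i < n" "j < n"
  shows "R $$ (i, j) = (\<Sum>k<m. mat_star_power I M k $$ (i, j)) + (mat_star_power I M m \<star>\<^sub>m\<^sub>m R) $$ (i, j)"
proof (induction m)
  case 0
  have "dim_row M = n" using mats_over_carrier[OF M] by auto
  then show ?case by (simp add: Id_mat_star[OF R] del: plus_fun_apply zero_fun_apply)
next
  case (Suc m)
  note Mm = mat_power_OM[OF M, of m]
  have "R - M \<star>\<^sub>m\<^sub>m R = IdM n"
    using inv mat_star_diff_left[OF Id_OM M R] by (simp add: Id_mat_star[OF R])
  then have "mat_star_power I M m \<star>\<^sub>m\<^sub>m (R - M \<star>\<^sub>m\<^sub>m R) = mat_star_power I M m"
    by (simp add: Id_mat_star[OF Mm])
  then have "mat_star_power I M m \<star>\<^sub>m\<^sub>m R - mat_star_power I M (Suc m) \<star>\<^sub>m\<^sub>m R = mat_star_power I M m"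
    using mat_star_diff_right[OF R OM_star[OF M R] Mm] mat_star_assoc[OF Mm M R] mat_power_commute[OF M, of m] by simp
  then have "(mat_star_power I M m \<star>\<^sub>m\<^sub>m R - mat_star_power I M (Suc m) \<star>\<^sub>m\<^sub>m R) $$ (i, j) = mat_star_power I M m $$ (i, j)"
    by simp
  then have "(mat_star_power I M m \<star>\<^sub>m\<^sub>m R) $$ (i, j) - (mat_star_power I M (Suc m) \<star>\<^sub>m\<^sub>m R) $$ (i, j) =
      mat_star_power I M m $$ (i, j)"
    using ij mats_over_carrier[OF OM_star[OF mat_power_OM[OF M, of "Suc m"] R]] by (simp del: mat_star_power.simps)
  then have "(mat_star_power I M m \<star>\<^sub>m\<^sub>m R) $$ (i, j) =
      mat_star_power I M m $$ (i, j) + (mat_star_power I M (Suc m) \<star>\<^sub>m\<^sub>m R) $$ (i, j)"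
    by (simp only: diff_eq_eq)
  with Suc show ?case by (simp only: sum.lessThan_Suc add.assoc)
qed

lemma D_mat_OM: "M \<in> D_mat I n \<Longrightarrow> M \<in> OM n n"
  unfolding D_mat_eq by (rule mats_over_mono) (auto intro: D_class_ops)

lemma D_mat_star: "X \<in> D_mat I n \<Longrightarrow> Y \<in> D_mat I n \<Longrightarrow> X \<star>\<^sub>m\<^sub>m Y \<in> D_mat I n"
proof -
  assume "X \<in> D_mat I n" "Y \<in> D_mat I n"
  then have X: "X \<in> mats_over (D_class I) n n" and Y: "Y \<in> mats_over (D_class I) n n" by (simp_all add: D_mat_eq)
  note c = mats_over_carrier[OF X] mats_over_carrier[OF Y]
  show ?thesis unfolding D_mat_eq
  proof (rule mats_overI[OF mat_star_carrier[OF c]])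
    fix i j assume ij: "i < n" "j < n"
    show "(X \<star>\<^sub>m\<^sub>m Y) $$ (i, j) \<in> D_class I"
      unfolding index_mat_star[OF c ij]
      by (intro D_class_sum D_class_star) (use ij in \<open>auto intro: mats_over_index[OF X] mats_over_index[OF Y]\<close>)
  qed
qed

text \<open>By the remainder formula the Neumann series converges as soon as \<open>M\<^sup>m R\<close> tends to \<open>0\<close>.\<close>

lemma is_star_resolventI:
  assumes M: "M \<in> D_mat I n" and R: "R \<in> D_mat I n"
    and inv: "R \<star>\<^sub>m\<^sub>m (IdM n - M) = IdM n" "(IdM n - M) \<star>\<^sub>m\<^sub>m R = IdM n"
    and lim: "\<And>i j t h. i < n \<Longrightarrow> j < n \<Longrightarrow> t \<in> J \<Longrightarrow> h \<in> TF \<Longrightarrow>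
      (\<lambda>m. ((mat_star_power I M m \<star>\<^sub>m\<^sub>m R) $$ (i, j)) t h) \<longlonglongrightarrow> 0"
  shows "is_star_resolvent I M R"
proof -
  have dim: "dim_row M = n" using M by (auto simp: D_mat_def)
  have "(\<lambda>k. (mat_star_power I M k $$ (i, j)) t h) sums (R $$ (i, j)) t h"
    if "i < n" "j < n" "t \<in> J" "h \<in> TF" for i j t h
  proof -
    have "(\<Sum>k<m. (mat_star_power I M k $$ (i, j)) t h) =
        (R $$ (i, j)) t h - ((mat_star_power I M m \<star>\<^sub>m\<^sub>m R) $$ (i, j)) t h" for m
      using arg_cong[OF neumann_remainder[OF D_mat_OM[OF M] D_mat_OM[OF R] inv(2) that(1,2), of m], of "\<lambda>d. d t h"]
      by (simp add: sum_distr_apply)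
    moreover have "(\<lambda>m. (R $$ (i, j)) t h - ((mat_star_power I M m \<star>\<^sub>m\<^sub>m R) $$ (i, j)) t h) \<longlonglongrightarrow> (R $$ (i, j)) t h - 0"
      by (intro tendsto_diff tendsto_const lim that)
    ultimately show ?thesis by (simp add: sums_def)
  qed
  then show ?thesis unfolding is_star_resolvent_def Let_def dim using M R inv by blast
qed

lemma star_resolvent_eqI:
  assumes "is_star_resolvent I M R"
  shows "star_resolvent I M = R"
  unfolding star_resolvent_def
proof (rule the_equality[where P = "is_star_resolvent I M", OF assms])
  fix S assume S: "is_star_resolvent I M S"
  define n where "n = dim_row M"
  have R: "R \<in> OM n n" "R \<star>\<^sub>m\<^sub>m (IdM n - M) = IdM n" and M: "M \<in> OM n n"
    using assms unfolding is_star_resolvent_def Let_def n_def[symmetric] by (auto intro: D_mat_OM)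
  have S: "S \<in> OM n n" "(IdM n - M) \<star>\<^sub>m\<^sub>m S = IdM n"
    using S unfolding is_star_resolvent_def Let_def n_def[symmetric] by (auto intro: D_mat_OM)
  have "R = R \<star>\<^sub>m\<^sub>m ((IdM n - M) \<star>\<^sub>m\<^sub>m S)" by (simp add: S Id_mat_star[OF R(1)])
  also have "\<dots> = S" using mat_star_assoc[OF R(1) OM_diff[OF Id_OM M] S(1)] R(2) Id_mat_star[OF S(1)] by simp
  finally show "S = R" by simp
qed

section \<open>Powers of Volterra matrices\<close>

text \<open>Iterated Volterra integrals gain a factorial: each of them integrates the bound
  \<open>(s - a)\<^sup>m / m!\<close> once more.  Here \<open>a\<close> lies to the left of the support of the test function, and the bound
  is uniform in the compact interval \<open>{a..t1}\<close>.\<close>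

lemma volterra_power_bound:
  assumes K: "K \<in> mats_over VO n n" and g: "g \<in> TF" and t1: "t1 \<in> J"
  shows "\<exists>a B C. a \<in> J \<and> a \<le> t1 \<and> 0 \<le> B \<and> 0 \<le> C \<and> (\<forall>m i j. i < n \<longrightarrow> j < n \<longrightarrow>
    (\<forall>s\<in>J. s \<le> a \<longrightarrow> (mat_star_power I K m $$ (i, j)) s g = 0) \<and>
    (\<forall>s\<in>{a..t1}. cmod ((mat_star_power I K m $$ (i, j)) s g) \<le> B * ((C * (s - a)) ^ m / fact m)))"
proof -
  interpret J: star_interval J by (rule interior_star_interval)
  have KO: "K \<in> OM n n" using K by (rule mats_over_mono) (auto intro: VO_ops)
  have dim: "dim_row K = n" using mats_over_carrier[OF K] by auto
  obtain b where b: "b \<in> J" "\<And>t. t \<in> J \<Longrightarrow> t \<le> b \<Longrightarrow> g t = 0" using test_funE[OF g] by blast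
  define a where "a = min b t1"
  have a: "a \<in> J" "a \<le> t1" "\<And>t. t \<in> J \<Longrightarrow> t \<le> a \<Longrightarrow> g t = 0" using b t1 by (auto simp: a_def min_def split: if_splits)
  have sub: "{a..t1} \<subseteq> J" using J.segment_subset a t1 by auto
  have "\<exists>f. smooth2 f \<and> K $$ (i, l) = Vol f" if "i < n" "l < n" for i l
    using mats_over_index[OF K that] by (auto simp: volterra_ops_def)
  then obtain f where f: "\<And>i l. i < n \<Longrightarrow> l < n \<Longrightarrow> smooth2 (f i l) \<and> K $$ (i, l) = Vol (f i l)" by metis
  have "\<exists>c. \<forall>s\<in>{a..t1}. \<forall>r\<in>{a..t1}. cmod (f i l s r) \<le> c" if "i < n" "l < n" for i l
  proof -
    have "smooth2_on J (f i l)" using f[OF that] by (intro smooth2_on_J) simp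
    then have "continuous_on ({a..t1} \<times> {a..t1}) (\<lambda>(x, y). f i l x y)"
      by (rule continuous_on_subset[OF J.smooth2_continuous]) (use sub in auto)
    then have "compact ((\<lambda>(x, y). f i l x y) ` ({a..t1} \<times> {a..t1}))"
      by (rule compact_continuous_image) (simp add: compact_Times)
    then have "bounded ((\<lambda>(x, y). f i l x y) ` ({a..t1} \<times> {a..t1}))" by (rule compact_imp_bounded)
    then obtain c where "\<forall>x\<in>(\<lambda>(x, y). f i l x y) ` ({a..t1} \<times> {a..t1}). cmod x \<le> c" by (auto simp: bounded_iff)
    then show ?thesis by (intro exI[of _ c]) auto
  qed
  then obtain c where c: "\<And>i l s r. i < n \<Longrightarrow> l < n \<Longrightarrow> s \<in> {a..t1} \<Longrightarrow> r \<in> {a..t1} \<Longrightarrow> cmod (f i l s r) \<le> c i l"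
    by metis
  \<comment> \<open>one bound for all the kernels that occur in \<open>K\<close>\<close>
  define c0 where "c0 = (\<Sum>i<n. \<Sum>l<n. \<bar>c i l\<bar>)"
  have c0: "cmod (f i l s r) \<le> c0" if "i < n" "l < n" "s \<in> {a..t1}" "r \<in> {a..t1}" for i l s r
  proof -
    have "cmod (f i l s r) \<le> \<bar>c i l\<bar>" using c[OF that] by linarith
    also have "\<dots> \<le> (\<Sum>l<n. \<bar>c i l\<bar>)" by (rule member_le_sum) (use that in auto)
    also have "\<dots> \<le> c0" unfolding c0_def
      by (rule member_le_sum[of i _ "\<lambda>i. \<Sum>l<n. \<bar>c i l\<bar>"]) (use that in \<open>auto intro: sum_nonneg\<close>)
    finally show ?thesis .
  qed
  have "c0 \<ge> 0" by (auto simp: c0_def intro!: sum_nonneg)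
  have "bounded (g ` {a..t1})"
    by (rule compact_imp_bounded, rule compact_continuous_image[OF continuous_on_subset[OF test_fun_continuous[OF g] sub]]) simp
  then obtain B where "\<forall>s\<in>{a..t1}. cmod (g s) \<le> B" unfolding bounded_iff by blast
  then have B: "\<And>s. s \<in> {a..t1} \<Longrightarrow> cmod (g s) \<le> B" by blast
  have "cmod (g a) \<le> B" using B a(2) by simp
  then have "B \<ge> 0" using norm_ge_zero[of "g a"] by linarith
  define C where "C = real n * c0"
  have "C \<ge> 0" using \<open>c0 \<ge> 0\<close> by (simp add: C_def)
  define y where "y = (\<lambda>m i j s. (mat_star_power I K m $$ (i, j)) s g)"
  have y0: "y 0 i j s = (if i = j then g s else 0)" if "i < n" "j < n" "s \<in> J" for i j s
    using that g by (simp add: y_def dim index_Id_star one_star_apply)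
  have yTF: "y m i j \<in> TF" if "i < n" "j < n" for m i j
    unfolding y_def using ops_test_fun[OF mats_over_index[OF mat_power_OM[OF KO] that] g] .
  have ySuc: "y (Suc m) i j s = (\<Sum>l<n. Vol (f i l) s (y m l j))" if "i < n" "j < n" for m i j s
  proof -
    note cK = mats_over_carrier[OF K] mats_over_carrier[OF mat_power_OM[OF KO]]
    have "mat_star_power I K (Suc m) $$ (i, j) = (\<Sum>l<n. K $$ (i, l) \<star> mat_star_power I K m $$ (l, j))"
      using index_mat_star[OF cK that] by simp
    also have "\<dots> = (\<Sum>l<n. Vol (f i l) \<star> mat_star_power I K m $$ (l, j))"
      by (intro sum.cong refl) (use f that in auto)
    finally show ?thesis by (simp add: y_def sum_distr_apply star_def)
  qed
  have zero: "y m i j s = 0" if "i < n" "j < n" "s \<in> J" "s \<le> a" for m i j s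
    using that
  proof (induction m arbitrary: i s)
    case 0
    then show ?case using a(3) by (simp add: y0)
  next
    case (Suc m)
    have "Vol (f i l) s (y m l j) = 0" if "l < n" for l
    proof -
      have "integral {r \<in> J. r \<le> s} (\<lambda>r. f i l s r * y m l j r) = integral {r \<in> J. r \<le> s} (\<lambda>r. 0)"
        by (rule integral_cong) (use Suc that in auto)
      then show ?thesis by (simp add: theta_apply)
    qed
    then show ?case using Suc.prems by (simp add: ySuc)
  qed
  have bound: "cmod (y m i j s) \<le> B * ((C * (s - a)) ^ m / fact m)"
    if "i < n" "j < n" "a \<le> s" "s \<le> t1" for m i j s
    using that
  proof (induction m arbitrary: i s)
    case 0
    then show ?case using B[of s] sub \<open>B \<ge> 0\<close> by (auto simp: y0)
  next
    case (Suc m)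
    have s: "s \<in> J" using Suc.prems sub by auto
    have "cmod (Vol (f i l) s (y m l j)) \<le> (c0 * (B * C ^ m)) * (\<bar>s - a\<bar> ^ Suc m / fact (Suc m))"
      if l: "l < n" for l
    proof -
      have "Vol (f i l) s (y m l j) = oint a s (\<lambda>r. f i l s r * y m l j r)"
        by (rule theta_oint[OF a(1) zero[OF l Suc.prems(2)] yTF[OF l Suc.prems(2)] s])
      also have "cmod \<dots> \<le> (c0 * (B * C ^ m)) * (\<bar>s - a\<bar> ^ Suc m / fact (Suc m))"
      proof (rule J.oint_power_bound[OF _ a(1) s])
        show "continuous_on J (\<lambda>r. f i l s r * y m l j r)"
          using f[OF Suc.prems(1) l]
          by (intro continuous_on_mult smooth2_continuous_J[OF _ s] test_fun_continuous[OF yTF[OF l Suc.prems(2)]]) simp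
        fix r assume "min a s \<le> r" "r \<le> max a s"
        then have r: "a \<le> r" "r \<le> s" using Suc.prems by auto
        have "cmod (f i l s r * y m l j r) \<le> c0 * (B * ((C * (r - a)) ^ m / fact m))"
          unfolding norm_mult
        proof (rule mult_mono)
          show "cmod (f i l s r) \<le> c0" by (rule c0) (use Suc.prems l r in auto)
          show "cmod (y m l j r) \<le> B * ((C * (r - a)) ^ m / fact m)"
            using Suc.IH[OF l Suc.prems(2), of r] r Suc.prems by simp
        qed (use \<open>c0 \<ge> 0\<close> in auto)
        also have "\<dots> = (c0 * (B * C ^ m)) * (\<bar>r - a\<bar> ^ m / fact m)"
          using r by (simp add: power_mult_distrib)
        finally show "cmod (f i l s r * y m l j r) \<le> (c0 * (B * C ^ m)) * (\<bar>r - a\<bar> ^ m / fact m)" .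
      qed
      finally show ?thesis .
    qed
    then have "cmod (y (Suc m) i j s) \<le> (\<Sum>l<n. (c0 * (B * C ^ m)) * (\<bar>s - a\<bar> ^ Suc m / fact (Suc m)))"
      unfolding ySuc[OF Suc.prems(1,2)] by (intro order_trans[OF norm_sum] sum_mono) auto
    also have "\<dots> = B * (C ^ Suc m * (\<bar>s - a\<bar> ^ Suc m / fact (Suc m)))"
      by (simp add: C_def del: fact_Suc)
    also have "\<dots> = B * ((C * (s - a)) ^ Suc m / fact (Suc m))"
      using Suc.prems(3) by (simp only: power_mult_distrib times_divide_eq_right abs_of_nonneg diff_ge_0_iff_ge)
    finally show ?case .
  qed
  show ?thesis
    by (intro exI[of _ a] exI[of _ B] exI[of _ C] conjI allI impI ballI a \<open>B \<ge> 0\<close> \<open>C \<ge> 0\<close>)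
       (use zero[unfolded y_def] bound[unfolded y_def] in auto)
qed

lemma power_div_fact_tendsto_0: "(\<lambda>m. B * (x ^ m / fact m)) \<longlonglongrightarrow> (0::real)"
proof -
  have "(\<lambda>m. inverse (fact m) * x ^ m) \<longlonglongrightarrow> 0" by (rule summable_LIMSEQ_zero[OF summable_exp])
  from tendsto_mult_right_zero[OF this, of B] show ?thesis by (simp add: field_simps)
qed

text \<open>An operator of order \<open>0\<close> at \<open>t\<close> only involves the values of a function and not its derivatives, so that
  it preserves the convergence to \<open>0\<close>, which is uniform on \<open>{a..t}\<close>.\<close>

lemma O0_volterra_power_tendsto:
  assumes K: "K \<in> mats_over VO n n" and g: "g \<in> TF" and t: "t \<in> J" and X: "X \<in> O0" and ij: "i < n" "j < n"
  shows "(\<lambda>m. X t (\<lambda>s. (mat_star_power I K m $$ (i, j)) s g)) \<longlonglongrightarrow> 0"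
proof -
  interpret J: star_interval J by (rule interior_star_interval)
  have KO: "K \<in> OM n n" using K by (rule mats_over_mono) (auto intro: VO_ops)
  define y where "y = (\<lambda>m s. (mat_star_power I K m $$ (i, j)) s g)"
  have yTF: "y m \<in> TF" for m
    unfolding y_def using ops_test_fun[OF mats_over_index[OF mat_power_OM[OF KO] ij] g] .
  obtain a B C where a: "a \<in> J" "a \<le> t" and BC: "0 \<le> B" "0 \<le> C"
    and *: "\<forall>m i j. i < n \<longrightarrow> j < n \<longrightarrow>
      (\<forall>s\<in>J. s \<le> a \<longrightarrow> (mat_star_power I K m $$ (i, j)) s g = 0) \<and>
      (\<forall>s\<in>{a..t}. cmod ((mat_star_power I K m $$ (i, j)) s g) \<le> B * ((C * (s - a)) ^ m / fact m))"
    using volterra_power_bound[OF K g t] by blast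
  have zero: "y m s = 0" if "s \<in> J" "s \<le> a" for m s
    using * ij that unfolding y_def by blast
  have bound: "cmod (y m s) \<le> B * ((C * (s - a)) ^ m / fact m)" if "a \<le> s" "s \<le> t" for m s
    using * ij that unfolding y_def by simp
  have unif: "cmod (y m s) \<le> B * ((C * (t - a)) ^ m / fact m)" if "a \<le> s" "s \<le> t" for m s
    by (rule order_trans[OF bound[OF that]])
       (use that BC in \<open>auto intro!: mult_left_mono divide_right_mono power_mono\<close>)
  obtain c f where X: "smooth1 c" "smooth2 f" "X = Mul c + Vol f" using O0E[OF X] by blast
  have "bounded (f t ` {a..t})"
    by (rule compact_imp_bounded, rule compact_continuous_image[OF continuous_on_subset[OF smooth2_continuous_J[OF X(2) t]]])
       (use J.segment_subset[OF a(1) t] in auto)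
  then obtain Cf where "\<forall>s\<in>{a..t}. cmod (f t s) \<le> Cf" unfolding bounded_iff by blast
  then have Cf: "\<And>s. s \<in> {a..t} \<Longrightarrow> cmod (f t s) \<le> Cf" by blast
  have "cmod (f t a) \<le> Cf" using Cf a(2) by simp
  then have "Cf \<ge> 0" using norm_ge_zero[of "f t a"] by linarith
  define z where "z m = B * ((C * (t - a)) ^ m / fact m)" for m
  have bd: "cmod (X t (y m)) \<le> (cmod (c t) + Cf * (t - a)) * z m" for m
  proof -
    have "Vol f t (y m) = integral {a..t} (\<lambda>r. f t r * y m r)"
      using theta_oint[OF a(1) zero yTF t] a by (simp add: oint_le)
    also have "cmod \<dots> \<le> (Cf * z m) * (t - a)"
    proof (rule integral_bound)
      show "continuous_on {a..t} (\<lambda>r. f t r * y m r)"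
        by (rule continuous_on_subset[OF continuous_on_mult[OF smooth2_continuous_J[OF X(2) t] test_fun_continuous[OF yTF]]])
           (rule J.segment_subset[OF a(1) t])
      show "cmod (f t r * y m r) \<le> Cf * z m" if "r \<in> {a..t}" for r
        unfolding norm_mult z_def by (rule mult_mono) (use that Cf unif \<open>Cf \<ge> 0\<close> in auto)
    qed (use a in auto)
    finally have "cmod (Vol f t (y m)) \<le> (Cf * z m) * (t - a)" .
    moreover have "cmod (y m t) \<le> z m" unfolding z_def by (rule unif[OF a(2) order_refl])
    from mult_left_mono[OF this norm_ge_zero] have "cmod (Mul c t (y m)) \<le> cmod (c t) * z m"
      using t yTF by (simp add: mult_op_def norm_mult)
    ultimately show ?thesis
      unfolding X(3) plus_fun_apply using norm_triangle_ineq[of "Mul c t (y m)" "Vol f t (y m)"]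
      by (simp add: algebra_simps)
  qed
  have "(\<lambda>m. (cmod (c t) + Cf * (t - a)) * z m) \<longlonglongrightarrow> 0"
    unfolding z_def by (rule tendsto_mult_right_zero[OF power_div_fact_tendsto_0])
  then have "(\<lambda>m. X t (y m)) \<longlonglongrightarrow> 0"
    by (rule Lim_null_comparison[rotated]) (use bd in auto)
  then show ?thesis by (simp add: y_def)
qed

text \<open>An idempotent equals its powers, and those of a Volterra matrix tend to \<open>0\<close>.\<close>

lemma idempotent_volterra_zero:
  assumes K: "K \<in> mats_over VO n n" and idem: "K \<star>\<^sub>m\<^sub>m K = K"
  shows "K = 0\<^sub>m n n"
proof -
  have KO: "K \<in> OM n n" using K by (rule mats_over_mono) (auto intro: VO_ops)
  have dim: "dim_row K = n" using mats_over_carrier[OF K] by auto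
  have pow: "mat_star_power I K (Suc m) = K" for m
    by (induction m) (simp_all add: dim Id_mat_star[OF KO] idem)
  have "K $$ (i, j) = 0" if ij: "i < n" "j < n" for i j
  proof (rule ops_eqI[OF mats_over_index[OF KO ij] ops_zero])
    fix t h assume t: "t \<in> J" and h: "h \<in> TF"
    have "(\<lambda>m. Unit t (\<lambda>s. (mat_star_power I K (Suc m) $$ (i, j)) s h)) \<longlonglongrightarrow> 0"
      using O0_volterra_power_tendsto[OF K h t unit_O0 ij] by (rule LIMSEQ_Suc)
    then have "(\<lambda>m::nat. Unit t (\<lambda>s. (K $$ (i, j)) s h)) \<longlonglongrightarrow> 0" by (simp only: pow)
    then have "Unit t (\<lambda>s. (K $$ (i, j)) s h) = 0" by (simp add: LIMSEQ_const_iff)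
    then show "(K $$ (i, j)) t h = 0 t h"
      using ops_test_fun[OF mats_over_index[OF KO ij] h] t by (simp add: one_star_apply)
  qed
  then show ?thesis using mats_over_carrier[OF K] by (intro eq_matI) auto
qed

end

section \<open>Linear differential equations\<close>

lemma left_inverse_imp_right_inverse:
  fixes z u :: "nat \<Rightarrow> nat \<Rightarrow> complex"
  assumes "\<And>i j. i < n \<Longrightarrow> j < n \<Longrightarrow> (\<Sum>k<n. z i k * u k j) = (if i = j then 1 else 0)"
    and ij: "i < n" "j < n"
  shows "(\<Sum>k<n. u i k * z k j) = (if i = j then 1 else 0)"
proof -
  define Z where "Z = Matrix.mat n n (\<lambda>(i, j). z i j)"
  define U where "U = Matrix.mat n n (\<lambda>(i, j). u i j)"
  have c: "Z \<in> carrier_mat n n" "U \<in> carrier_mat n n" by (simp_all add: Z_def U_def)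
  have ZU: "(Z * U) $$ (i, j) = (\<Sum>k<n. z i k * u k j)" "(U * Z) $$ (i, j) = (\<Sum>k<n. u i k * z k j)"
    if "i < n" "j < n" for i j
    using that unfolding Z_def U_def by (simp_all add: scalar_prod_def atLeast0LessThan)
  have "Z * U = 1\<^sub>m n"
  proof (rule eq_matI)
    fix i j assume "i < dim_row (1\<^sub>m n :: complex mat)" "j < dim_col (1\<^sub>m n :: complex mat)"
    then have ij: "i < n" "j < n" by simp_all
    show "(Z * U) $$ (i, j) = 1\<^sub>m n $$ (i, j)"
      unfolding ZU(1)[OF ij] assms(1)[OF ij] using ij by simp
  qed (use c in auto)
  from mat_mult_left_right_inverse[OF c this] have "(U * Z) $$ (i, j) = 1\<^sub>m n $$ (i, j)" by (simp only:)
  then show ?thesis unfolding ZU(2)[OF ij] using ij by simp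
qed

text \<open>The summands of the Picard series, that is, the iterated integrals of the matrix \<open>b\<close>.\<close>

primrec picard :: "nat \<Rightarrow> (nat \<Rightarrow> nat \<Rightarrow> real \<Rightarrow> complex) \<Rightarrow> real \<Rightarrow> (nat \<Rightarrow> complex) \<Rightarrow> nat \<Rightarrow> nat \<Rightarrow> real \<Rightarrow> complex" where
  "picard n b p x0 0 = (\<lambda>i t. x0 i)"
| "picard n b p x0 (Suc m) = (\<lambda>i t. oint p t (\<lambda>s. \<Sum>j<n. b i j s * picard n b p x0 m j s))"

context star_interval
begin

lemma picard_continuous:
  assumes b: "\<And>i j. i < n \<Longrightarrow> j < n \<Longrightarrow> continuous_on I (b i j)" and p: "p \<in> I" and i: "i < n"
  shows "continuous_on I (picard n b p x0 m i)"
    and "t \<in> I \<Longrightarrow> (picard n b p x0 (Suc m) i has_vector_derivative (\<Sum>j<n. b i j t * picard n b p x0 m j t)) (at t within I)"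
proof -
  have "continuous_on I (picard n b p x0 m i) \<and> (\<forall>t\<in>I. (picard n b p x0 (Suc m) i has_vector_derivative (\<Sum>j<n. b i j t * picard n b p x0 m j t)) (at t within I))"
    using i
  proof (induction m arbitrary: i)
    case 0
    have "continuous_on I (\<lambda>s. \<Sum>j<n. b i j s * x0 j)"
      by (intro continuous_intros b 0) simp
    then show ?case using oint_has_vector_derivative[OF _ p] by auto
  next
    case (Suc m)
    have c: "continuous_on I (picard n b p x0 (Suc m) j)" if "j < n" for j
      unfolding continuous_on_eq_continuous_within
      using Suc.IH[OF that] has_vector_derivative_continuous by blast
    have "continuous_on I (\<lambda>s. \<Sum>j<n. b i j s * picard n b p x0 (Suc m) j s)"
      by (intro continuous_on_sum continuous_on_mult b c Suc.prems) simp_all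
    then show ?case using oint_has_vector_derivative[OF _ p] c[OF Suc.prems]
      by (auto simp del: picard.simps simp: picard.simps(2)[of n b p x0 "Suc m"])
  qed
  then show "continuous_on I (picard n b p x0 m i)"
    and "t \<in> I \<Longrightarrow> (picard n b p x0 (Suc m) i has_vector_derivative (\<Sum>j<n. b i j t * picard n b p x0 m j t)) (at t within I)"
    by blast+
qed

lemma picard_bound:
  assumes b: "\<And>i j. i < n \<Longrightarrow> j < n \<Longrightarrow> continuous_on I (b i j)" and I: "u \<in> I" "v \<in> I" and p: "p \<in> {u..v}"
    and C: "\<And>i j t. i < n \<Longrightarrow> j < n \<Longrightarrow> t \<in> {u..v} \<Longrightarrow> cmod (b i j t) \<le> C" "0 \<le> C"
    and X: "\<And>i. i < n \<Longrightarrow> cmod (x0 i) \<le> X"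
    and i: "i < n" and t: "t \<in> {u..v}"
  shows "cmod (picard n b p x0 m i t) \<le> X * (real n * C) ^ m * (\<bar>t - p\<bar> ^ m / fact m)"
  using i t
proof (induction m arbitrary: i t)
  case 0
  then show ?case using X by simp
next
  case (Suc m)
  have sub: "{u..v} \<subseteq> I" by (rule segment_subset[OF I])
  have "cmod (oint p t (\<lambda>s. \<Sum>j<n. b i j s * picard n b p x0 m j s)) \<le>
      (X * (real n * C) ^ Suc m) * (\<bar>t - p\<bar> ^ Suc m / fact (Suc m))"
  proof (rule oint_power_bound)
    show "continuous_on I (\<lambda>s. \<Sum>j<n. b i j s * picard n b p x0 m j s)"
      using sub p by (intro continuous_on_sum continuous_on_mult b picard_continuous Suc.prems) auto
    fix s assume s: "min p t \<le> s" "s \<le> max p t"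
    then have s': "s \<in> {u..v}" using p Suc.prems by auto
    have "cmod (\<Sum>j<n. b i j s * picard n b p x0 m j s) \<le> (\<Sum>j<n. C * (X * (real n * C) ^ m * (\<bar>s - p\<bar> ^ m / fact m)))"
    proof (intro order_trans[OF norm_sum] sum_mono)
      fix j assume "j \<in> {..<n}"
      then show "cmod (b i j s * picard n b p x0 m j s) \<le> C * (X * (real n * C) ^ m * (\<bar>s - p\<bar> ^ m / fact m))"
        unfolding norm_mult by (intro mult_mono C Suc s') auto
    qed
    also have "\<dots> = X * (real n * C) ^ Suc m * (\<bar>s - p\<bar> ^ m / fact m)" by simp
    finally show "cmod (\<Sum>j<n. b i j s * picard n b p x0 m j s) \<le> X * (real n * C) ^ Suc m * (\<bar>s - p\<bar> ^ m / fact m)" .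
  qed (use sub p Suc.prems in auto)
  then show ?case by (simp del: fact_Suc power_Suc)
qed

text \<open>The bound of the summands gives uniform convergence of the Picard series and of the series of its
  derivatives on every compact subinterval.\<close>

lemma linear_ode_exists:
  fixes b :: "nat \<Rightarrow> nat \<Rightarrow> real \<Rightarrow> complex" and x0 :: "nat \<Rightarrow> complex"
  assumes b: "\<And>i j. i < n \<Longrightarrow> j < n \<Longrightarrow> continuous_on I (b i j)" and p: "p \<in> I"
  shows "\<exists>x. (\<forall>i<n. x i p = x0 i) \<and>
    (\<forall>i<n. \<forall>t\<in>I. (x i has_vector_derivative (\<Sum>j<n. b i j t * x j t)) (at t within I))"
proof -
  define y where "y m i t = picard n b p x0 m i t" for m i t
  define x where "x i t = (\<Sum>m. y m i t)" for i t
  define X where "X = (\<Sum>i<n. cmod (x0 i))"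
  have X: "cmod (x0 i) \<le> X" if "i < n" for i
    unfolding X_def by (rule member_le_sum[of i _ "\<lambda>i. cmod (x0 i)"]) (use that in auto)
  have X0: "X \<ge> 0" by (auto simp: X_def intro: sum_nonneg)
  have "x i p = x0 i" for i
  proof -
    have "y m i p = (if m = 0 then x0 i else 0)" for m by (cases m) (simp_all add: y_def)
    then show ?thesis using suminf_finite[of "{0}" "\<lambda>m. y m i p"] by (simp add: x_def)
  qed
  moreover have "(x i has_vector_derivative (\<Sum>j<n. b i j t * x j t)) (at t within I)" if i: "i < n" and t: "t \<in> I" for i t
  proof -
    obtain u v where uv: "u \<in> I" "v \<in> I" "t \<in> {u..v}" "p \<in> {u..v}" "at t within I = at t within {u..v}"
      using compact_neighbourhood[OF t p] by blast
    have sub: "{u..v} \<subseteq> I" by (rule segment_subset[OF uv(1,2)])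
    have "\<exists>c. \<forall>t\<in>{u..v}. cmod (b i j t) \<le> c" if "i < n" "j < n" for i j
    proof -
      have "bounded (b i j ` {u..v})"
        by (rule compact_imp_bounded, rule compact_continuous_image[OF continuous_on_subset[OF b[OF that] sub]]) simp
      then show ?thesis unfolding bounded_iff by blast
    qed
    then obtain c where c: "\<And>i j t. i < n \<Longrightarrow> j < n \<Longrightarrow> t \<in> {u..v} \<Longrightarrow> cmod (b i j t) \<le> c i j" by metis
    define C where "C = (\<Sum>i<n. \<Sum>j<n. \<bar>c i j\<bar>)"
    have C: "cmod (b i j t) \<le> C" if "i < n" "j < n" "t \<in> {u..v}" for i j t
    proof -
      have "cmod (b i j t) \<le> \<bar>c i j\<bar>" using c[OF that] by linarith
      also have "\<dots> \<le> (\<Sum>j<n. \<bar>c i j\<bar>)" by (rule member_le_sum) (use that in auto)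
      also have "\<dots> \<le> C" unfolding C_def
        by (rule member_le_sum[of i _ "\<lambda>i. \<Sum>j<n. \<bar>c i j\<bar>"]) (use that in \<open>auto intro: sum_nonneg\<close>)
      finally show ?thesis .
    qed
    have C0: "C \<ge> 0" by (auto simp: C_def intro!: sum_nonneg)
    define L where "L = real n * C * (v - u)"
    have bd: "cmod (y m j s) \<le> X * (inverse (fact m) * L ^ m)" if "j < n" "s \<in> {u..v}" for m j s
    proof -
      have "cmod (y m j s) \<le> X * (real n * C) ^ m * (\<bar>s - p\<bar> ^ m / fact m)"
        unfolding y_def by (rule picard_bound[OF b uv(1,2,4) C C0 X that])
      also have "\<dots> \<le> X * (real n * C) ^ m * ((v - u) ^ m / fact m)"
        using that uv X0 C0 by (intro mult_left_mono divide_right_mono power_mono) auto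
      also have "\<dots> = X * (inverse (fact m) * L ^ m)"
        unfolding L_def power_mult_distrib by (simp add: divide_inverse mult_ac)
      finally show ?thesis .
    qed
    have sumM: "summable (\<lambda>m. X * (inverse (fact m) * L ^ m))"
      by (intro summable_mult summable_exp)
    have sumy: "summable (\<lambda>m. y m j s)" if "j < n" "s \<in> {u..v}" for j s
      by (rule summable_comparison_test'[OF sumM bd[OF that]])
    \<comment> \<open>the derivatives of the summands\<close>
    define y' where "y' m s = (case m of 0 \<Rightarrow> 0 | Suc k \<Rightarrow> \<Sum>j<n. b i j s * y k j s)" for m s
    have dy: "(y m i has_vector_derivative y' m s) (at s within {u..v})" if "s \<in> {u..v}" for m s
    proof (cases m)
      case 0
      then show ?thesis by (simp add: y_def[abs_def] y'_def)
    next
      case (Suc k)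
      have "(picard n b p x0 (Suc k) i has_vector_derivative (\<Sum>j<n. b i j s * picard n b p x0 k j s)) (at s within {u..v})"
        by (rule has_vector_derivative_within_subset[OF picard_continuous(2)[OF b p i] sub]) (use that sub in auto)
      then show ?thesis unfolding Suc y_def[abs_def] y'_def by simp
    qed
    define G where "G s = (\<Sum>j<n. b i j s * x j s)" for s
    have bdy': "cmod (y' (Suc m) s) \<le> (\<Sum>j<n. C * (X * (inverse (fact m) * L ^ m)))" if "s \<in> {u..v}" for m s
    proof -
      have "cmod (\<Sum>j<n. b i j s * y m j s) \<le> (\<Sum>j<n. C * (X * (inverse (fact m) * L ^ m)))"
      proof (intro order_trans[OF norm_sum] sum_mono)
        fix j assume "j \<in> {..<n}"
        then show "cmod (b i j s * y m j s) \<le> C * (X * (inverse (fact m) * L ^ m))"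
          unfolding norm_mult by (intro mult_mono C bd i that C0) auto
      qed
      then show ?thesis by (simp add: y'_def)
    qed
    define Mb where "Mb m = (case m of 0 \<Rightarrow> 0 | Suc k \<Rightarrow> \<Sum>j<n. C * (X * (inverse (fact k) * L ^ k)))" for m
    have "summable (\<lambda>m. Mb (Suc m))" unfolding Mb_def nat.case
      by (intro summable_sum summable_mult summable_exp)
    then have sumMb: "summable Mb" by (simp only: summable_Suc_iff)
    have bdMb: "cmod (y' m s) \<le> Mb m" if "s \<in> {u..v}" for m s
      using bdy'[OF that] by (cases m) (simp_all add: Mb_def y'_def)
    have y'G: "(\<lambda>m. y' m s) sums G s" if s: "s \<in> {u..v}" for s
    proof -
      have "(\<lambda>m. \<Sum>j<n. b i j s * y m j s) sums G s"
        unfolding G_def x_def by (intro sums_sum sums_mult summable_sums sumy s) simp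
      then have "(\<lambda>m. y' (Suc m) s) sums G s" by (simp add: y'_def)
      then show ?thesis using sums_Suc_iff[of "\<lambda>m. y' m s" "G s"] by (simp add: y'_def)
    qed
    have "uniform_limit {u..v} (\<lambda>k s. \<Sum>m<k. y' m s) (\<lambda>s. \<Sum>m. y' m s) sequentially"
      by (rule Weierstrass_m_test[OF bdMb sumMb])
    then have unif: "\<forall>\<^sub>F k in sequentially. \<forall>s\<in>{u..v}. cmod ((\<Sum>m<k. y' m s) - (\<Sum>m. y' m s)) < e" if "e > 0" for e
      using that unfolding uniform_limit_iff dist_norm by blast
    have "\<exists>g. \<forall>s\<in>{u..v}. (\<lambda>m. y m i s) sums g s \<and> (g has_derivative (\<lambda>h. h *\<^sub>R G s)) (at s within {u..v})"
    proof (rule has_derivative_series[where f' = "\<lambda>m s h. h *\<^sub>R y' m s"])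
      show "(y m i has_derivative (\<lambda>h. h *\<^sub>R y' m s)) (at s within {u..v})" if "s \<in> {u..v}" for m s
        using dy[OF that] by (simp add: has_vector_derivative_def)
      show "\<forall>\<^sub>F k in sequentially. \<forall>s\<in>{u..v}. \<forall>h. norm ((\<Sum>m<k. h *\<^sub>R y' m s) - h *\<^sub>R G s) \<le> e * norm h"
        if "e > 0" for e
        using unif[OF that]
      proof (rule eventually_mono, intro ballI allI)
        fix k s and h :: real
        assume *: "\<forall>s\<in>{u..v}. cmod ((\<Sum>m<k. y' m s) - (\<Sum>m. y' m s)) < e" and s: "s \<in> {u..v}"
        have "(\<Sum>m<k. h *\<^sub>R y' m s) - h *\<^sub>R G s = h *\<^sub>R ((\<Sum>m<k. y' m s) - (\<Sum>m. y' m s))"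
          using sums_unique[OF y'G[OF s]] by (simp add: scaleR_sum_right scaleR_diff_right)
        moreover have "cmod ((\<Sum>m<k. y' m s) - (\<Sum>m. y' m s)) \<le> e" using * s by (auto intro: less_imp_le)
        from mult_right_mono[OF this, of "norm h"]
        have "norm (h *\<^sub>R ((\<Sum>m<k. y' m s) - (\<Sum>m. y' m s))) \<le> e * norm h"
          by (simp add: mult.commute)
        ultimately show "norm ((\<Sum>m<k. h *\<^sub>R y' m s) - h *\<^sub>R G s) \<le> e * norm h"
          by (simp only:)
      qed
      show "(\<lambda>m. y m i t) sums (\<Sum>m. y m i t)" by (rule summable_sums[OF sumy[OF i uv(3)]])
    qed (use uv in auto)
    then obtain g where g: "\<forall>s\<in>{u..v}. (\<lambda>m. y m i s) sums g s \<and> (g has_derivative (\<lambda>h. h *\<^sub>R G s)) (at s within {u..v})" by blast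
    have "x i s = g s" if "s \<in> {u..v}" for s
      using g that sums_unique[of "\<lambda>m. y m i s" "g s"] by (simp add: x_def)
    moreover have "(g has_vector_derivative G t) (at t within {u..v})"
      using g uv(3) by (simp add: has_vector_derivative_def)
    ultimately have "(x i has_vector_derivative G t) (at t within {u..v})"
      using has_vector_derivative_transform[OF uv(3), of "x i" g "G t"] by simp
    then show ?thesis unfolding uv(5) G_def .
  qed
  ultimately show ?thesis by (intro exI[of _ x]) auto
qed

text \<open>Linear combinations of the solutions with smooth coefficients are closed under differentiation,
  because the equation expresses the derivatives of the solutions in this form.\<close>

lemma linear_ode_smooth:
  fixes b :: "nat \<Rightarrow> nat \<Rightarrow> real \<Rightarrow> complex"
  assumes b: "\<And>i j. i < n \<Longrightarrow> j < n \<Longrightarrow> smooth1 (b i j)"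
    and x: "\<And>i t. i < n \<Longrightarrow> t \<in> I \<Longrightarrow> (x i has_vector_derivative (\<Sum>j<n. b i j t * x j t)) (at t within I)"
    and i: "i < n"
  shows "smooth1 (x i)"
proof -
  define X where "X q \<longleftrightarrow> (\<exists>c. (\<forall>j<n. smooth2 (c j)) \<and> q = (\<lambda>s y. \<Sum>j<n. c j s y * x j s))" for q
  have "x i s = (\<Sum>j<n. (if j = i then 1 else 0) * x j s)" for s
    using i by (simp add: if_distrib[of "\<lambda>z. z * _"] cong: if_cong)
  then have "X (\<lambda>s y. x i s)" unfolding X_def
    by (intro exI[of _ "\<lambda>j s y. if j = i then 1 else 0"]) (auto simp: fun_eq_iff intro: smooth2_const)
  then show ?thesis
  proof (rule smooth2_coinduct[where X = X])
    fix q assume "X q"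
    then obtain c where c: "\<And>j. j < n \<Longrightarrow> smooth2 (c j)" and q: "q = (\<lambda>s y. \<Sum>j<n. c j s y * x j s)"
      unfolding X_def by blast
    have cx: "continuous_on I (x j)" if "j < n" for j
      unfolding continuous_on_eq_continuous_within using x[OF that] has_vector_derivative_continuous by blast
    have "continuous_on (I \<times> I) (\<lambda>z. \<Sum>j<n. (case z of (s, y) \<Rightarrow> c j s y) * (case z of (s, y) \<Rightarrow> x j s))"
      by (intro continuous_on_sum continuous_on_mult smooth2_continuous c continuous_on_fst_snd(1) cx) simp_all
    then show "continuous_on (I \<times> I) (\<lambda>(x, y). q x y)" by (simp add: q split_beta)
    define d where "d k = (\<lambda>s y. partial1 I (c k) s y + (\<Sum>j<n. c j s y * b j k s))" for k
    have "smooth2 (d k)" if "k < n" for k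
      unfolding d_def by (intro smooth2_add smooth2_sum smooth2_mult smooth2_partials c b that) simp_all
    then have X1: "X (\<lambda>s y. \<Sum>k<n. d k s y * x k s)" unfolding X_def by blast
    have X2: "X (\<lambda>s y. \<Sum>k<n. partial2 I (c k) s y * x k s)"
      unfolding X_def by (rule exI[of _ "\<lambda>k. partial2 I (c k)"]) (simp add: smooth2_partials c)
    have D1: "((\<lambda>s. q s y) has_vector_derivative (\<Sum>k<n. d k s y * x k s)) (at s within I)" if I: "s \<in> I" "y \<in> I" for s y
    proof -
      have "((\<lambda>s. q s y) has_vector_derivative
          (\<Sum>j<n. c j s y * (\<Sum>k<n. b j k s * x k s) + partial1 I (c j) s y * x j s)) (at s within I)"
        unfolding q by (intro has_vector_derivative_sum has_vector_derivative_mult smooth2_partials c x I) simp_all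
      also have "(\<Sum>j<n. c j s y * (\<Sum>k<n. b j k s * x k s) + partial1 I (c j) s y * x j s) = (\<Sum>k<n. d k s y * x k s)"
      proof -
        have "(\<Sum>j<n. c j s y * (\<Sum>k<n. b j k s * x k s)) = (\<Sum>k<n. (\<Sum>j<n. c j s y * b j k s) * x k s)"
          unfolding sum_distrib_left sum_distrib_right by (subst sum.swap) (simp add: mult.assoc)
        then show ?thesis by (simp add: d_def sum.distrib distrib_right add.commute)
      qed
      finally show ?thesis .
    qed
    have D2: "((\<lambda>y. q s y) has_vector_derivative (\<Sum>k<n. partial2 I (c k) s y * x k s)) (at y within I)"
      if I: "s \<in> I" "y \<in> I" for s y
      unfolding q by (intro has_vector_derivative_sum has_vector_derivative_mult_left smooth2_partials c I) simp_all
    show "\<exists>g h. X g \<and> X h \<and> (\<forall>x\<in>I. \<forall>y\<in>I. ((\<lambda>s. q s y) has_vector_derivative g x y) (at x within I) \<and>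
        ((\<lambda>s. q x s) has_vector_derivative h x y) (at y within I))"
      by (intro exI[of _ "\<lambda>s y. \<Sum>k<n. d k s y * x k s"] exI[of _ "\<lambda>s y. \<Sum>k<n. partial2 I (c k) s y * x k s"]
          conjI ballI X1 X2 D1 D2)
  qed
qed

lemma smooth1_continuous: "smooth1 c \<Longrightarrow> continuous_on I c"
  using smooth2_continuous_diagonal[of "\<lambda>x y. c x"] by simp

text \<open>The rows of the inverse \<open>z\<close> of a fundamental matrix \<open>u\<close> of \<open>u' = a u\<close> solve the adjoint equation
  \<open>z' = - z a\<close>.  Both are constructed with the value \<open>Id\<close> at a point \<open>p\<close>; then \<open>z u\<close> is constant.\<close>

lemma fundamental_matrix:
  fixes a :: "nat \<Rightarrow> nat \<Rightarrow> real \<Rightarrow> complex"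
  assumes a: "\<And>i j. i < n \<Longrightarrow> j < n \<Longrightarrow> smooth1 (a i j)"
  shows "\<exists>u z. (\<forall>i<n. \<forall>j<n. smooth1 (u i j) \<and> smooth1 (z i j) \<and>
      (\<forall>t\<in>I. (z i j has_vector_derivative - (\<Sum>k<n. z i k t * a k j t)) (at t within I) \<and>
        (\<Sum>k<n. z i k t * u k j t) = (if i = j then 1 else 0) \<and>
        (\<Sum>k<n. u i k t * z k j t) = (if i = j then 1 else 0)))"
proof -
  obtain p where p: "p \<in> I" using interior_nonempty interior_subset by blast
  have ca: "continuous_on I (a i j)" if "i < n" "j < n" for i j using smooth1_continuous a that by blast
  have "\<forall>j. \<exists>x. (\<forall>i<n. x i p = (if i = j then 1 else 0)) \<and>
      (\<forall>i<n. \<forall>t\<in>I. (x i has_vector_derivative (\<Sum>k<n. a i k t * x k t)) (at t within I))"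
    by (intro allI linear_ode_exists[OF ca p])
  from choice[OF this] obtain u where u': "\<forall>j. (\<forall>i<n. u j i p = (if i = j then 1 else 0)) \<and>
      (\<forall>i<n. \<forall>t\<in>I. (u j i has_vector_derivative (\<Sum>k<n. a i k t * u j k t)) (at t within I))" by blast
  then have u: "\<And>i j. i < n \<Longrightarrow> u j i p = (if i = j then 1 else 0)"
    "\<And>i j t. i < n \<Longrightarrow> t \<in> I \<Longrightarrow> (u j i has_vector_derivative (\<Sum>k<n. a i k t * u j k t)) (at t within I)"
    by simp_all
  have "\<forall>i. \<exists>x. (\<forall>j<n. x j p = (if i = j then 1 else 0)) \<and>
      (\<forall>j<n. \<forall>t\<in>I. (x j has_vector_derivative (\<Sum>k<n. - a k j t * x k t)) (at t within I))"
    by (intro allI linear_ode_exists[OF _ p] continuous_on_minus ca)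
  from choice[OF this] obtain z where z': "\<forall>i. (\<forall>j<n. z i j p = (if i = j then 1 else 0)) \<and>
      (\<forall>j<n. \<forall>t\<in>I. (z i j has_vector_derivative (\<Sum>k<n. - a k j t * z i k t)) (at t within I))" by blast
  then have z: "\<And>i j. j < n \<Longrightarrow> z i j p = (if i = j then 1 else 0)"
    "\<And>i j t. j < n \<Longrightarrow> t \<in> I \<Longrightarrow> (z i j has_vector_derivative (\<Sum>k<n. - a k j t * z i k t)) (at t within I)"
    by simp_all
  have su: "smooth1 (u j i)" if "i < n" for i j
    by (rule linear_ode_smooth[where x = "u j" and b = a and n = n, OF a u(2) that])
  have sz: "smooth1 (z i j)" if "j < n" for i j
    by (rule linear_ode_smooth[where x = "z i" and b = "\<lambda>j k t. - a k j t" and n = n,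
          OF smooth2_minus[OF a] z(2) that])
  have dz: "(z i j has_vector_derivative - (\<Sum>k<n. z i k t * a k j t)) (at t within I)" if "j < n" "t \<in> I" for i j t
    using z(2)[OF that] by (simp add: sum_negf mult.commute)
  have zu: "(\<Sum>k<n. z i k t * u j k t) = (if i = j then 1 else 0)" if ij: "i < n" "j < n" and t: "t \<in> I" for i j t
  proof -
    define g where "g t = (\<Sum>k<n. z i k t * u j k t)" for t
    have "(g has_vector_derivative 0) (at s within I)" if s: "s \<in> I" for s
    proof -
      have "(g has_vector_derivative
          (\<Sum>k<n. z i k s * (\<Sum>l<n. a k l s * u j l s) + (- (\<Sum>l<n. z i l s * a l k s)) * u j k s)) (at s within I)"
        unfolding g_def by (intro has_vector_derivative_sum has_vector_derivative_mult dz u(2) s) simp_all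
      also have "(\<Sum>k<n. z i k s * (\<Sum>l<n. a k l s * u j l s) + (- (\<Sum>l<n. z i l s * a l k s)) * u j k s) = 0"
      proof -
        have "(\<Sum>k<n. z i k s * (\<Sum>l<n. a k l s * u j l s)) = (\<Sum>l<n. \<Sum>k<n. z i k s * a k l s * u j l s)"
          unfolding sum_distrib_left by (subst sum.swap) (simp add: mult.assoc)
        also have "\<dots> = (\<Sum>k<n. (\<Sum>l<n. z i l s * a l k s) * u j k s)"
          by (simp add: sum_distrib_right)
        finally show ?thesis by (simp add: sum_subtractf)
      qed
      finally show ?thesis .
    qed
    then have "oint p t (\<lambda>s. 0) = g t - g p" by (intro oint_FTC p t)
    then have "g t = g p" by (simp add: oint_def)
    also have "g p = (\<Sum>k<n. if k = i then (if i = j then 1 else 0) else 0)"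
      unfolding g_def by (intro sum.cong refl) (use u(1) z(1) in auto)
    finally show ?thesis using ij by (simp add: g_def)
  qed
  have uz: "(\<Sum>k<n. u k i t * z k j t) = (if i = j then 1 else 0)" if "i < n" "j < n" "t \<in> I" for i j t
    using left_inverse_imp_right_inverse[of n "\<lambda>i k. z i k t" "\<lambda>k j. u j k t" i j] zu that by simp
  show ?thesis
    by (rule exI[of _ "\<lambda>i j. u j i"], rule exI[of _ z]) (use su sz dz zu uz in auto)
qed

section \<open>The resolvent of a separable Volterra matrix\<close>

definition mat_inverse :: "nat \<Rightarrow> distr mat \<Rightarrow> distr mat \<Rightarrow> bool" where
  "mat_inverse n X Y \<longleftrightarrow> X \<in> OM n n \<and> Y \<in> OM n n \<and> X \<star>\<^sub>m\<^sub>m Y = IdM n \<and> Y \<star>\<^sub>m\<^sub>m X = IdM n"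

lemma mat_inverse_sym: "mat_inverse n X Y \<Longrightarrow> mat_inverse n Y X"
  by (simp add: mat_inverse_def)

lemma mat_inverse_star:
  assumes "mat_inverse n X X'" "mat_inverse n Y Y'"
  shows "mat_inverse n (X \<star>\<^sub>m\<^sub>m Y) (Y' \<star>\<^sub>m\<^sub>m X')"
proof -
  have *: "(X \<star>\<^sub>m\<^sub>m Y) \<star>\<^sub>m\<^sub>m (Y' \<star>\<^sub>m\<^sub>m X') = IdM n"
    if "mat_inverse n X X'" "mat_inverse n Y Y'" for X X' Y Y'
  proof -
    have c: "X \<in> OM n n" "X' \<in> OM n n" "Y \<in> OM n n" "Y' \<in> OM n n" using that by (simp_all add: mat_inverse_def)
    have "(X \<star>\<^sub>m\<^sub>m Y) \<star>\<^sub>m\<^sub>m (Y' \<star>\<^sub>m\<^sub>m X') = X \<star>\<^sub>m\<^sub>m ((Y \<star>\<^sub>m\<^sub>m Y') \<star>\<^sub>m\<^sub>m X')"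
      using mat_star_assoc[OF c(1,3) OM_star[OF c(4,2)]] mat_star_assoc[OF c(3,4,2)] by simp
    then show ?thesis using that by (simp add: mat_inverse_def Id_mat_star[OF c(2)])
  qed
  show ?thesis unfolding mat_inverse_def
    using *[OF assms] *[OF mat_inverse_sym[OF assms(2)] mat_inverse_sym[OF assms(1)]] assms
      OM_star[of X n n Y n] OM_star[of Y' n n X' n]
    by (simp add: mat_inverse_def)
qed

lemma D_class_generators:
  "smooth1 c \<Longrightarrow> Mul c \<in> D_class I" "Der \<in> D_class I" "Integ \<in> D_class I" "0 \<in> D_class I"
  using Ord_D_class[of "Mul c" 0] Ord_D_class[OF deriv_pow_Ord, of 1] Ord_D_class[OF deriv_pow_Ord, of "-1"]
    Ord_D_class[OF Ord_zero]
  by (simp_all add: Ord_0 mult_O0 deriv_pow_1)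

text \<open>Variation of constants: a fundamental matrix \<open>u\<close> of \<open>u' = a u\<close> with inverse \<open>z\<close> factors the operator
  \<open>\<delta>' - a\<close> as \<open>u \<delta>' z\<close>.  Multiplying by \<open>\<Theta>\<close>, the inverse of \<open>\<delta>'\<close>, from the right gives
  \<open>Id - a \<Theta> = u \<delta>' z \<Theta>\<close>, with inverse \<open>\<delta>' u \<Theta> z\<close>.\<close>

lemma separable_volterra_inverse:
  fixes a :: "nat \<Rightarrow> nat \<Rightarrow> real \<Rightarrow> complex"
  assumes a: "\<And>i j. i < n \<Longrightarrow> j < n \<Longrightarrow> smooth1 (a i j)"
    and A: "A = Matrix.mat n n (\<lambda>(i, j). Vol (\<lambda>x y. a i j x))"
  shows "\<exists>R\<in>D_mat I n. mat_inverse n (IdM n - A) R"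
proof -
  obtain u z where uz: "\<And>i j. i < n \<Longrightarrow> j < n \<Longrightarrow> smooth1 (u i j)" "\<And>i j. i < n \<Longrightarrow> j < n \<Longrightarrow> smooth1 (z i j)"
    and dz: "\<And>i j t. i < n \<Longrightarrow> j < n \<Longrightarrow> t \<in> I \<Longrightarrow> (z i j has_vector_derivative - (\<Sum>k<n. z i k t * a k j t)) (at t within I)"
    and inv: "\<And>i j t. i < n \<Longrightarrow> j < n \<Longrightarrow> t \<in> I \<Longrightarrow> (\<Sum>k<n. z i k t * u k j t) = (if i = j then 1 else 0)"
      "\<And>i j t. i < n \<Longrightarrow> j < n \<Longrightarrow> t \<in> I \<Longrightarrow> (\<Sum>k<n. u i k t * z k j t) = (if i = j then 1 else 0)"
  proof -
    obtain u z where *: "\<forall>i<n. \<forall>j<n. smooth1 (u i j) \<and> smooth1 (z i j) \<and>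
      (\<forall>t\<in>I. (z i j has_vector_derivative - (\<Sum>k<n. z i k t * a k j t)) (at t within I) \<and>
        (\<Sum>k<n. z i k t * u k j t) = (if i = j then 1 else 0) \<and>
        (\<Sum>k<n. u i k t * z k j t) = (if i = j then 1 else 0))"
      using fundamental_matrix[where a = a and n = n, OF a] by blast
    show thesis by (rule that[of u z]) (use * in blast)+
  qed
  define MU where "MU = Matrix.mat n n (\<lambda>(i, j). Mul (u i j))"
  define MZ where "MZ = Matrix.mat n n (\<lambda>(i, j). Mul (z i j))"
  define MD where "MD = Matrix.mat n n (\<lambda>(i, j). if i = j then Der else 0)"
  define MI where "MI = Matrix.mat n n (\<lambda>(i, j). if i = j then Integ else 0)"
  have Dm: "MU \<in> D_mat I n" "MZ \<in> D_mat I n" "MD \<in> D_mat I n" "MI \<in> D_mat I n"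
    using uz D_class_generators by (auto simp: D_mat_def MU_def MZ_def MD_def MI_def)
  note O = Dm[THEN D_mat_OM]
  note C = O[THEN mats_over_carrier]
  have delta: "Mul f = (if i = j then Unit else 0)" if "\<And>t. t \<in> J \<Longrightarrow> f t = (if i = j then 1 else 0)" for f and i j :: nat
    using mult_cong[of f "\<lambda>t. if i = j then 1 else 0"] that mult_one by (cases "i = j") auto
  have UZ: "mat_inverse n MU MZ"
  proof -
    have "MU \<star>\<^sub>m\<^sub>m MZ = IdM n"
    proof (rule eq_matI)
      fix i j assume "i < dim_row (IdM n)" "j < dim_col (IdM n)"
      then have ij: "i < n" "j < n" by (simp_all add: Id_star_def)
      have "(MU \<star>\<^sub>m\<^sub>m MZ) $$ (i, j) = (\<Sum>k<n. Mul (\<lambda>t. u i k t * z k j t))"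
        unfolding index_mat_star[OF C(1,2) ij]
        by (intro sum.cong refl) (use ij uz in \<open>auto simp: MU_def MZ_def mult_mult\<close>)
      also have "\<dots> = IdM n $$ (i, j)"
        unfolding mult_sum using delta[of "\<lambda>t. \<Sum>k<n. u i k t * z k j t" i j] inv(2) ij J_subset
        by (simp add: index_Id_star)
      finally show "(MU \<star>\<^sub>m\<^sub>m MZ) $$ (i, j) = IdM n $$ (i, j)" .
    qed (auto simp: mat_star_def Id_star_def MU_def MZ_def)
    moreover have "MZ \<star>\<^sub>m\<^sub>m MU = IdM n"
    proof (rule eq_matI)
      fix i j assume "i < dim_row (IdM n)" "j < dim_col (IdM n)"
      then have ij: "i < n" "j < n" by (simp_all add: Id_star_def)
      have "(MZ \<star>\<^sub>m\<^sub>m MU) $$ (i, j) = (\<Sum>k<n. Mul (\<lambda>t. z i k t * u k j t))"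
        unfolding index_mat_star[OF C(2,1) ij]
        by (intro sum.cong refl) (use ij uz in \<open>auto simp: MU_def MZ_def mult_mult\<close>)
      also have "\<dots> = IdM n $$ (i, j)"
        unfolding mult_sum using delta[of "\<lambda>t. \<Sum>k<n. z i k t * u k j t" i j] inv(1) ij J_subset
        by (simp add: index_Id_star)
      finally show "(MZ \<star>\<^sub>m\<^sub>m MU) $$ (i, j) = IdM n $$ (i, j)" .
    qed (auto simp: mat_star_def Id_star_def MU_def MZ_def)
    ultimately show ?thesis using O by (simp add: mat_inverse_def)
  qed
  have diag_right: "(X \<star>\<^sub>m\<^sub>m Matrix.mat n n (\<lambda>(i, j). if i = j then d else 0)) $$ (i, j) = X $$ (i, j) \<star> d"
    if X: "X \<in> OM n n" and ij: "i < n" "j < n" for X d i j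
  proof -
    have "(X \<star>\<^sub>m\<^sub>m Matrix.mat n n (\<lambda>(i, j). if i = j then d else 0)) $$ (i, j) =
        (\<Sum>k<n. if k = j then X $$ (i, k) \<star> d else 0)"
      unfolding index_mat_star[OF mats_over_carrier[OF X] mat_carrier ij]
      by (intro sum.cong refl) (use ij X in \<open>auto simp: mats_over_index\<close>)
    then show ?thesis using ij by simp
  qed
  have diag_left: "(Matrix.mat n n (\<lambda>(i, j). if i = j then d else 0) \<star>\<^sub>m\<^sub>m X) $$ (i, j) = d \<star> X $$ (i, j)"
    if X: "X \<in> OM n n" and ij: "i < n" "j < n" for X d i j
  proof -
    have "(Matrix.mat n n (\<lambda>(i, j). if i = j then d else 0) \<star>\<^sub>m\<^sub>m X) $$ (i, j) =
        (\<Sum>k<n. if i = k then d \<star> X $$ (k, j) else 0)"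
      unfolding index_mat_star[OF mat_carrier mats_over_carrier[OF X] ij]
      by (intro sum.cong refl) (use ij in auto)
    then show ?thesis using ij by simp
  qed
  have DI: "mat_inverse n MD MI"
  proof -
    have "(MD \<star>\<^sub>m\<^sub>m MI) $$ (i, j) = IdM n $$ (i, j) \<and> (MI \<star>\<^sub>m\<^sub>m MD) $$ (i, j) = IdM n $$ (i, j)" if ij: "i < n" "j < n" for i j
      using diag_right[OF O(3) ij, of Integ] diag_right[OF O(4) ij, of Der] ij
      by (simp add: MI_def[symmetric] MD_def[symmetric] index_Id_star)
         (auto simp: MI_def MD_def deriv_int int_deriv)
    then have "MD \<star>\<^sub>m\<^sub>m MI = IdM n" "MI \<star>\<^sub>m\<^sub>m MD = IdM n"
      by (auto intro!: eq_matI simp: mat_star_def Id_star_def MD_def MI_def)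
    then show ?thesis using O by (simp add: mat_inverse_def)
  qed
  have "IdM n - A = MU \<star>\<^sub>m\<^sub>m (MD \<star>\<^sub>m\<^sub>m (MZ \<star>\<^sub>m\<^sub>m MI))"
  proof (rule eq_matI)
    have c: "MU \<star>\<^sub>m\<^sub>m (MD \<star>\<^sub>m\<^sub>m (MZ \<star>\<^sub>m\<^sub>m MI)) \<in> carrier_mat n n" using C by simp
    show "dim_row (IdM n - A) = dim_row (MU \<star>\<^sub>m\<^sub>m (MD \<star>\<^sub>m\<^sub>m (MZ \<star>\<^sub>m\<^sub>m MI)))"
         "dim_col (IdM n - A) = dim_col (MU \<star>\<^sub>m\<^sub>m (MD \<star>\<^sub>m\<^sub>m (MZ \<star>\<^sub>m\<^sub>m MI)))" using c by (simp_all add: A)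
    fix i j assume "i < dim_row (MU \<star>\<^sub>m\<^sub>m (MD \<star>\<^sub>m\<^sub>m (MZ \<star>\<^sub>m\<^sub>m MI)))" "j < dim_col (MU \<star>\<^sub>m\<^sub>m (MD \<star>\<^sub>m\<^sub>m (MZ \<star>\<^sub>m\<^sub>m MI)))"
    then have ij: "i < n" "j < n" using c by auto
    \<comment> \<open>the derivative of the entry \<open>(k, j)\<close> of \<open>z\<close>\<close>
    define z' where "z' k = (\<lambda>t. - (\<Sum>l<n. z k l t * a l j t))" for k
    have sz': "smooth1 (z' k)" if "k < n" for k
      unfolding z'_def by (intro smooth2_minus smooth2_sum smooth2_mult uz a that ij) simp_all
    have summand: "Mul (u i k) \<star> (Der \<star> (Mul (z k j) \<star> Integ)) =
        Mul (\<lambda>t. u i k t * z' k t) \<star> Integ + Mul (\<lambda>t. u i k t * z k j t)" if k: "k < n" for k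
    proof -
      have "(z k j has_vector_derivative z' k t) (at t)" if "t \<in> J" for t
        using dz[OF k ij(2) J_subset[OF that]] by (simp add: at_within_J(2)[OF that] z'_def)
      from deriv_mult[OF uz(2)[OF k ij(2)] sz'[OF k] this]
      have "Der \<star> (Mul (z k j) \<star> Integ) = Mul (z' k) \<star> Integ + Mul (z k j)"
        using uz(2)[OF k ij(2)]
        by (simp add: star_assoc[symmetric] star_add_left) (simp add: star_assoc deriv_int star_one_right ops_mult)
      then show ?thesis
        using uz(1)[OF ij(1) k] uz(2)[OF k ij(2)] sz'[OF k]
        by (simp add: star_add_right ops_mult ops_star integ_ops star_assoc[symmetric] mult_mult)
    qed
    have "(MU \<star>\<^sub>m\<^sub>m (MD \<star>\<^sub>m\<^sub>m (MZ \<star>\<^sub>m\<^sub>m MI))) $$ (i, j) = (\<Sum>k<n. Mul (u i k) \<star> (Der \<star> (Mul (z k j) \<star> Integ)))"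
    proof -
      have DZI: "(MD \<star>\<^sub>m\<^sub>m (MZ \<star>\<^sub>m\<^sub>m MI)) $$ (k, j) = Der \<star> (Mul (z k j) \<star> Integ)" if "k < n" for k
        using diag_left[OF OM_star[OF O(2,4)] that ij(2), of Der] diag_right[OF O(2) that ij(2), of Integ] that ij
        by (simp add: MD_def[symmetric] MI_def[symmetric]) (simp add: MZ_def)
      have MU: "MU $$ (i, k) = Mul (u i k)" if "k < n" for k using that ij by (simp add: MU_def)
      show ?thesis
        unfolding index_mat_star[OF C(1) mats_over_carrier[OF OM_star[OF O(3) OM_star[OF O(2,4)]]] ij]
        by (intro sum.cong refl) (simp only: lessThan_iff DZI MU)
    qed
    also have "\<dots> = (\<Sum>k<n. Mul (\<lambda>t. u i k t * z' k t) \<star> Integ + Mul (\<lambda>t. u i k t * z k j t))"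
      by (intro sum.cong refl summand) simp
    also have "\<dots> = Mul (\<lambda>t. \<Sum>k<n. u i k t * z' k t) \<star> Integ + Mul (\<lambda>t. \<Sum>k<n. u i k t * z k j t)"
      by (simp only: sum.distrib star_sum_left[symmetric] mult_sum)
    also have "Mul (\<lambda>t. \<Sum>k<n. u i k t * z k j t) = IdM n $$ (i, j)"
      using delta[of "\<lambda>t. \<Sum>k<n. u i k t * z k j t" i j] inv(2) ij J_subset by (simp add: index_Id_star)
    also have "Mul (\<lambda>t. \<Sum>k<n. u i k t * z' k t) = Mul (\<lambda>t. - a i j t)"
    proof (rule mult_cong)
      fix t assume t: "t \<in> J"
      have "(\<Sum>k<n. u i k t * z' k t) = - (\<Sum>l<n. (\<Sum>k<n. u i k t * z k l t) * a l j t)"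
        unfolding z'_def sum_distrib_right mult_minus_right sum_negf sum_distrib_left
        by (subst sum.swap) (simp add: mult.assoc)
      also have "(\<Sum>l<n. (\<Sum>k<n. u i k t * z k l t) * a l j t) = (\<Sum>l<n. if l = i then a l j t else 0)"
        by (intro sum.cong refl) (use inv(2)[OF ij(1) _ J_subset[OF t]] in auto)
      finally show "(\<Sum>k<n. u i k t * z' k t) = - a i j t" using ij by simp
    qed
    also have "Mul (\<lambda>t. - a i j t) \<star> Integ = - A $$ (i, j)"
    proof -
      have "Mul (\<lambda>t. - a i j t) \<star> Integ = Vol (\<lambda>x y. - a i j x * 1)"
        by (rule theta_scale[OF smooth2_const smooth2_minus[OF a[OF ij]]])
      then show ?thesis using ij theta_uminus[of "\<lambda>x y. a i j x"] by (simp add: A)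
    qed
    finally have "(MU \<star>\<^sub>m\<^sub>m (MD \<star>\<^sub>m\<^sub>m (MZ \<star>\<^sub>m\<^sub>m MI))) $$ (i, j) = - A $$ (i, j) + IdM n $$ (i, j)" .
    moreover have "(IdM n - A) $$ (i, j) = IdM n $$ (i, j) - A $$ (i, j)"
      by (rule index_minus_mat(1)) (use ij in \<open>simp_all add: A\<close>)
    ultimately show "(IdM n - A) $$ (i, j) = (MU \<star>\<^sub>m\<^sub>m (MD \<star>\<^sub>m\<^sub>m (MZ \<star>\<^sub>m\<^sub>m MI))) $$ (i, j)" by simp
  qed
  moreover have "mat_inverse n (MU \<star>\<^sub>m\<^sub>m (MD \<star>\<^sub>m\<^sub>m (MZ \<star>\<^sub>m\<^sub>m MI))) (((MD \<star>\<^sub>m\<^sub>m MU) \<star>\<^sub>m\<^sub>m MI) \<star>\<^sub>m\<^sub>m MZ)"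
    by (intro mat_inverse_star UZ DI mat_inverse_sym[OF UZ] mat_inverse_sym[OF DI])
  moreover have "((MD \<star>\<^sub>m\<^sub>m MU) \<star>\<^sub>m\<^sub>m MI) \<star>\<^sub>m\<^sub>m MZ \<in> D_mat I n" by (intro D_mat_star Dm)
  ultimately show ?thesis by auto
qed

end

section \<open>Vectors of operators\<close>

definition vecs_over :: "distr set \<Rightarrow> nat \<Rightarrow> distr vec set" where
  "vecs_over S n = {x \<in> carrier_vec n. \<forall>i<n. vec_index x i \<in> S}"

lemma vecs_over_dim: "x \<in> vecs_over S n \<Longrightarrow> dim_vec x = n"
  by (auto simp: vecs_over_def)

lemma vecs_over_index: "x \<in> vecs_over S n \<Longrightarrow> i < n \<Longrightarrow> vec_index x i \<in> S"
  by (simp add: vecs_over_def)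

lemma vecs_overI: "dim_vec x = n \<Longrightarrow> (\<And>i. i < n \<Longrightarrow> vec_index x i \<in> S) \<Longrightarrow> x \<in> vecs_over S n"
  unfolding vecs_over_def mem_Collect_eq by (intro conjI allI impI carrier_vecI) assumption+

lemma vdot_sum: "dim_vec y = n \<Longrightarrow> x \<star>\<^sub>v\<^sub>v y = (\<Sum>i<n. vec_index x i \<star> vec_index y i)"
  by (simp add: vdot_def)

lemma index_vec_mat_star:
  "A \<in> carrier_mat n n \<Longrightarrow> j < n \<Longrightarrow> vec_index (x \<star>\<^sub>v\<^sub>m A) j = (\<Sum>i<n. vec_index x i \<star> A $$ (i, j))"
  by (simp add: vec_mat_star_def vdot_def)

lemma index_mat_vec_star:
  "A \<in> carrier_mat n n \<Longrightarrow> i < n \<Longrightarrow> dim_vec y = n \<Longrightarrow>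
    vec_index (A \<star>\<^sub>m\<^sub>v y) i = (\<Sum>j<n. A $$ (i, j) \<star> vec_index y j)"
  by (simp add: mat_vec_star_def vdot_def)

lemma choice_index2:
  assumes "\<And>i k. i < n \<Longrightarrow> k < n \<Longrightarrow> \<exists>c X. Q c X i k"
  shows "\<exists>c X. \<forall>i k. i < (n::nat) \<longrightarrow> k < (n::nat) \<longrightarrow> Q (c i k) (X i k) i k"
  using assms by metis

context star_interval
begin

abbreviation "OrdV k \<equiv> vecs_over (Ord k)"

lemma OrdV_ops: "x \<in> OrdV k n \<Longrightarrow> x \<in> vecs_over Ops n"
  by (auto simp: vecs_over_def Ord_ops)

lemma vdot_Ord: "x \<in> OrdV a n \<Longrightarrow> y \<in> OrdV b n \<Longrightarrow> a + b = c \<Longrightarrow> x \<star>\<^sub>v\<^sub>v y \<in> Ord c"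
  unfolding vdot_sum[OF vecs_over_dim]
  by (intro Ord_sum) (auto intro: Ord_star' vecs_over_index)

lemma vec_mat_Ord:
  assumes "x \<in> OrdV a n" "A \<in> mats_over (Ord b) n n" "a + b = c"
  shows "x \<star>\<^sub>v\<^sub>m A \<in> OrdV c n"
proof (rule vecs_overI)
  note A = mats_over_carrier[OF assms(2)]
  show "dim_vec (x \<star>\<^sub>v\<^sub>m A) = n" using A by (simp add: vec_mat_star_def)
  show "vec_index (x \<star>\<^sub>v\<^sub>m A) j \<in> Ord c" if "j < n" for j
    unfolding index_vec_mat_star[OF A that]
    by (intro Ord_sum Ord_star'[OF vecs_over_index[OF assms(1)] mats_over_index[OF assms(2)] assms(3)])
       (use that in auto)
qed

lemma mat_vec_Ord:
  assumes "y \<in> OrdV a n" "A \<in> mats_over (Ord b) n n" "b + a = c"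
  shows "A \<star>\<^sub>m\<^sub>v y \<in> OrdV c n"
proof (rule vecs_overI)
  note A = mats_over_carrier[OF assms(2)]
  show "dim_vec (A \<star>\<^sub>m\<^sub>v y) = n" using A by (simp add: mat_vec_star_def)
  show "vec_index (A \<star>\<^sub>m\<^sub>v y) i \<in> Ord c" if "i < n" for i
    unfolding index_mat_vec_star[OF A that vecs_over_dim[OF assms(1)]]
    by (intro Ord_sum Ord_star'[OF mats_over_index[OF assms(2)] vecs_over_index[OF assms(1)] assms(3)])
       (use that in auto)
qed

lemma lscale_Ord: "d \<in> Ord a \<Longrightarrow> x \<in> OrdV b n \<Longrightarrow> a + b = c \<Longrightarrow> d \<star>\<^sub>s\<^sub>v x \<in> OrdV c n"
  by (rule vecs_overI) (auto simp: lscale_def vecs_over_dim intro: Ord_star' vecs_over_index)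

lemma rscale_Ord: "x \<in> OrdV a n \<Longrightarrow> d \<in> Ord b \<Longrightarrow> a + b = c \<Longrightarrow> x \<star>\<^sub>v\<^sub>s d \<in> OrdV c n"
  by (rule vecs_overI) (auto simp: rscale_def vecs_over_dim intro: Ord_star' vecs_over_index)

lemma minus_OrdV: "x \<in> OrdV a n \<Longrightarrow> y \<in> OrdV a n \<Longrightarrow> x - y \<in> OrdV a n"
  by (rule vecs_overI) (auto simp: vecs_over_dim intro: Ord_diff vecs_over_index)

lemma zero_OrdV: "0\<^sub>v n \<in> OrdV a n"
  by (rule vecs_overI) (auto simp: Ord_zero)

lemma vdot_vec_mat:
  assumes x: "x \<in> vecs_over Ops n" and A: "A \<in> OM n n" and y: "y \<in> vecs_over Ops n"
  shows "x \<star>\<^sub>v\<^sub>m A \<star>\<^sub>v\<^sub>v y = x \<star>\<^sub>v\<^sub>v (A \<star>\<^sub>m\<^sub>v y)"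
proof -
  note cA = mats_over_carrier[OF A] and dy = vecs_over_dim[OF y]
  have dAy: "dim_vec (A \<star>\<^sub>m\<^sub>v y) = n" using cA by (simp add: mat_vec_star_def)
  have "x \<star>\<^sub>v\<^sub>m A \<star>\<^sub>v\<^sub>v y = (\<Sum>j<n. \<Sum>i<n. vec_index x i \<star> (A $$ (i, j) \<star> vec_index y j))"
    unfolding vdot_sum[OF dy] by (simp add: index_vec_mat_star[OF cA] star_sum_left star_assoc)
  also have "\<dots> = (\<Sum>i<n. \<Sum>j<n. vec_index x i \<star> (A $$ (i, j) \<star> vec_index y j))" by (rule sum.swap)
  also have "\<dots> = (\<Sum>i<n. vec_index x i \<star> (\<Sum>j<n. A $$ (i, j) \<star> vec_index y j))"
    by (intro sum.cong refl star_sum_right[symmetric] ops_star)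
       (use x A y in \<open>auto intro: vecs_over_index mats_over_index\<close>)
  also have "\<dots> = x \<star>\<^sub>v\<^sub>v (A \<star>\<^sub>m\<^sub>v y)"
    unfolding vdot_sum[OF dAy] by (intro sum.cong refl) (simp add: index_mat_vec_star[OF cA _ dy])
  finally show ?thesis .
qed

lemma vdot_diff_left: "dim_vec x = n \<Longrightarrow> dim_vec x' = n \<Longrightarrow> dim_vec y = n \<Longrightarrow>
    (x - x') \<star>\<^sub>v\<^sub>v y = x \<star>\<^sub>v\<^sub>v y - x' \<star>\<^sub>v\<^sub>v y"
  unfolding vdot_def by (simp add: star_diff_left sum_subtractf[symmetric])

lemma vdot_diff_right: "x \<in> vecs_over Ops n \<Longrightarrow> y \<in> vecs_over Ops n \<Longrightarrow> y' \<in> vecs_over Ops n \<Longrightarrow>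
    x \<star>\<^sub>v\<^sub>v (y - y') = x \<star>\<^sub>v\<^sub>v y - x \<star>\<^sub>v\<^sub>v y'"
  unfolding vdot_def by (simp add: vecs_over_dim vecs_over_index star_diff_right sum_subtractf[symmetric])

lemma vdot_lscale: "d \<in> Ops \<Longrightarrow> x \<in> vecs_over Ops n \<Longrightarrow> y \<in> vecs_over Ops n \<Longrightarrow>
    (d \<star>\<^sub>s\<^sub>v x) \<star>\<^sub>v\<^sub>v y = d \<star> (x \<star>\<^sub>v\<^sub>v y)"
  unfolding vdot_def
  by (subst star_sum_right) (auto simp: lscale_def vecs_over_dim vecs_over_index star_assoc intro: ops_star)

lemma vdot_rscale: "x \<star>\<^sub>v\<^sub>v (y \<star>\<^sub>v\<^sub>s d) = (x \<star>\<^sub>v\<^sub>v y) \<star> d"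
  unfolding vdot_def by (simp add: rscale_def star_sum_left star_assoc)

lemma const_delta_mult: "const_delta I z = Mul (\<lambda>t. z)"
  by (auto simp: const_delta_def dform_def mult_op_def fun_eq_iff)

lemma star_inverse_eqI:
  assumes g: "is_star_inverse I f g"
  shows "star_inverse I f = g"
  unfolding star_inverse_def
proof (rule the_equality[where P = "is_star_inverse I f", OF g])
  fix g' assume g': "is_star_inverse I f g'"
  have "g' = g' \<star> (f \<star> g)" using g g' by (simp add: is_star_inverse_def star_one_right D_class_ops)
  also have "\<dots> = g" using g g' unfolding star_assoc[symmetric] by (simp add: is_star_inverse_def star_one_left D_class_ops)
  finally show "g' = g" .
qed

lemma O0_matrix_volterra_tendsto:
  assumes W: "W \<in> mats_over O0 n n" and K: "K \<in> mats_over VO n n" and Y: "Y \<in> OM n n"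
    and ij: "i < n" "j < n" and t: "t \<in> J" and h: "h \<in> TF"
  shows "(\<lambda>m. ((W \<star>\<^sub>m\<^sub>m (mat_star_power I K m \<star>\<^sub>m\<^sub>m Y)) $$ (i, j)) t h) \<longlonglongrightarrow> 0"
proof -
  have KO: "K \<in> OM n n" using K by (rule mats_over_mono) (auto intro: VO_ops)
  have WO: "W \<in> OM n n" using W by (rule mats_over_mono) (auto intro: O0_ops)
  have eq: "((W \<star>\<^sub>m\<^sub>m (mat_star_power I K m \<star>\<^sub>m\<^sub>m Y)) $$ (i, j)) t h =
      (\<Sum>k<n. \<Sum>l<n. (W $$ (i, k)) t (\<lambda>s. (mat_star_power I K m $$ (k, l)) s (\<lambda>r. (Y $$ (l, j)) r h)))" for m
  proof -
    note Km = mat_power_OM[OF KO, of m]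
    have "(W \<star>\<^sub>m\<^sub>m (mat_star_power I K m \<star>\<^sub>m\<^sub>m Y)) $$ (i, j) =
        (\<Sum>k<n. W $$ (i, k) \<star> (\<Sum>l<n. mat_star_power I K m $$ (k, l) \<star> Y $$ (l, j)))"
      unfolding index_mat_star[OF mats_over_carrier[OF WO] mats_over_carrier[OF OM_star[OF Km Y]] ij]
      by (intro sum.cong refl) (simp add: index_mat_star[OF mats_over_carrier[OF Km] mats_over_carrier[OF Y] _ ij(2)])
    also have "\<dots> = (\<Sum>k<n. \<Sum>l<n. W $$ (i, k) \<star> (mat_star_power I K m $$ (k, l) \<star> Y $$ (l, j)))"
      by (intro sum.cong refl star_sum_right ops_star)
         (use ij in \<open>auto intro: mats_over_index[OF WO] mats_over_index[OF Km] mats_over_index[OF Y]\<close>)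
    finally show ?thesis by (simp add: sum_distr_apply star_def)
  qed
  have "(\<lambda>m. \<Sum>k<n. \<Sum>l<n. (W $$ (i, k)) t (\<lambda>s. (mat_star_power I K m $$ (k, l)) s (\<lambda>r. (Y $$ (l, j)) r h))) \<longlonglongrightarrow>
      (\<Sum>k<n. \<Sum>l<n. 0)"
    by (intro tendsto_sum O0_volterra_power_tendsto[OF K _ t])
       (use ij in \<open>auto intro: mats_over_index[OF W] ops_test_fun[OF mats_over_index[OF Y] h]\<close>)
  then show ?thesis unfolding eq by simp
qed

section \<open>One-sided inverses of graded matrices\<close>

lemma O0_star_ex:
  assumes "smooth1 c" "X \<in> VO" "smooth1 d" "Y \<in> VO"
  shows "\<exists>Z\<in>VO. (Mul c + X) \<star> (Mul d + Y) = Mul (\<lambda>t. c t * d t) + Z"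
  using O0_star_principal[OF assms] by blast

text \<open>In a noncommutative ring a left inverse of a square matrix need not be a right inverse.  Here the
  symbols \<open>c\<close> of the rows of \<open>W\<close> and \<open>e\<close> of the columns of \<open>V\<close> are, at each point, complex matrices with
  \<open>c e = Id\<close>, hence \<open>e c = Id\<close>.  So \<open>Id - V W\<close> has symbol \<open>0\<close>, that is, it is a Volterra matrix; being
  idempotent, it vanishes.\<close>

lemma filtered_right_inverse:
  assumes V: "V \<in> carrier_mat n n" "\<And>i k. i < n \<Longrightarrow> k < n \<Longrightarrow> V $$ (i, k) \<in> Ord (int k)"
    and W: "W \<in> carrier_mat n n" "\<And>i k. i < n \<Longrightarrow> k < n \<Longrightarrow> W $$ (k, i) \<in> Ord (- int k)"
    and WV: "W \<star>\<^sub>m\<^sub>m V = IdM n"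
  shows "V \<star>\<^sub>m\<^sub>m W = IdM n"
proof -
  have VO: "V \<in> OM n n" and WO: "W \<in> OM n n"
    by (rule mats_overI[OF V(1) Ord_ops[OF V(2)]], assumption+) (rule mats_overI[OF W(1) Ord_ops[OF W(2)]])
  have "\<exists>e Y. smooth1 e \<and> Y \<in> VO \<and> V $$ (i, k) \<star> D (- int k) = Mul e + Y" if "i < n" "k < n" for i k
    using Ord_star'[OF V(2)[OF that] deriv_pow_Ord, of "- int k" 0] by (simp add: Ord_0 O0_iff)
  from choice_index2[where Q = "\<lambda>e Y i k. smooth1 e \<and> Y \<in> VO \<and> V $$ (i, k) \<star> D (- int k) = Mul e + Y", OF this]
  obtain e Y where e: "\<And>i k. i < n \<Longrightarrow> k < n \<Longrightarrow> smooth1 (e i k) \<and> Y i k \<in> VO \<and> V $$ (i, k) \<star> D (- int k) = Mul (e i k) + Y i k"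
    by blast
  have "\<exists>c X. smooth1 c \<and> X \<in> VO \<and> D (int k) \<star> W $$ (k, i) = Mul c + X" if "i < n" "k < n" for i k
    using Ord_star'[OF deriv_pow_Ord W(2)[OF that], of "int k" 0] by (simp add: Ord_0 O0_iff)
  from choice_index2[where Q = "\<lambda>c X i k. smooth1 c \<and> X \<in> VO \<and> D (int k) \<star> W $$ (k, i) = Mul c + X", OF this]
  obtain c' X' where c': "\<And>i k. i < n \<Longrightarrow> k < n \<Longrightarrow> smooth1 (c' i k) \<and> X' i k \<in> VO \<and> D (int k) \<star> W $$ (k, i) = Mul (c' i k) + X' i k"
    by blast
  \<comment> \<open>indexed like the entries of \<open>W\<close>\<close>
  define c X where "c = (\<lambda>k i. c' i k)" and "X = (\<lambda>k i. X' i k)"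
  have c: "smooth1 (c k i) \<and> X k i \<in> VO \<and> D (int k) \<star> W $$ (k, i) = Mul (c k i) + X k i" if "i < n" "k < n" for i k
    unfolding c_def X_def by (rule c'[OF that])
  have unit: "(if i = j then Unit else 0) = Mul (\<lambda>t. if i = j then 1 else 0)" for i j :: nat
    using mult_one by simp
  have ce: "(\<Sum>i<n. c k i t * e i j t) = (if k = j then 1 else 0)" if kj: "k < n" "j < n" and t: "t \<in> J" for k j t
  proof -
    have "\<exists>Z\<in>VO. (D (int k) \<star> W $$ (k, i)) \<star> (V $$ (i, j) \<star> D (- int j)) = Mul (\<lambda>t. c k i t * e i j t) + Z" if "i < n" for i
    proof -
      have cW: "D (int k) \<star> W $$ (k, i) = Mul (c k i) + X k i" using c[OF that kj(1)] by blast
      have eV: "V $$ (i, j) \<star> D (- int j) = Mul (e i j) + Y i j" using e[OF that kj(2)] by blast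
      show ?thesis unfolding cW eV by (rule O0_star_ex) (use c[OF that kj(1)] e[OF that kj(2)] in blast)+
    qed
    then obtain Z where Z: "\<And>i. i < n \<Longrightarrow> Z i \<in> VO \<and>
        (D (int k) \<star> W $$ (k, i)) \<star> (V $$ (i, j) \<star> D (- int j)) = Mul (\<lambda>t. c k i t * e i j t) + Z i" by metis
    have "(\<Sum>i<n. (D (int k) \<star> W $$ (k, i)) \<star> (V $$ (i, j) \<star> D (- int j))) = D (int k) \<star> ((W \<star>\<^sub>m\<^sub>m V) $$ (k, j) \<star> D (- int j))"
      unfolding index_mat_star[OF W(1) V(1) kj] star_sum_left star_assoc
      by (rule star_sum_right[symmetric])
         (use kj in \<open>auto intro!: ops_star deriv_pow_ops mats_over_index[OF WO] mats_over_index[OF VO]\<close>)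
    also have "\<dots> = (if k = j then Unit else 0)"
    proof -
      have "D (int j) \<star> D (- int j) = Unit" by (simp add: deriv_pow_add[symmetric] deriv_pow_0)
      then show ?thesis using kj by (simp add: WV index_Id_star star_one_left deriv_pow_ops)
    qed
    finally have "(\<Sum>i<n. (D (int k) \<star> W $$ (k, i)) \<star> (V $$ (i, j) \<star> D (- int j))) = Mul (\<lambda>t. if k = j then 1 else 0)"
      by (simp only: unit)
    moreover have "(\<Sum>i<n. (D (int k) \<star> W $$ (k, i)) \<star> (V $$ (i, j) \<star> D (- int j))) =
        Mul (\<lambda>t. \<Sum>i<n. c k i t * e i j t) + (\<Sum>i<n. Z i)"
      using Z by (simp only: mult_sum[symmetric] sum.distrib[symmetric]) (intro sum.cong refl, simp)
    ultimately have "Mul (\<lambda>t. (\<Sum>i<n. c k i t * e i j t) - (if k = j then 1 else 0)) + (\<Sum>i<n. Z i) = 0"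
      unfolding mult_diff[symmetric] by (simp only: diff_add_eq diff_self)
    moreover have "(\<Sum>i<n. Z i) \<in> VO" using Z by (intro VO_sum) auto
    ultimately have "(\<Sum>i<n. c k i t * e i j t) - (if k = j then 1 else 0) = 0"
      using symbol_zero[of "\<lambda>t. (\<Sum>i<n. c k i t * e i j t) - (if k = j then 1 else 0)" "\<Sum>i<n. Z i" t] VO_zero t
      by (simp only:)
    then show ?thesis by simp
  qed
  have ec: "(\<Sum>k<n. e i k t * c k j t) = (if i = j then 1 else 0)" if "i < n" "j < n" "t \<in> J" for i j t
    using left_inverse_imp_right_inverse[of n "\<lambda>k i. c k i t" "\<lambda>i j. e i j t" i j] ce that by simp
  define K where "K = IdM n - V \<star>\<^sub>m\<^sub>m W"
  note VW = OM_star[OF VO WO]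
  have K: "K \<in> mats_over VO n n"
  proof (rule mats_overI)
    show "K \<in> carrier_mat n n" unfolding K_def using mats_over_carrier[OF OM_diff[OF Id_OM VW]] .
    fix i j assume ij: "i < n" "j < n"
    have "\<exists>Z\<in>VO. (V $$ (i, k) \<star> D (- int k)) \<star> (D (int k) \<star> W $$ (k, j)) = Mul (\<lambda>t. e i k t * c k j t) + Z" if "k < n" for k
    proof -
      have cW: "D (int k) \<star> W $$ (k, j) = Mul (c k j) + X k j" using c[OF ij(2) that] by blast
      have eV: "V $$ (i, k) \<star> D (- int k) = Mul (e i k) + Y i k" using e[OF ij(1) that] by blast
      show ?thesis unfolding cW eV by (rule O0_star_ex) (use c[OF ij(2) that] e[OF ij(1) that] in blast)+
    qed
    then obtain Z where Z: "\<And>k. k < n \<Longrightarrow> Z k \<in> VO \<and>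
        (V $$ (i, k) \<star> D (- int k)) \<star> (D (int k) \<star> W $$ (k, j)) = Mul (\<lambda>t. e i k t * c k j t) + Z k" by metis
    have "(V \<star>\<^sub>m\<^sub>m W) $$ (i, j) = (\<Sum>k<n. Mul (\<lambda>t. e i k t * c k j t) + Z k)"
      unfolding index_mat_star[OF V(1) W(1) ij]
    proof (intro sum.cong refl)
      fix k assume k: "k \<in> {..<n}"
      have "D (- int k) \<star> (D (int k) \<star> W $$ (k, j)) = W $$ (k, j)"
        unfolding star_assoc[symmetric] deriv_pow_add[symmetric]
        using mats_over_index[OF WO] k ij by (simp add: deriv_pow_0 star_one_left)
      then have "V $$ (i, k) \<star> W $$ (k, j) = (V $$ (i, k) \<star> D (- int k)) \<star> (D (int k) \<star> W $$ (k, j))"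
        by (simp only: star_assoc)
      then show "V $$ (i, k) \<star> W $$ (k, j) = Mul (\<lambda>t. e i k t * c k j t) + Z k" using Z k by simp
    qed
    also have "\<dots> = Mul (\<lambda>t. \<Sum>k<n. e i k t * c k j t) + (\<Sum>k<n. Z k)"
      by (simp only: sum.distrib mult_sum)
    also have "Mul (\<lambda>t. \<Sum>k<n. e i k t * c k j t) = IdM n $$ (i, j)"
      unfolding index_Id_star[OF ij] unit by (rule mult_cong) (rule ec[OF ij])
    finally have VWij: "(V \<star>\<^sub>m\<^sub>m W) $$ (i, j) = IdM n $$ (i, j) + (\<Sum>k<n. Z k)" .
    have "K $$ (i, j) = IdM n $$ (i, j) - (V \<star>\<^sub>m\<^sub>m W) $$ (i, j)"
      unfolding K_def by (rule index_minus_mat(1)) (use ij mats_over_carrier[OF VW] in auto)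
    then have "K $$ (i, j) = - (\<Sum>k<n. Z k)"
      unfolding VWij by (simp del: plus_fun_apply)
    moreover have "(\<Sum>k<n. Z k) \<in> VO" using Z by (intro VO_sum) auto
    ultimately show "K $$ (i, j) \<in> VO" using VO_uminus by simp
  qed
  have "V \<star>\<^sub>m\<^sub>m W \<star>\<^sub>m\<^sub>m (V \<star>\<^sub>m\<^sub>m W) = V \<star>\<^sub>m\<^sub>m W"
    using mat_star_assoc[OF VO WO VW] mat_star_assoc[OF WO VO WO] by (simp add: WV Id_mat_star[OF WO])
  then have VWK: "(V \<star>\<^sub>m\<^sub>m W) \<star>\<^sub>m\<^sub>m K = 0\<^sub>m n n"
    unfolding K_def mat_star_diff_right[OF Id_OM VW VW] Id_mat_star(2)[OF VW]
    using mats_over_carrier[OF VW] by simp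
  have KO: "K \<in> OM n n" unfolding K_def by (rule OM_diff[OF Id_OM VW])
  have "K \<star>\<^sub>m\<^sub>m K = K - 0\<^sub>m n n"
    using mat_star_diff_left[OF Id_OM VW KO] VWK Id_mat_star(1)[OF KO] by (simp add: K_def[symmetric])
  also have "\<dots> = K" using mats_over_carrier[OF KO] by (intro eq_matI) auto
  finally have "K = 0\<^sub>m n n" by (rule idempotent_volterra_zero[OF K])
  have "(V \<star>\<^sub>m\<^sub>m W) $$ (i, j) = IdM n $$ (i, j)" if ij: "i < n" "j < n" for i j
  proof -
    have "IdM n $$ (i, j) - (V \<star>\<^sub>m\<^sub>m W) $$ (i, j) = K $$ (i, j)"
      unfolding K_def by (rule index_minus_mat(1)[symmetric]) (use ij mats_over_carrier[OF VW] in auto)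
    also have "\<dots> = 0" unfolding \<open>K = 0\<^sub>m n n\<close> using ij by simp
    finally show ?thesis by (simp only: right_minus_eq)
  qed
  then show ?thesis
    using mats_over_carrier[OF VW] by (intro eq_matI) (simp_all add: Id_star_def)
qed

end

section \<open>The star-Lanczos algorithm\<close>

locale lanczos_run = star_interval I for I +
  fixes N :: nat and A :: "distr mat" and v w :: "complex Matrix.vec"
  assumes A: "A \<in> mats_over (order_le I (-1)) N N"
    and v: "v \<in> carrier_vec N" and w: "w \<in> carrier_vec N" and wv: "v \<bullet>c w = 1"
    and nb: "no_breakdown I A w v N"
begin

abbreviation "W k \<equiv> lanczos_w I A w v k"
abbreviation "V k \<equiv> lanczos_v I A w v k"
abbreviation "\<alpha> k \<equiv> lanczos_\<alpha> I A w v k"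
abbreviation "\<beta> k \<equiv> lanczos_\<beta> I A w v k"

text \<open>The vectors with index \<open>k - 1\<close>; those with index \<open>-1\<close> are \<open>0\<close>.\<close>

definition Wp :: "nat \<Rightarrow> distr vec" where
  "Wp k = (case k of 0 \<Rightarrow> 0\<^sub>v N | Suc j \<Rightarrow> W j)"

definition Vp :: "nat \<Rightarrow> distr vec" where
  "Vp k = (case k of 0 \<Rightarrow> 0\<^sub>v N | Suc j \<Rightarrow> V j)"

lemma dim_A: "dim_row A = N" "dim_col A = N"
  using mats_over_carrier[OF A] by auto

lemma A_OM: "A \<in> OM N N"
  using A by (rule mats_over_mono) (auto intro: Ord_ops)

lemma state: "lanczos_state I A w v k = (W k, Wp k, V k, Vp k, \<beta> k)"
proof (cases k)
  case 0
  then show ?thesis by (simp add: lanczos_w_def lanczos_v_def lanczos_\<beta>_def Wp_def Vp_def dim_A)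
next
  case (Suc j)
  then show ?thesis
    by (simp add: lanczos_w_def lanczos_v_def lanczos_\<beta>_def Wp_def Vp_def Let_def split: prod.splits)
qed

lemma W_Suc: "W (Suc k) = W k \<star>\<^sub>v\<^sub>m A - \<alpha> k \<star>\<^sub>s\<^sub>v W k - \<beta> k \<star>\<^sub>s\<^sub>v Wp k"
  unfolding lanczos_w_def[of I A w v "Suc k"] by (simp add: state Let_def lanczos_\<alpha>_def)

lemma \<beta>_Suc: "\<beta> (Suc k) = W (Suc k) \<star>\<^sub>v\<^sub>m A \<star>\<^sub>v\<^sub>v V k"
  unfolding lanczos_\<beta>_def[of I A w v "Suc k"] W_Suc by (simp add: state Let_def lanczos_\<alpha>_def)

lemma V_Suc: "V (Suc k) = (A \<star>\<^sub>m\<^sub>v V k - V k \<star>\<^sub>v\<^sub>s \<alpha> k - Vp k) \<star>\<^sub>v\<^sub>s star_inverse I (\<beta> (Suc k))"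
  unfolding lanczos_v_def[of I A w v "Suc k"] \<beta>_Suc W_Suc by (simp add: state Let_def lanczos_\<alpha>_def)

lemma init: "W 0 = map_vec (\<lambda>z. const_delta I (cnj z)) w" "V 0 = map_vec (const_delta I) v" "\<beta> 0 = 0"
  by (simp_all add: lanczos_w_def lanczos_v_def lanczos_\<beta>_def)

lemma Wp_Suc [simp]: "Wp (Suc k) = W k" "Vp (Suc k) = V k"
  by (simp_all add: Wp_def Vp_def)

lemma Wp_0: "Wp 0 = 0\<^sub>v N" "Vp 0 = 0\<^sub>v N"
  by (simp_all add: Wp_def Vp_def)

text \<open>The order count.  Multiplication by \<open>A\<close> lowers the order by one, so \<open>w\<^sub>k\<close> has order \<open>-k\<close>.  If \<open>v\<^sub>k\<close> has
  order \<open>k\<close>, then \<open>\<alpha>\<^sub>k\<close> has order \<open>-1\<close> and \<open>\<beta>\<^sub>k\<^sub>+\<^sub>1\<close> has order \<open>-2\<close>.\<close>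

lemma W_step:
  assumes "W k \<in> OrdV (- int k) N" "Wp k \<in> OrdV (1 - int k) N" "V k \<in> OrdV (int k) N" "\<beta> k \<in> Ord (-2)"
  shows "\<alpha> k \<in> Ord (-1)" "W (Suc k) \<in> OrdV (- int (Suc k)) N" "\<beta> (Suc k) \<in> Ord (-2)"
proof -
  have WA: "W k \<star>\<^sub>v\<^sub>m A \<in> OrdV (- int k - 1) N" by (rule vec_mat_Ord[OF assms(1) A]) simp
  show a: "\<alpha> k \<in> Ord (-1)" unfolding lanczos_\<alpha>_def by (rule vdot_Ord[OF WA assms(3)]) simp
  have "W (Suc k) \<in> OrdV (- int k - 1) N" unfolding W_Suc
    by (intro minus_OrdV WA lscale_Ord[OF a assms(1)] lscale_Ord[OF assms(4,2)]) simp_all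
  moreover have "- int k - 1 = - int (Suc k)" by simp
  ultimately show Wk: "W (Suc k) \<in> OrdV (- int (Suc k)) N" by (simp only:)
  have "W (Suc k) \<star>\<^sub>v\<^sub>m A \<in> OrdV (- int k - 2) N"
    by (rule vec_mat_Ord[OF Wk A]) simp
  then show "\<beta> (Suc k) \<in> Ord (-2)" unfolding \<beta>_Suc by (rule vdot_Ord[OF _ assms(3)]) simp
qed

text \<open>The nondegeneracy of \<open>\<beta>\<^sub>k\<close> on the diagonal says that its symbol of order \<open>-2\<close> has no zero, so that its
  inverse has order \<open>2\<close>.\<close>

lemma \<beta>_inverse:
  assumes "1 \<le> k" "k \<le> N - 1"
  shows "is_star_inverse I (\<beta> k) (star_inverse I (\<beta> k))"
    and "\<beta> k \<in> Ord (-2) \<Longrightarrow> star_inverse I (\<beta> k) \<in> Ord 2"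
proof -
  obtain g b where g: "is_star_inverse I (\<beta> k) g" and b: "theta_coeff I (\<beta> k) b"
    "\<forall>t\<in>I. vector_derivative (\<lambda>s. b t s) (at t within I) \<noteq> 0"
    using nb assms unfolding no_breakdown_def by blast
  have eq: "star_inverse I (\<beta> k) = g" by (rule star_inverse_eqI[OF g])
  show "is_star_inverse I (\<beta> k) (star_inverse I (\<beta> k))" unfolding eq by (rule g)
  show "star_inverse I (\<beta> k) \<in> Ord 2" if "\<beta> k \<in> Ord (-2)"
    unfolding eq
  proof (rule inverse_order_2[OF that b(1)])
    show "partial2 I b t t \<noteq> 0" if "t \<in> J" for t
      using b(2) J_subset[OF that] by (simp add: partial2_def)
    show "g \<in> D_class I" "\<beta> k \<star> g = Unit" using g by (simp_all add: is_star_inverse_def)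
  qed
qed

text \<open>Passing from \<open>v\<^sub>k\<close> to \<open>v\<^sub>k\<^sub>+\<^sub>1\<close>, multiplication by \<open>A\<close> lowers the order by one and multiplication by the
  inverse of \<open>\<beta>\<^sub>k\<^sub>+\<^sub>1\<close> raises it by two.\<close>

lemma orders:
  assumes "k < N"
  shows "W k \<in> OrdV (- int k) N" "Wp k \<in> OrdV (1 - int k) N" "V k \<in> OrdV (int k) N"
    "Vp k \<in> OrdV (int k - 1) N" "\<beta> k \<in> Ord (-2)"
proof -
  have "W k \<in> OrdV (- int k) N \<and> Wp k \<in> OrdV (1 - int k) N \<and> V k \<in> OrdV (int k) N \<and>
      Vp k \<in> OrdV (int k - 1) N \<and> \<beta> k \<in> Ord (-2)"
    using assms
  proof (induction k)
    case 0
    have "const_delta I z \<in> Ord 0" for z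
      by (simp add: const_delta_mult Ord_0 mult_O0 smooth2_const)
    then have "W 0 \<in> OrdV 0 N" "V 0 \<in> OrdV 0 N"
      using v w by (auto simp: init intro!: vecs_overI)
    moreover have "\<beta> 0 \<in> Ord (-2)" unfolding init by (rule Ord_zero)
    ultimately show ?case by (simp add: Wp_0 zero_OrdV)
  next
    case (Suc k)
    then have IH: "W k \<in> OrdV (- int k) N" "Wp k \<in> OrdV (1 - int k) N" "V k \<in> OrdV (int k) N"
      "Vp k \<in> OrdV (int k - 1) N" "\<beta> k \<in> Ord (-2)" by simp_all
    note step = W_step[OF IH(1-3,5)]
    have inv: "star_inverse I (\<beta> (Suc k)) \<in> Ord 2"
      using \<beta>_inverse(2)[of "Suc k"] Suc.prems step(3) by simp
    have Vhat: "A \<star>\<^sub>m\<^sub>v V k - V k \<star>\<^sub>v\<^sub>s \<alpha> k - Vp k \<in> OrdV (int k - 1) N"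
      by (intro minus_OrdV mat_vec_Ord[OF IH(3) A] rscale_Ord[OF IH(3) step(1)] IH(4)) simp_all
    have "V (Suc k) \<in> OrdV (int (Suc k)) N"
      unfolding V_Suc by (rule rscale_Ord[OF Vhat inv]) simp
    then show ?case using step IH by simp
  qed
  then show "W k \<in> OrdV (- int k) N" "Wp k \<in> OrdV (1 - int k) N" "V k \<in> OrdV (int k) N"
    "Vp k \<in> OrdV (int k - 1) N" "\<beta> k \<in> Ord (-2)" by blast+
qed

lemma W_ops: "k \<le> N \<Longrightarrow> W k \<in> vecs_over Ops N"
proof (cases k)
  case 0
  have "const_delta I z \<in> Ops" for z by (simp add: const_delta_mult ops_mult smooth2_const)
  then show ?thesis using w 0 by (auto simp: init intro!: vecs_overI)
next
  case (Suc j)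
  assume "k \<le> N"
  then have "j < N" using Suc by simp
  from W_step(2)[OF orders(1-3,5)[OF this]] show ?thesis unfolding Suc by (rule OrdV_ops)
qed

lemma run_ops:
  assumes "k < N"
  shows "Wp k \<in> vecs_over Ops N" "V k \<in> vecs_over Ops N" "Vp k \<in> vecs_over Ops N"
    "\<beta> k \<in> Ops" "\<alpha> k \<in> Ops"
  using orders[OF assms] W_step(1)[OF orders(1-3,5)[OF assms]] OrdV_ops Ord_ops by blast+

text \<open>The three-term recurrences, paired with an arbitrary vector on the other side.\<close>

lemma left_recurrence:
  assumes k: "k < N" and y: "y \<in> vecs_over Ops N"
  shows "W k \<star>\<^sub>v\<^sub>m A \<star>\<^sub>v\<^sub>v y = W (Suc k) \<star>\<^sub>v\<^sub>v y + \<alpha> k \<star> (W k \<star>\<^sub>v\<^sub>v y) + \<beta> k \<star> (Wp k \<star>\<^sub>v\<^sub>v y)"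
proof -
  have W: "W k \<in> vecs_over Ops N" using W_ops k by simp
  have dims: "dim_vec (W k \<star>\<^sub>v\<^sub>m A) = N" "dim_vec (\<alpha> k \<star>\<^sub>s\<^sub>v W k) = N" "dim_vec (\<beta> k \<star>\<^sub>s\<^sub>v Wp k) = N" "dim_vec y = N"
    using vecs_over_dim[OF W] vecs_over_dim[OF run_ops(1)[OF k]] vecs_over_dim[OF y]
    by (simp_all add: vec_mat_star_def dim_A lscale_def)
  have "W (Suc k) \<star>\<^sub>v\<^sub>v y = W k \<star>\<^sub>v\<^sub>m A \<star>\<^sub>v\<^sub>v y - (\<alpha> k \<star>\<^sub>s\<^sub>v W k) \<star>\<^sub>v\<^sub>v y - (\<beta> k \<star>\<^sub>s\<^sub>v Wp k) \<star>\<^sub>v\<^sub>v y"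
    unfolding W_Suc
    by (subst vdot_diff_left[where n = N], use dims in simp_all)
       (subst vdot_diff_left[where n = N], use dims in simp_all)
  also have "(\<alpha> k \<star>\<^sub>s\<^sub>v W k) \<star>\<^sub>v\<^sub>v y = \<alpha> k \<star> (W k \<star>\<^sub>v\<^sub>v y)"
    by (rule vdot_lscale[OF run_ops(5)[OF k] W y])
  also have "(\<beta> k \<star>\<^sub>s\<^sub>v Wp k) \<star>\<^sub>v\<^sub>v y = \<beta> k \<star> (Wp k \<star>\<^sub>v\<^sub>v y)"
    by (rule vdot_lscale[OF run_ops(4)[OF k] run_ops(1)[OF k] y])
  finally have eq: "W (Suc k) \<star>\<^sub>v\<^sub>v y = W k \<star>\<^sub>v\<^sub>m A \<star>\<^sub>v\<^sub>v y - \<alpha> k \<star> (W k \<star>\<^sub>v\<^sub>v y) - \<beta> k \<star> (Wp k \<star>\<^sub>v\<^sub>v y)" .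
  show ?thesis unfolding eq by (simp del: plus_fun_apply)
qed

lemma right_recurrence:
  assumes k: "Suc k < N" and x: "x \<in> vecs_over Ops N"
  shows "x \<star>\<^sub>v\<^sub>m A \<star>\<^sub>v\<^sub>v V k = (x \<star>\<^sub>v\<^sub>v V (Suc k)) \<star> \<beta> (Suc k) + (x \<star>\<^sub>v\<^sub>v V k) \<star> \<alpha> k + x \<star>\<^sub>v\<^sub>v Vp k"
proof -
  have k': "k < N" using k by simp
  define Vh where "Vh = A \<star>\<^sub>m\<^sub>v V k - V k \<star>\<^sub>v\<^sub>s \<alpha> k - Vp k"
  note o = orders[OF k'] and a = W_step(1)[OF orders(1-3,5)[OF k']]
  have AV: "A \<star>\<^sub>m\<^sub>v V k \<in> vecs_over Ops N" by (rule OrdV_ops[OF mat_vec_Ord[OF o(3) A refl]])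
  have Va: "V k \<star>\<^sub>v\<^sub>s \<alpha> k \<in> vecs_over Ops N" by (rule OrdV_ops[OF rscale_Ord[OF o(3) a refl]])
  have "A \<star>\<^sub>m\<^sub>v V k - V k \<star>\<^sub>v\<^sub>s \<alpha> k \<in> OrdV (int k - 1) N"
    by (intro minus_OrdV mat_vec_Ord[OF o(3) A] rscale_Ord[OF o(3) a]) simp_all
  note d1 = OrdV_ops[OF this] and Vh = minus_OrdV[OF this o(4), folded Vh_def]
  have inv: "star_inverse I (\<beta> (Suc k)) \<in> Ops" "star_inverse I (\<beta> (Suc k)) \<star> \<beta> (Suc k) = Unit"
    using \<beta>_inverse(1)[of "Suc k"] k by (simp_all add: is_star_inverse_def D_class_ops)
  have xV: "x \<star>\<^sub>v\<^sub>v Vh \<in> Ops"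
    unfolding vdot_sum[OF vecs_over_dim[OF OrdV_ops[OF Vh]]]
    by (intro ops_sum ops_star vecs_over_index[OF x] vecs_over_index[OF OrdV_ops[OF Vh]]) simp_all
  have "(x \<star>\<^sub>v\<^sub>v V (Suc k)) \<star> \<beta> (Suc k) = x \<star>\<^sub>v\<^sub>v Vh"
    unfolding V_Suc Vh_def[symmetric] vdot_rscale star_assoc inv(2) by (rule star_one_right[OF xV])
  also have "\<dots> = x \<star>\<^sub>v\<^sub>v (A \<star>\<^sub>m\<^sub>v V k) - (x \<star>\<^sub>v\<^sub>v V k) \<star> \<alpha> k - x \<star>\<^sub>v\<^sub>v Vp k"
    unfolding Vh_def vdot_diff_right[OF x d1 run_ops(3)[OF k']] vdot_diff_right[OF x AV Va] vdot_rscale ..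
  also have "x \<star>\<^sub>v\<^sub>v (A \<star>\<^sub>m\<^sub>v V k) = x \<star>\<^sub>v\<^sub>m A \<star>\<^sub>v\<^sub>v V k"
    by (rule vdot_vec_mat[OF x A_OM run_ops(2)[OF k'], symmetric])
  finally have eq: "(x \<star>\<^sub>v\<^sub>v V (Suc k)) \<star> \<beta> (Suc k) = x \<star>\<^sub>v\<^sub>m A \<star>\<^sub>v\<^sub>v V k - (x \<star>\<^sub>v\<^sub>v V k) \<star> \<alpha> k - x \<star>\<^sub>v\<^sub>v Vp k" .
  show ?thesis unfolding eq by (simp del: plus_fun_apply)
qed

lemma zero_vdot: "0\<^sub>v N \<star>\<^sub>v\<^sub>v y = 0" if "dim_vec y = N" for y
  using that by (simp add: vdot_def)

lemma vdot_zero: "x \<star>\<^sub>v\<^sub>v 0\<^sub>v N = 0" if "x \<in> vecs_over Ops N" for x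
  using that by (simp add: vdot_def vecs_over_index)

lemma W0_V0: "W 0 \<star>\<^sub>v\<^sub>v V 0 = Unit"
proof -
  have "W 0 \<star>\<^sub>v\<^sub>v V 0 = (\<Sum>i<N. Mul (\<lambda>t. cnj (vec_index w i) * vec_index v i))"
    using v w by (simp add: vdot_def init const_delta_mult mult_mult smooth2_const)
  also have "\<dots> = Mul (\<lambda>t. \<Sum>i<N. cnj (vec_index w i) * vec_index v i)"
    by (rule mult_sum)
  also have "(\<Sum>i<N. cnj (vec_index w i) * vec_index v i) = 1"
    using wv v w by (simp add: scalar_prod_def atLeast0LessThan mult.commute)
  finally show ?thesis by (simp only: mult_one)
qed

text \<open>Both recurrences evaluate \<open>w\<^sub>k A v\<^sub>j\<close>.  For \<open>j = k\<close> it is \<open>\<alpha>\<^sub>k\<close> by definition.  For \<open>j < k\<close> the right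
  recurrence gives \<open>\<beta>\<^sub>k\<close> if \<open>k = j + 1\<close> and \<open>0\<close> otherwise.  In each case this is what the left recurrence
  gives besides \<open>w\<^sub>k\<^sub>+\<^sub>1 v\<^sub>j\<close>, which therefore vanishes.  The last row of \<open>T = W A V\<close> uses the case
  \<open>k = N - 1\<close>, in which \<open>v\<^sub>N\<close> does not occur.\<close>

lemma biorthogonal_W_step:
  assumes k: "k < N" and IH: "\<And>i j. i \<le> k \<Longrightarrow> j \<le> k \<Longrightarrow> W i \<star>\<^sub>v\<^sub>v V j = (if i = j then Unit else 0)"
    and j: "j \<le> k"
  shows "W (Suc k) \<star>\<^sub>v\<^sub>v V j = 0"
proof -
  have jN: "j < N" using j k by simp
  note Vj = run_ops(2)[OF jN] and Wk = W_ops[OF less_imp_le[OF k]]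
  have Wp: "Wp k \<star>\<^sub>v\<^sub>v V j = (if k = Suc j then Unit else 0)"
  proof (cases k)
    case 0
    then show ?thesis using zero_vdot[OF vecs_over_dim[OF Vj]] by (simp add: Wp_0)
  next
    case (Suc m)
    then show ?thesis using IH[of m j] j by simp
  qed
  have Vp: "W k \<star>\<^sub>v\<^sub>v Vp j = 0"
  proof (cases j)
    case 0
    then show ?thesis using vdot_zero[OF Wk] by (simp add: Wp_0)
  next
    case (Suc m)
    then show ?thesis using IH[of k m] j by simp
  qed
  have eq: "W k \<star>\<^sub>v\<^sub>m A \<star>\<^sub>v\<^sub>v V j = W (Suc k) \<star>\<^sub>v\<^sub>v V j + \<alpha> k \<star> (if k = j then Unit else 0) + \<beta> k \<star> (if k = Suc j then Unit else 0)"
    using left_recurrence[OF k Vj] unfolding Wp IH[OF order_refl j] .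
  show ?thesis
  proof (cases "j = k")
    case True
    then have "\<alpha> k = W (Suc k) \<star>\<^sub>v\<^sub>v V j + \<alpha> k"
      using eq run_ops(4,5)[OF k] by (simp add: lanczos_\<alpha>_def[symmetric] star_one_right)
    then show ?thesis by (simp only: add_cancel_right_left)
  next
    case False
    then have j': "Suc j \<le> k" "Suc j < N" using j k by simp_all
    have "W k \<star>\<^sub>v\<^sub>m A \<star>\<^sub>v\<^sub>v V j = (if k = Suc j then \<beta> k else 0)"
      using right_recurrence[OF j'(2) Wk] run_ops(4,5)[OF j'(2)] False
      unfolding Vp IH[OF order_refl j'(1)] IH[OF order_refl j] by (simp add: star_one_left)
    moreover have "\<alpha> k \<star> (if k = j then Unit else 0) = 0" using False run_ops(5)[OF k] by simp
    moreover have "\<beta> k \<star> (if k = Suc j then Unit else 0) = (if k = Suc j then \<beta> k else 0)"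
      using run_ops(4)[OF k] star_one_right[OF run_ops(4)[OF k]] by (simp only: star_zero_right split: if_split) simp
    ultimately have "(if k = Suc j then \<beta> k else 0) = W (Suc k) \<star>\<^sub>v\<^sub>v V j + (if k = Suc j then \<beta> k else 0)"
      using eq by (simp only: add_0_right)
    then show ?thesis by (simp only: add_cancel_right_left)
  qed
qed

text \<open>The products of \<open>v\<^sub>k\<^sub>+\<^sub>1\<close> with the earlier left vectors are found in the same way, now after
  cancelling the invertible factor \<open>\<beta>\<^sub>k\<^sub>+\<^sub>1\<close>, and the diagonal one by the definition of \<open>\<beta>\<^sub>k\<^sub>+\<^sub>1\<close>.\<close>

lemma biorthogonal: "k < N \<Longrightarrow> i \<le> k \<Longrightarrow> j \<le> k \<Longrightarrow> W i \<star>\<^sub>v\<^sub>v V j = (if i = j then Unit else 0)"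
proof (induction k arbitrary: i j)
  case 0
  then show ?case by (simp add: W0_V0)
next
  case (Suc k)
  then have k: "k < N" by simp
  have IH: "W i \<star>\<^sub>v\<^sub>v V j = (if i = j then Unit else 0)" if "i \<le> k" "j \<le> k" for i j
    by (rule Suc.IH[OF k that])
  have Wstep: "W (Suc k) \<star>\<^sub>v\<^sub>v V j = 0" if "j \<le> k" for j
    by (rule biorthogonal_W_step[OF k _ that]) (rule IH)
  have cancel: "x = 0" if "x \<star> \<beta> (Suc k) = 0" "x \<in> Ops" for x
  proof -
    have inv: "star_inverse I (\<beta> (Suc k)) \<in> Ops" "\<beta> (Suc k) \<star> star_inverse I (\<beta> (Suc k)) = Unit"
      using \<beta>_inverse(1)[of "Suc k"] Suc.prems by (simp_all add: is_star_inverse_def D_class_ops)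
    have "x = (x \<star> \<beta> (Suc k)) \<star> star_inverse I (\<beta> (Suc k))"
      unfolding star_assoc inv(2) using that(2) by (simp only: star_one_right)
    then show ?thesis unfolding that(1) by simp
  qed
  have WV_ops: "W i \<star>\<^sub>v\<^sub>v V (Suc k) \<in> Ops" if "i \<le> N" for i
    unfolding vdot_sum[OF vecs_over_dim[OF run_ops(2)[OF Suc.prems(1)]]]
    by (intro ops_sum ops_star vecs_over_index[OF W_ops[OF that]] vecs_over_index[OF run_ops(2)[OF Suc.prems(1)]]) simp_all
  have Vp0: "x \<star>\<^sub>v\<^sub>v Vp k = (if i = k - 1 \<and> k \<noteq> 0 then Unit else 0)" if "x = W i" "i \<le> k" for x i
  proof (cases k)
    case 0
    then show ?thesis using vdot_zero[OF W_ops[of i]] that k by (simp add: Wp_0)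
  next
    case (Suc m)
    then show ?thesis using IH[OF that(2), of m] that by simp
  qed
  have below: "W i \<star>\<^sub>v\<^sub>v V (Suc k) = 0" if i: "i \<le> k" for i
  proof (rule cancel)
    have iN: "i < N" "i \<le> N" using i k by simp_all
    have right: "W i \<star>\<^sub>v\<^sub>m A \<star>\<^sub>v\<^sub>v V k = (W i \<star>\<^sub>v\<^sub>v V (Suc k)) \<star> \<beta> (Suc k) + (if i = k then Unit else 0) \<star> \<alpha> k + (if i = k - 1 \<and> k \<noteq> 0 then Unit else 0)"
      using right_recurrence[OF Suc.prems(1) W_ops[OF iN(2)]] unfolding IH[OF i order_refl] Vp0[OF refl i] .
    show "(W i \<star>\<^sub>v\<^sub>v V (Suc k)) \<star> \<beta> (Suc k) = 0"
    proof (cases "i = k")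
      case True
      have none: "(i = k - 1 \<and> k \<noteq> 0) = False" using True by auto
      have one: "(if i = k then Unit else 0) \<star> \<alpha> k = \<alpha> k" using True run_ops(5)[OF k] by (simp add: star_one_left)
      have "W i \<star>\<^sub>v\<^sub>m A \<star>\<^sub>v\<^sub>v V k = \<alpha> k" unfolding True lanczos_\<alpha>_def ..
      then have "\<alpha> k = (W i \<star>\<^sub>v\<^sub>v V (Suc k)) \<star> \<beta> (Suc k) + \<alpha> k"
        using right unfolding none one if_False add_0_right by (simp only:)
      then show ?thesis by (simp only: add_cancel_right_left)
    next
      case False
      then have i': "Suc i \<le> k" using i by simp
      have Wp: "Wp i \<star>\<^sub>v\<^sub>v V k = 0"
      proof (cases i)
        case 0
        then show ?thesis using zero_vdot[OF vecs_over_dim[OF run_ops(2)[OF k]]] by (simp add: Wp_0)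
      next
        case (Suc m)
        then show ?thesis using IH[of m k] i' by simp
      qed
      have "W i \<star>\<^sub>v\<^sub>m A \<star>\<^sub>v\<^sub>v V k = (if Suc i = k then Unit else 0)"
        using left_recurrence[OF iN(1) run_ops(2)[OF k]] run_ops(4,5)[OF iN(1)] False
        unfolding Wp IH[OF i' order_refl] IH[OF i order_refl] by simp
      moreover have "(i = k - 1 \<and> k \<noteq> 0) = (Suc i = k)" using i' by auto
      ultimately have "(if Suc i = k then Unit else 0) = (W i \<star>\<^sub>v\<^sub>v V (Suc k)) \<star> \<beta> (Suc k) + (if Suc i = k then Unit else 0)"
        using right False by simp
      then show ?thesis by (simp only: add_cancel_right_left)
    qed
    show "W i \<star>\<^sub>v\<^sub>v V (Suc k) \<in> Ops" by (rule WV_ops[OF iN(2)])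
  qed
  have diag: "W (Suc k) \<star>\<^sub>v\<^sub>v V (Suc k) = Unit"
  proof -
    have le: "Suc k \<le> N" using k by simp
    have Vp: "W (Suc k) \<star>\<^sub>v\<^sub>v Vp k = 0"
    proof (cases k)
      case 0
      then show ?thesis using vdot_zero[OF W_ops[OF le]] by (simp add: Wp_0)
    next
      case (Suc m)
      then show ?thesis using Wstep[of m] by simp
    qed
    have "\<beta> (Suc k) = (W (Suc k) \<star>\<^sub>v\<^sub>v V (Suc k)) \<star> \<beta> (Suc k)"
      using right_recurrence[OF Suc.prems(1) W_ops[OF le]] unfolding Vp Wstep[OF order_refl] \<beta>_Suc[symmetric]
      by (simp del: plus_fun_apply)
    then have "(W (Suc k) \<star>\<^sub>v\<^sub>v V (Suc k) - Unit) \<star> \<beta> (Suc k) = 0"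
      unfolding star_diff_left star_one_left[OF run_ops(4)[OF Suc.prems(1)]] by (simp only: right_minus_eq)
    from cancel[OF this] have "W (Suc k) \<star>\<^sub>v\<^sub>v V (Suc k) - Unit = 0"
      using WV_ops[OF le] by (simp only: ops_diff ops_one)
    then show ?thesis by (simp only: right_minus_eq)
  qed
  show ?case
  proof (cases "i = Suc k")
    case True
    then show ?thesis using Wstep[of j] diag Suc.prems by (cases "j = Suc k") auto
  next
    case False
    then have "i \<le> k" using Suc.prems by simp
    then show ?thesis using below[of i] IH[of i j] Suc.prems by (cases "j = Suc k") auto
  qed
qed

abbreviation "VM \<equiv> lanczos_V I A w v N"
abbreviation "WM \<equiv> lanczos_WH I A w v N"
abbreviation "TM \<equiv> lanczos_T I A w v N"

lemma matrices_carrier: "VM \<in> carrier_mat N N" "WM \<in> carrier_mat N N" "TM \<in> carrier_mat N N"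
  by (simp_all add: lanczos_V_def lanczos_WH_def lanczos_T_def dim_A)

lemma index_VM: "i < N \<Longrightarrow> k < N \<Longrightarrow> VM $$ (i, k) = vec_index (V k) i"
  by (simp add: lanczos_V_def dim_A)

lemma index_WM: "i < N \<Longrightarrow> k < N \<Longrightarrow> WM $$ (k, i) = vec_index (W k) i"
  by (simp add: lanczos_WH_def dim_A)

lemma VM_Ord: "i < N \<Longrightarrow> k < N \<Longrightarrow> VM $$ (i, k) \<in> Ord (int k)"
  unfolding index_VM by (rule vecs_over_index[OF orders(3)])

lemma WM_Ord: "i < N \<Longrightarrow> k < N \<Longrightarrow> WM $$ (k, i) \<in> Ord (- int k)"
  unfolding index_WM by (rule vecs_over_index[OF orders(1)])

lemma VM_D: "VM \<in> D_mat I N" and WM_D: "WM \<in> D_mat I N" and A_D: "A \<in> D_mat I N"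
  unfolding D_mat_eq
  by (rule mats_overI[OF matrices_carrier(1) Ord_D_class[OF VM_Ord]], assumption+)
     (rule mats_overI[OF matrices_carrier(2) Ord_D_class[OF WM_Ord]], assumption+,
      rule mats_overI[OF mats_over_carrier[OF A] Ord_D_class[OF mats_over_index[OF A]]])

lemma vdot_index: "i < N \<Longrightarrow> j < N \<Longrightarrow> (\<Sum>l<N. WM $$ (i, l) \<star> VM $$ (l, j)) = W i \<star>\<^sub>v\<^sub>v V j"
  using vdot_sum[OF vecs_over_dim[OF run_ops(2)[of j]]] by (simp add: index_VM index_WM)

lemma WM_VM: "WM \<star>\<^sub>m\<^sub>m VM = IdM N"
proof (rule eq_matI)
  fix i j assume "i < dim_row (IdM N)" "j < dim_col (IdM N)"
  then have ij: "i < N" "j < N" by (simp_all add: Id_star_def)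
  show "(WM \<star>\<^sub>m\<^sub>m VM) $$ (i, j) = IdM N $$ (i, j)"
    unfolding index_mat_star[OF matrices_carrier(2,1) ij] vdot_index[OF ij] index_Id_star[OF ij]
    by (rule biorthogonal[of "N - 1"]) (use ij in auto)
qed (simp_all add: mat_star_def Id_star_def lanczos_V_def lanczos_WH_def)

lemma VM_WM: "VM \<star>\<^sub>m\<^sub>m WM = IdM N"
  by (rule filtered_right_inverse[OF matrices_carrier(1) VM_Ord matrices_carrier(2) WM_Ord WM_VM])

text \<open>Pairing the left recurrence with \<open>v\<^sub>j\<close> gives the entries of \<open>W A V\<close>.  The last row needs \<open>w\<^sub>N v\<^sub>j = 0\<close>.\<close>

lemma TM_eq: "TM = WM \<star>\<^sub>m\<^sub>m (A \<star>\<^sub>m\<^sub>m VM)"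
proof (rule eq_matI)
  note cA = mats_over_carrier[OF A]
  note cAV = mat_star_carrier[OF cA matrices_carrier(1)]
  note cWAV = mat_star_carrier[OF matrices_carrier(2) cAV]
  show "dim_row TM = dim_row (WM \<star>\<^sub>m\<^sub>m (A \<star>\<^sub>m\<^sub>m VM))" "dim_col TM = dim_col (WM \<star>\<^sub>m\<^sub>m (A \<star>\<^sub>m\<^sub>m VM))"
    using cWAV matrices_carrier by auto
  fix i j assume "i < dim_row (WM \<star>\<^sub>m\<^sub>m (A \<star>\<^sub>m\<^sub>m VM))" "j < dim_col (WM \<star>\<^sub>m\<^sub>m (A \<star>\<^sub>m\<^sub>m VM))"
  then have i: "i < N" and j: "j < N" using cWAV by auto
  note Vj = run_ops(2)[OF j]
  have dAV: "dim_vec (A \<star>\<^sub>m\<^sub>v V j) = N" by (simp add: mat_vec_star_def dim_A)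
  have "(WM \<star>\<^sub>m\<^sub>m (A \<star>\<^sub>m\<^sub>m VM)) $$ (i, j) = (\<Sum>l<N. vec_index (W i) l \<star> vec_index (A \<star>\<^sub>m\<^sub>v V j) l)"
    unfolding index_mat_star[OF matrices_carrier(2) cAV i j]
    by (intro sum.cong refl)
       (simp add: index_mat_star[OF cA matrices_carrier(1) _ j] index_WM i index_VM j
         index_mat_vec_star[OF cA _ vecs_over_dim[OF Vj]])
  also have "\<dots> = W i \<star>\<^sub>v\<^sub>v (A \<star>\<^sub>m\<^sub>v V j)" by (rule vdot_sum[OF dAV, symmetric])
  also have "\<dots> = W i \<star>\<^sub>v\<^sub>m A \<star>\<^sub>v\<^sub>v V j"
    by (rule vdot_vec_mat[OF W_ops[OF less_imp_le[OF i]] A_OM Vj, symmetric])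
  also have "\<dots> = W (Suc i) \<star>\<^sub>v\<^sub>v V j + \<alpha> i \<star> (W i \<star>\<^sub>v\<^sub>v V j) + \<beta> i \<star> (Wp i \<star>\<^sub>v\<^sub>v V j)"
    by (rule left_recurrence[OF i Vj])
  also have "W i \<star>\<^sub>v\<^sub>v V j = (if i = j then Unit else 0)"
    by (rule biorthogonal[of "N - 1"]) (use i j in auto)
  also have "W (Suc i) \<star>\<^sub>v\<^sub>v V j = (if Suc i = j then Unit else 0)"
  proof (cases "Suc i < N")
    case True
    then show ?thesis using biorthogonal[of "N - 1" "Suc i" j] j by auto
  next
    case False
    then have "i = N - 1" using i by simp
    then show ?thesis
      using biorthogonal_W_step[OF i biorthogonal[OF i], of j] j by auto
  qed
  also have "Wp i \<star>\<^sub>v\<^sub>v V j = (if i = Suc j then Unit else 0)"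
  proof (cases i)
    case 0
    then show ?thesis using zero_vdot[OF vecs_over_dim[OF Vj]] by (simp add: Wp_0)
  next
    case (Suc m)
    then show ?thesis using biorthogonal[of "N - 1" m j] i j by auto
  qed
  finally have "(WM \<star>\<^sub>m\<^sub>m (A \<star>\<^sub>m\<^sub>m VM)) $$ (i, j) = (if Suc i = j then Unit else 0) +
      \<alpha> i \<star> (if i = j then Unit else 0) + \<beta> i \<star> (if i = Suc j then Unit else 0)" .
  then show "TM $$ (i, j) = (WM \<star>\<^sub>m\<^sub>m (A \<star>\<^sub>m\<^sub>m VM)) $$ (i, j)"
    using i j run_ops(4,5)[OF i] by (auto simp: lanczos_T_def star_one_right simp del: plus_fun_apply zero_fun_apply)
qed

lemma power_eq: "mat_star_power I A j = VM \<star>\<^sub>m\<^sub>m mat_star_power I TM j \<star>\<^sub>m\<^sub>m WM"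
proof -
  note VO = D_mat_OM[OF VM_D] and WO = D_mat_OM[OF WM_D] and Aj = mat_power_OM[OF A_OM, of j]
  have "mat_star_power I TM j = WM \<star>\<^sub>m\<^sub>m (mat_star_power I A j \<star>\<^sub>m\<^sub>m VM)"
    by (rule similar_mat_power[OF A_OM VO WO WM_VM VM_WM TM_eq])
  then have "VM \<star>\<^sub>m\<^sub>m mat_star_power I TM j = (VM \<star>\<^sub>m\<^sub>m WM) \<star>\<^sub>m\<^sub>m (mat_star_power I A j \<star>\<^sub>m\<^sub>m VM)"
    by (simp add: mat_star_assoc[OF VO WO OM_star[OF Aj VO]])
  also have "\<dots> = mat_star_power I A j \<star>\<^sub>m\<^sub>m VM" by (simp add: VM_WM Id_mat_star[OF OM_star[OF Aj VO]])
  finally have "VM \<star>\<^sub>m\<^sub>m mat_star_power I TM j \<star>\<^sub>m\<^sub>m WM = mat_star_power I A j \<star>\<^sub>m\<^sub>m (VM \<star>\<^sub>m\<^sub>m WM)"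
    by (simp add: mat_star_assoc[OF Aj VO WO])
  then show ?thesis by (simp add: VM_WM Id_mat_star[OF Aj])
qed

text \<open>Conjugation by \<open>V\<close> and \<open>W\<close> carries the resolvent of \<open>A\<close> to that of \<open>T\<close>.  For the convergence of the series
  for \<open>T\<close> it matters that the entries of \<open>W\<close> have order at most \<open>0\<close>: the powers of \<open>T\<close> are \<open>W A\<^sup>m V\<close>.\<close>

lemma resolvents:
  assumes R: "R \<in> D_mat I N" "mat_inverse N (IdM N - A) R"
  shows "is_star_resolvent I A R"
    and "is_star_resolvent I TM ((WM \<star>\<^sub>m\<^sub>m R) \<star>\<^sub>m\<^sub>m VM)"
proof -
  note VO = D_mat_OM[OF VM_D] and WO = D_mat_OM[OF WM_D] and RO = D_mat_OM[OF R(1)]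
  have K: "A \<in> mats_over VO N N" using A by (simp add: Ord_neg1)
  have Id0: "IdM N \<in> mats_over O0 N N"
    by (rule mats_overI) (simp_all add: index_Id_star unit_O0 VO_O0 VO_zero del: zero_fun_apply)
  have W0: "WM \<in> mats_over O0 N N"
  proof (rule mats_overI[OF matrices_carrier(2)])
    show "WM $$ (i, j) \<in> O0" if "i < N" "j < N" for i j
      using Ord_mono[OF WM_Ord[OF that(2,1)], of 0] by (simp add: Ord_0)
  qed
  show "is_star_resolvent I A R"
  proof (rule is_star_resolventI[OF A_D R(1)])
    show "R \<star>\<^sub>m\<^sub>m (IdM N - A) = IdM N" "(IdM N - A) \<star>\<^sub>m\<^sub>m R = IdM N" using R(2) by (simp_all add: mat_inverse_def)
    fix i j t h assume ij: "i < N" "j < N" and t: "t \<in> J" and h: "h \<in> TF"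
    have "IdM N \<star>\<^sub>m\<^sub>m (mat_star_power I A m \<star>\<^sub>m\<^sub>m R) = mat_star_power I A m \<star>\<^sub>m\<^sub>m R" for m
      by (rule Id_mat_star(1)[OF OM_star[OF mat_power_OM[OF A_OM] RO]])
    then show "(\<lambda>m. ((mat_star_power I A m \<star>\<^sub>m\<^sub>m R) $$ (i, j)) t h) \<longlonglongrightarrow> 0"
      using O0_matrix_volterra_tendsto[OF Id0 K RO ij t h] by (simp only:)
  qed
  define RT where "RT = (WM \<star>\<^sub>m\<^sub>m R) \<star>\<^sub>m\<^sub>m VM"
  have RT: "RT \<in> D_mat I N" unfolding RT_def by (intro D_mat_star WM_D VM_D R)
  have T_D: "TM \<in> D_mat I N" unfolding TM_eq by (intro D_mat_star WM_D VM_D A_D)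
  have WV: "mat_inverse N WM VM" using VO WO by (simp add: mat_inverse_def WM_VM VM_WM)
  have "IdM N - TM = WM \<star>\<^sub>m\<^sub>m ((IdM N - A) \<star>\<^sub>m\<^sub>m VM)"
    unfolding mat_star_diff_left[OF Id_OM A_OM VO] Id_mat_star(1)[OF VO]
      mat_star_diff_right[OF VO OM_star[OF A_OM VO] WO] WM_VM TM_eq ..
  moreover have "mat_inverse N (WM \<star>\<^sub>m\<^sub>m ((IdM N - A) \<star>\<^sub>m\<^sub>m VM)) ((WM \<star>\<^sub>m\<^sub>m R) \<star>\<^sub>m\<^sub>m VM)"
    by (intro mat_inverse_star WV R(2) mat_inverse_sym[OF WV])
  ultimately have inv: "mat_inverse N (IdM N - TM) RT" by (simp only: RT_def)
  have "is_star_resolvent I TM RT"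
  proof (rule is_star_resolventI[OF T_D RT])
    show "RT \<star>\<^sub>m\<^sub>m (IdM N - TM) = IdM N" "(IdM N - TM) \<star>\<^sub>m\<^sub>m RT = IdM N" using inv by (simp_all add: mat_inverse_def)
    fix i j t h assume ij: "i < N" "j < N" and t: "t \<in> J" and h: "h \<in> TF"
    have eq: "mat_star_power I TM m \<star>\<^sub>m\<^sub>m RT = WM \<star>\<^sub>m\<^sub>m (mat_star_power I A m \<star>\<^sub>m\<^sub>m (VM \<star>\<^sub>m\<^sub>m RT))" for m
    proof -
      note Am = mat_power_OM[OF A_OM, of m] and RTO = D_mat_OM[OF RT]
      have "mat_star_power I TM m = WM \<star>\<^sub>m\<^sub>m (mat_star_power I A m \<star>\<^sub>m\<^sub>m VM)"
        by (rule similar_mat_power[OF A_OM VO WO WM_VM VM_WM TM_eq])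
      then show ?thesis
        by (simp only: mat_star_assoc[OF WO OM_star[OF Am VO] RTO] mat_star_assoc[OF Am VO RTO])
    qed
    show "(\<lambda>m. ((mat_star_power I TM m \<star>\<^sub>m\<^sub>m RT) $$ (i, j)) t h) \<longlonglongrightarrow> 0"
      unfolding eq by (rule O0_matrix_volterra_tendsto[OF W0 K OM_star[OF VO D_mat_OM[OF RT]] ij t h])
  qed
  then show "is_star_resolvent I TM ((WM \<star>\<^sub>m\<^sub>m R) \<star>\<^sub>m\<^sub>m VM)" by (simp only: RT_def)
qed

end

theorem theorem2p3:
  fixes I :: "real set" and N :: nat
    and A_tilde :: "real \<Rightarrow> complex mat"
    and v w :: "complex Matrix.vec"
    and A :: "distr mat"
  assumes "is_interval I" and "interior I \<noteq> {}"
    and "\<forall>t\<in>I. A_tilde t \<in> carrier_mat N N"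
    and "\<forall>i<N. \<forall>j<N. smooth2_on I (\<lambda>t' t. A_tilde t' $$ (i, j))"
    and "A = Matrix.mat N N (\<lambda>(i, j). theta I (\<lambda>t' t. A_tilde t' $$ (i, j)))"
    and "v \<in> carrier_vec N" and "w \<in> carrier_vec N"
    and "v \<bullet>c w = 1"
    and "no_breakdown I A w v N"
  shows "(\<forall>j. mat_star_power I A j =
            lanczos_V I A w v N \<star>\<^sub>m\<^sub>m mat_star_power I (lanczos_T I A w v N) j
              \<star>\<^sub>m\<^sub>m lanczos_WH I A w v N) \<and>
         has_star_resolvent I A \<and> has_star_resolvent I (lanczos_T I A w v N) \<and>
         star_resolvent I A =
            lanczos_V I A w v N \<star>\<^sub>m\<^sub>m star_resolvent I (lanczos_T I A w v N)
              \<star>\<^sub>m\<^sub>m lanczos_WH I A w v N"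
proof -
  interpret star_interval I by (rule star_interval.intro) (use assms in auto)
  have a: "smooth2_on I (\<lambda>x y. A_tilde x $$ (i, j))" if "i < N" "j < N" for i j
    using assms(4) that by blast
  have "A \<in> mats_over (order_le I (-1)) N N"
    unfolding Ord_neg1 by (rule mats_overI) (use a VOI in \<open>auto simp: assms(5)\<close>)
  then interpret lanczos_run I N A v w
    by (intro lanczos_run.intro lanczos_run_axioms.intro star_interval_axioms assms)
  obtain R where R: "R \<in> D_mat I N" "mat_inverse N (IdM N - A) R"
    using separable_volterra_inverse[where a = "\<lambda>i j x. A_tilde x $$ (i, j)" and n = N, OF a assms(5)] by blast
  note RA = resolvents(1)[OF R] and RT = resolvents(2)[OF R]
  note VO = D_mat_OM[OF VM_D] and WO = D_mat_OM[OF WM_D] and RO = D_mat_OM[OF R(1)]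
  have "VM \<star>\<^sub>m\<^sub>m star_resolvent I TM \<star>\<^sub>m\<^sub>m WM = VM \<star>\<^sub>m\<^sub>m ((WM \<star>\<^sub>m\<^sub>m R) \<star>\<^sub>m\<^sub>m VM) \<star>\<^sub>m\<^sub>m WM"
    by (simp only: star_resolvent_eqI[OF RT])
  also have "\<dots> = (VM \<star>\<^sub>m\<^sub>m WM) \<star>\<^sub>m\<^sub>m (R \<star>\<^sub>m\<^sub>m (VM \<star>\<^sub>m\<^sub>m WM))"
    by (simp only: mat_star_assoc[OF VO OM_star[OF OM_star[OF WO RO] VO] WO] mat_star_assoc[OF OM_star[OF WO RO] VO WO]
        mat_star_assoc[OF WO RO OM_star[OF VO WO]] mat_star_assoc[OF VO WO OM_star[OF RO OM_star[OF VO WO]]])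
  also have "\<dots> = star_resolvent I A"
    unfolding VM_WM Id_mat_star(2)[OF RO] Id_mat_star(1)[OF RO] star_resolvent_eqI[OF RA] ..
  finally show ?thesis using power_eq RA RT unfolding has_star_resolvent_def by metis
qed

end
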